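(* Let $\alpha(\mathbf{x})=\frac{1}{4\pi}\sum_{d}w_d\,|\boldsymbol{\Omega}_d\cdot\mathbf{n}(\mathbf{x})|$ for $\mathbf{x}\in\Gamma\in\mathcal{F}$, and assume that $\alpha$ is uniformly bounded away from zero on each interior and boundary mesh face. Let $D_\varepsilon=\frac1\varepsilon F_0+D_0$ be the symmetric interior penalty (SIP) DSA matrix and let $S_\varepsilon$ be the source-iteration (sweep) matrix. Then, as $\varepsilon\to0$, $$\left(\varepsilon^{2}D_{\varepsilon}\right)^{-1}M_{t}\left(I-S_{\varepsilon}\right)=I+\mathcal{O}\left(\varepsilon\right).$$
   Context: Setting. Let $\mathcal{D}\subset\mathbb{R}^n$, $n\le 3$, be a spatial domain decomposed into a finite set $\mathcal{E}$ of (possibly curved) elements $\kappa$, each the image of a reference element $\hat\kappa$, and let $\mathcal{F}$ be the set of interior and boundary element faces. $\mathcal{U}$ is the discontinuous Galerkin space of functions in $L^2(\mathcal{D})$ whose pullback to the reference element is, on each element, a polynomial of fixed degree $r$; $N=\dim\mathcal{U}$, a basis of $\mathcal{U}$ is fixed, and $\mathbf{u},\mathbf{v}\in\mathbb{R}^N$ denote the coefficient vectors of $u,v\in\mathcal{U}$. Each face has a fixed (arbitrary sign) unit normal $\mathbf{n}$; on an interior face shared by $\kappa,\kappa'$ with $\mathbf{n}$ pointing from $\kappa$ to $\kappa'$, $\llbracket u\rrbracket=u_\kappa-u_{\kappa'}$ and $\{u\}=(u_\kappa+u_{\kappa'})/2$; on a boundary face of $\kappa$ ($\mathbf n$ outward),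 $\llbracket u\rrbracket=u_\kappa$ and $\{u\}=u_\kappa$. Angular quadrature: directions $\boldsymbol{\Omega}_d\in\mathbb{S}^2$ and weights $w_d>0$, $d=1,\dots,N_\Omega$ (if $n<3$ only the first $n$ components of $\boldsymbol\Omega_d$ are used in spatial expressions). Each $\boldsymbol{\Omega}_d$ has a reversed direction $\boldsymbol\Omega_{d'}=-\boldsymbol\Omega_d$ with $w_{d'}=w_d$, and $\sum_d w_d=4\pi$, $\sum_d w_d\boldsymbol\Omega_d\boldsymbol\Omega_d^T=\frac{4\pi}{3}I$, $\sum_d w_d\boldsymbol\Omega_d=\mathbf 0$, $\sum_d w_d\boldsymbol\Omega_d|\boldsymbol\Omega_d\cdot\mathbf n|=\mathbf 0$. Matrices ($\sigma_t>0$ total opacity, $\sigma_a$ absorption opacity, both given functions independent of $\varepsilon$): $\mathbf{G}=(G_1,\dots,G_n)$ is a vector of $N\times N$ matrices, $\boldsymbol\Omega_d\cdot\mathbf G=\sum_j(\boldsymbol\Omega_d)_jG_j$, and $$\mathbf v^T(\boldsymbol\Omega_d\cdot\mathbf G)\mathbf u=\sum_{\kappa\in\mathcal E}\int_\kappa(\boldsymbol\Omega_d\cdot\nabla u)v\,d\mathbf x,\quad \mathbf v^TM_t\mathbf u=\sum_\kappa\int_\kappa\sigma_tuv\,d\mathbf x,\quad \mathbf v^TM_a\mathbf u=\sum_\kappa\int_\kappa\sigma_auv\,d\mathbf x,$$ $$\mathbf v^TF^{(d)}\mathbf u=-\sum_{\Gamma\in\mathcal F}\int_\Gamma\boldsymbol\Omega_d\cdot\mathbf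 n\,\llbracket u\rrbracket\{v\}\,dS+\frac12\sum_{\Gamma\in\mathcal F}\int_\Gamma|\boldsymbol\Omega_d\cdot\mathbf n|\,\llbracket u\rrbracket\llbracket v\rrbracket\,dS,$$ $$\mathbf v^T\tilde F^{(d)}\mathbf u=\sum_{\Gamma\in\mathcal F}\int_\Gamma\boldsymbol\Omega_d\cdot\mathbf n\,\{u\}\llbracket v\rrbracket\,dS+\frac12\sum_{\Gamma\in\mathcal F}\int_\Gamma|\boldsymbol\Omega_d\cdot\mathbf n|\,\llbracket u\rrbracket\llbracket v\rrbracket\,dS.$$ Sweep matrix: $S_\varepsilon=\sum_dw_d\left(I+\varepsilon M_t^{-1}(\boldsymbol\Omega_d\cdot\mathbf G+F^{(d)})\right)^{-1}\frac1{4\pi}\left(I-\varepsilon^2M_t^{-1}M_a\right)$. DSA matrix: $F_0=\frac1{4\pi}\sum_dw_dF^{(d)}$, $\mathbf F_1=\frac1{4\pi}\sum_dw_d\boldsymbol\Omega_dF^{(d)}$, $\tilde{\mathbf F}_1=\frac1{4\pi}\sum_dw_d\boldsymbol\Omega_d\tilde F^{(d)}$ (vectors of matrices), and $$D_0=\tfrac13\mathbf G^T\cdot M_t^{-1}\mathbf G-\tilde{\mathbf F}_1\cdot M_t^{-1}\mathbf G+\mathbf G^T\cdot M_t^{-1}\mathbf F_1+M_a,$$ where dot products are over the component index, e.g. $\mathbf G^T\cdot M_t^{-1}\mathbf G=\sum_jG_j^TM_t^{-1}G_j$. Standing assumptions: $\varepsilon\|M_t^{-1}(\boldsymbol\Omega_d\cdot\mathbf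 G+F^{(d)})\|<1$ and $\varepsilon^2\|M_t^{-1}M_a\|<1$; the mesh, $\mathcal U$, opacities and quadrature are fixed and $\mathcal O(\varepsilon)$ denotes a matrix whose norm is at most $C\varepsilon$ for all sufficiently small $\varepsilon>0$. With $P$ a projection of $\mathbb R^N$ onto the coefficient vectors of continuous functions in $\mathcal U$ that vanish on $\partial\mathcal D$, the matrix $P^TD_0P$ is assumed invertible as a map from the range of $P$ to the range of $P^T$. *)

theory Defs
  imports "HOL-Analysis.Analysis"
begin

section \<open>Meshes of curved elements\<close>

text \<open>
  A side is a pair of an element and a facet of the reference element. An interior face
  \<open>Interior s s'\<close> lies between the elements of \<open>s\<close> and \<open>s'\<close>; the order of the two sides
  records the arbitrary choice of sign of the normal, which points from the first element to the
  second.
\<close>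

type_synonym 'v side = "'v set \<times> 'v set"

datatype 's face = Boundary (lead: 's) | Interior (lead: 's) (trail: 's)

record 'v mesh =
  dom :: "'v set"
  refel :: "'v set"
  elems :: "'v set set"
  emap :: "'v set \<Rightarrow> 'v \<Rightarrow> 'v"
  faces :: "'v side face set"

definition sides :: "'v::euclidean_space mesh \<Rightarrow> 'v side set" where
  "sides M = elems M \<times> {f. f facet_of refel M}"

definition side_set :: "'v mesh \<Rightarrow> 'v side \<Rightarrow> 'v set" where
  "side_set M s = emap M (fst s) ` snd s"

definition face_set :: "'v mesh \<Rightarrow> 'v side face \<Rightarrow> 'v set" where
  "face_set M \<Gamma> = side_set M (lead \<Gamma>)"

definition C1_diffeo_on :: "(real^'n) set \<Rightarrow> (real^'n \<Rightarrow> real^'n) \<Rightarrow> bool" where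
  "C1_diffeo_on K T \<longleftrightarrow>
     inj_on T K \<and>
     (\<exists>W. open W \<and> K \<subseteq> W \<and> (\<forall>x\<in>W. T differentiable (at x)) \<and>
          continuous_on W (\<lambda>x. jacobian T (at x))) \<and>
     (\<forall>x\<in>K. det (jacobian T (at x)) \<noteq> 0)"

text \<open>
  Elements are closed sets, so \<open>dom M\<close> is decomposed in the sense that the elements cover its
  closure and have disjoint interiors. Every facet of every element is either a boundary face or
  one of the two sides of a unique interior face.
\<close>

definition valid_mesh :: "(real^'n) mesh \<Rightarrow> bool" where
  "valid_mesh M \<longleftrightarrow>
     open (dom M) \<and>
     polytope (refel M) \<and> interior (refel M) \<noteq> {} \<and>
     finite (elems M) \<and>
     (\<forall>\<kappa>\<in>elems M. C1_diffeo_on (refel M) (emap M \<kappa>) \<and> \<kappa> = emap M \<kappa> ` refel M) \<and>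
     \<Union> (elems M) = closure (dom M) \<and>
     (\<forall>\<kappa>\<in>elems M. \<forall>\<kappa>'\<in>elems M. \<kappa> \<noteq> \<kappa>' \<longrightarrow> interior \<kappa> \<inter> interior \<kappa>' = {}) \<and>
     (\<forall>\<Gamma>\<in>faces M. set_face \<Gamma> \<subseteq> sides M) \<and>
     (\<forall>s s'. Interior s s' \<in> faces M \<longrightarrow> fst s \<noteq> fst s' \<and> side_set M s = side_set M s') \<and>
     (\<forall>s\<in>sides M. \<exists>!\<Gamma>. \<Gamma> \<in> faces M \<and> s \<in> set_face \<Gamma>) \<and>
     frontier (dom M) = (\<Union>s\<in>{s. Boundary s \<in> faces M}. side_set M s)"

definition ref_normal :: "(real^'n) set \<Rightarrow> (real^'n) set \<Rightarrow> real^'n" where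
  "ref_normal K f = (THE n. norm n = 1 \<and> (\<exists>b. K \<subseteq> {x. n \<bullet> x \<le> b} \<and> f = K \<inter> {x. n \<bullet> x = b}))"

text \<open>
  With \<open>J\<close> the Jacobian matrix of the element map and \<open>n\<close> the outward unit normal of the
  reference facet, \<open>J\<close> inverse transposed times \<open>n\<close> is an outward normal of the curved side.
\<close>

definition conormal :: "(real^'n) mesh \<Rightarrow> (real^'n) side \<Rightarrow> real^'n \<Rightarrow> real^'n" where
  "conormal M s y =
     matrix_inv (transpose (jacobian (emap M (fst s)) (at y))) *v ref_normal (refel M) (snd s)"

definition face_normal :: "(real^'n) mesh \<Rightarrow> (real^'n) side face \<Rightarrow> real^'n \<Rightarrow> real^'n" where
  "face_normal M \<Gamma> x =
     (let s = lead \<Gamma>;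
          m = conormal M s (inv_into (refel M) (emap M (fst s)) x)
      in m /\<^sub>R norm m)"

text \<open>
  Integral over a flat facet \<open>f\<close> with unit normal \<open>n\<close> with respect to the \<open>(n - 1)\<close>-dimensional
  Lebesgue measure: the integrand is extended constantly in normal direction to the cylinder of
  height one over \<open>f\<close>. If the dimension is one, this is evaluation at the point of \<open>f\<close>.
\<close>

definition facet_integral :: "(real^'n) set \<Rightarrow> real^'n \<Rightarrow> (real^'n \<Rightarrow> real) \<Rightarrow> real" where
  "facet_integral f n g =
     integral {y + t *\<^sub>R n |y t. y \<in> f \<and> t \<in> {0..1}} (\<lambda>z. g (closest_point (affine hull f) z))"

text \<open>
  Surface integral over a curved face, pulled back to the reference facet. The surface element
  is given by Nanson's formula \<open>dS = \<bar>det J\<bar> \<parallel>J\<^sup>-\<^sup>T n\<parallel>\<close> times the reference surface element.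
\<close>

definition face_integral ::
  "(real^'n) mesh \<Rightarrow> (real^'n) side face \<Rightarrow> (real^'n \<Rightarrow> real) \<Rightarrow> real" where
  "face_integral M \<Gamma> g =
     (let s = lead \<Gamma>; T = emap M (fst s)
      in facet_integral (snd s) (ref_normal (refel M) (snd s))
           (\<lambda>y. g (T y) * (\<bar>det (jacobian T (at y))\<bar> * norm (conormal M s y))))"


section \<open>The discontinuous Galerkin space\<close>

definition monomial :: "('n::finite \<Rightarrow> nat) \<Rightarrow> real^'n \<Rightarrow> real" where
  "monomial a x = (\<Prod>i\<in>UNIV. (x $ i) ^ a i)"

definition polys :: "('n::finite \<Rightarrow> nat) set \<Rightarrow> (real^'n \<Rightarrow> real) set" where
  "polys A = {p. \<exists>c. p = (\<lambda>x. \<Sum>a\<in>A. c a * monomial a x)}"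

definition total_degree_exponents :: "nat \<Rightarrow> ('n::finite \<Rightarrow> nat) set" where
  "total_degree_exponents r = {a. (\<Sum>i\<in>UNIV. a i) \<le> r}"

definition tensor_degree_exponents :: "nat \<Rightarrow> ('n::finite \<Rightarrow> nat) set" where
  "tensor_degree_exponents r = {a. \<forall>i. a i \<le> r}"

text \<open>
  A discontinuous piecewise polynomial \<open>u\<close> is given by its branches: \<open>u \<kappa>\<close> is the restriction of
  \<open>u\<close> to the closed element \<open>\<kappa>\<close>, including its traces on the faces of \<open>\<kappa>\<close>, extended by zero.
  The branches determine and are determined by the \<open>L\<^sup>2\<close> class of \<open>u\<close>.
\<close>

type_synonym 'v dgfun = "'v set \<Rightarrow> 'v \<Rightarrow> real"

definition dg_space :: "('n::finite \<Rightarrow> nat) set \<Rightarrow> (real^'n) mesh \<Rightarrow> (real^'n) dgfun set" where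
  "dg_space A M =
     {u. (\<forall>\<kappa>\<in>elems M. \<exists>p\<in>polys A. \<forall>y\<in>refel M. u \<kappa> (emap M \<kappa> y) = p y) \<and>
         (\<forall>\<kappa> x. \<kappa> \<notin> elems M \<or> x \<notin> \<kappa> \<longrightarrow> u \<kappa> x = 0)}"

definition from_coeffs :: "('N::finite \<Rightarrow> 'v dgfun) \<Rightarrow> real^'N \<Rightarrow> 'v dgfun" where
  "from_coeffs \<phi> c = (\<lambda>\<kappa> x. \<Sum>i\<in>UNIV. c $ i * \<phi> i \<kappa> x)"

definition is_basis :: "('N::finite \<Rightarrow> 'v dgfun) \<Rightarrow> 'v dgfun set \<Rightarrow> bool" where
  "is_basis \<phi> U \<longleftrightarrow> (\<forall>i. \<phi> i \<in> U) \<and> (\<forall>u\<in>U. \<exists>!c. u = from_coeffs \<phi> c)"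

definition continuous_vanishing :: "'v::topological_space mesh \<Rightarrow> 'v dgfun \<Rightarrow> bool" where
  "continuous_vanishing M u \<longleftrightarrow>
     (\<exists>w. continuous_on (closure (dom M)) w \<and>
          (\<forall>\<kappa>\<in>elems M. \<forall>x\<in>\<kappa>. u \<kappa> x = w x) \<and>
          (\<forall>x\<in>frontier (dom M). w x = 0))"

fun jump :: "'v dgfun \<Rightarrow> 'v side face \<Rightarrow> 'v \<Rightarrow> real" where
  "jump u (Boundary s) x = u (fst s) x"
| "jump u (Interior s s') x = u (fst s) x - u (fst s') x"

fun average :: "'v dgfun \<Rightarrow> 'v side face \<Rightarrow> 'v \<Rightarrow> real" where
  "average u (Boundary s) x = u (fst s) x"
| "average u (Interior s s') x = (u (fst s) x + u (fst s') x) / 2"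


section \<open>Angular quadrature\<close>

text \<open>
  The spatial coordinates are identified with some of the three coordinates of the sphere by an
  injection \<open>\<iota>\<close>; its existence says that the space dimension is at most three.
\<close>

definition spatial :: "('n::finite \<Rightarrow> 3) \<Rightarrow> real^3 \<Rightarrow> real^'n" where
  "spatial \<iota> \<Omega> = (\<chi> j. \<Omega> $ \<iota> j)"

definition valid_quadrature ::
  "(real^'n) mesh \<Rightarrow> ('n \<Rightarrow> 3) \<Rightarrow> ('d::finite \<Rightarrow> real^3) \<Rightarrow> ('d \<Rightarrow> real) \<Rightarrow> bool" where
  "valid_quadrature M \<iota> \<Omega> w \<longleftrightarrow>
     (\<forall>d. norm (\<Omega> d) = 1 \<and> w d > 0) \<and>
     (\<forall>d. \<exists>d'. \<Omega> d' = - \<Omega> d \<and> w d' = w d) \<and>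
     (\<Sum>d\<in>UNIV. w d) = 4 * pi \<and>
     (\<Sum>d\<in>UNIV. w d *\<^sub>R (\<chi> i j. \<Omega> d $ i * \<Omega> d $ j)) = (4 * pi / 3) *\<^sub>R (mat 1 :: real^3^3) \<and>
     (\<Sum>d\<in>UNIV. w d *\<^sub>R \<Omega> d) = 0 \<and>
     (\<forall>\<Gamma>\<in>faces M. \<forall>x\<in>face_set M \<Gamma>.
        (\<Sum>d\<in>UNIV. (w d * \<bar>spatial \<iota> (\<Omega> d) \<bullet> face_normal M \<Gamma> x\<bar>) *\<^sub>R \<Omega> d) = 0)"

text \<open>From here on, \<open>\<omega>\<close> stands for a direction, or a family of directions, in space.\<close>

definition alpha ::
  "(real^'n) mesh \<Rightarrow> ('d::finite \<Rightarrow> real^'n) \<Rightarrow> ('d \<Rightarrow> real) \<Rightarrow> (real^'n) side face \<Rightarrow> real^'n \<Rightarrow> real"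
  where
  "alpha M \<omega> w \<Gamma> x = 1 / (4 * pi) * (\<Sum>d\<in>UNIV. w d * \<bar>\<omega> d \<bullet> face_normal M \<Gamma> x\<bar>)"


section \<open>Discretization matrices\<close>

text \<open>The matrix \<open>A\<close> with \<open>v \<bullet> (A *v u) = b u v\<close> for a bilinear form \<open>b\<close>.\<close>

definition form_matrix ::
  "('N::finite \<Rightarrow> 'v dgfun) \<Rightarrow> ('v dgfun \<Rightarrow> 'v dgfun \<Rightarrow> real) \<Rightarrow> real^'N^'N" where
  "form_matrix \<phi> b = (\<chi> i k. b (\<phi> k) (\<phi> i))"

text \<open>
  The branches are differentiable only in the interior of the elements; the frontier of an element
  is a null set, on which the integrand does not matter.
\<close>

definition grad_matrix ::
  "(real^'n) mesh \<Rightarrow> ('N::finite \<Rightarrow> (real^'n) dgfun) \<Rightarrow> 'n \<Rightarrow> real^'N^'N" where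
  "grad_matrix M \<phi> j = form_matrix \<phi> (\<lambda>u v.
     \<Sum>\<kappa>\<in>elems M. integral \<kappa> (\<lambda>x. frechet_derivative (u \<kappa>) (at x) (axis j 1) * v \<kappa> x))"

definition mass_matrix ::
  "(real^'n) mesh \<Rightarrow> ('N::finite \<Rightarrow> (real^'n) dgfun) \<Rightarrow> (real^'n \<Rightarrow> real) \<Rightarrow> real^'N^'N" where
  "mass_matrix M \<phi> \<sigma> = form_matrix \<phi> (\<lambda>u v.
     \<Sum>\<kappa>\<in>elems M. integral \<kappa> (\<lambda>x. \<sigma> x * u \<kappa> x * v \<kappa> x))"

definition flux_matrix ::
  "(real^'n) mesh \<Rightarrow> ('N::finite \<Rightarrow> (real^'n) dgfun) \<Rightarrow> real^'n \<Rightarrow> real^'N^'N" where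
  "flux_matrix M \<phi> \<omega> = form_matrix \<phi> (\<lambda>u v.
     - (\<Sum>\<Gamma>\<in>faces M. face_integral M \<Gamma>
          (\<lambda>x. (\<omega> \<bullet> face_normal M \<Gamma> x) * jump u \<Gamma> x * average v \<Gamma> x))
     + 1 / 2 * (\<Sum>\<Gamma>\<in>faces M. face_integral M \<Gamma>
          (\<lambda>x. \<bar>\<omega> \<bullet> face_normal M \<Gamma> x\<bar> * jump u \<Gamma> x * jump v \<Gamma> x)))"

definition flux_matrix' ::
  "(real^'n) mesh \<Rightarrow> ('N::finite \<Rightarrow> (real^'n) dgfun) \<Rightarrow> real^'n \<Rightarrow> real^'N^'N" where
  "flux_matrix' M \<phi> \<omega> = form_matrix \<phi> (\<lambda>u v.
     (\<Sum>\<Gamma>\<in>faces M. face_integral M \<Gamma>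
          (\<lambda>x. (\<omega> \<bullet> face_normal M \<Gamma> x) * average u \<Gamma> x * jump v \<Gamma> x))
     + 1 / 2 * (\<Sum>\<Gamma>\<in>faces M. face_integral M \<Gamma>
          (\<lambda>x. \<bar>\<omega> \<bullet> face_normal M \<Gamma> x\<bar> * jump u \<Gamma> x * jump v \<Gamma> x)))"

text \<open>
  \<open>flux_matrix\<close> is the matrix \<open>F\<close> of the direction \<open>\<omega>\<close>, and \<open>flux_matrix'\<close> its variant written
  with a tilde, in which the roles of jump and average are exchanged in the first sum.
\<close>

definition mat_norm :: "real^'N^'N \<Rightarrow> real" where
  "mat_norm A = onorm (\<lambda>x. A *v x)"

definition transport_matrix ::
  "(real^'n) mesh \<Rightarrow> ('N::finite \<Rightarrow> (real^'n) dgfun) \<Rightarrow> (real^'n \<Rightarrow> real) \<Rightarrow> real^'n \<Rightarrow> real^'N^'N"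
  where
  "transport_matrix M \<phi> \<sigma>t \<omega> =
     matrix_inv (mass_matrix M \<phi> \<sigma>t) **
       ((\<Sum>j\<in>UNIV. \<omega> $ j *\<^sub>R grad_matrix M \<phi> j) + flux_matrix M \<phi> \<omega>)"

definition absorption_matrix ::
  "(real^'n) mesh \<Rightarrow> ('N::finite \<Rightarrow> (real^'n) dgfun) \<Rightarrow> (real^'n \<Rightarrow> real) \<Rightarrow> (real^'n \<Rightarrow> real)
     \<Rightarrow> real^'N^'N" where
  "absorption_matrix M \<phi> \<sigma>t \<sigma>a = matrix_inv (mass_matrix M \<phi> \<sigma>t) ** mass_matrix M \<phi> \<sigma>a"

definition sweep_matrix ::
  "(real^'n) mesh \<Rightarrow> ('N::finite \<Rightarrow> (real^'n) dgfun) \<Rightarrow> (real^'n \<Rightarrow> real) \<Rightarrow> (real^'n \<Rightarrow> real)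
     \<Rightarrow> ('d::finite \<Rightarrow> real^'n) \<Rightarrow> ('d \<Rightarrow> real) \<Rightarrow> real \<Rightarrow> real^'N^'N" where
  "sweep_matrix M \<phi> \<sigma>t \<sigma>a \<omega> w \<epsilon> =
     (\<Sum>d\<in>UNIV. w d *\<^sub>R
        (matrix_inv (mat 1 + \<epsilon> *\<^sub>R transport_matrix M \<phi> \<sigma>t (\<omega> d)) **
         ((1 / (4 * pi)) *\<^sub>R (mat 1 - \<epsilon>\<^sup>2 *\<^sub>R absorption_matrix M \<phi> \<sigma>t \<sigma>a))))"

definition F0_matrix ::
  "(real^'n) mesh \<Rightarrow> ('N::finite \<Rightarrow> (real^'n) dgfun) \<Rightarrow> ('d::finite \<Rightarrow> real^'n) \<Rightarrow> ('d \<Rightarrow> real)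
     \<Rightarrow> real^'N^'N" where
  "F0_matrix M \<phi> \<omega> w = (1 / (4 * pi)) *\<^sub>R (\<Sum>d\<in>UNIV. w d *\<^sub>R flux_matrix M \<phi> (\<omega> d))"

definition F1_matrix ::
  "(real^'n) mesh \<Rightarrow> ('N::finite \<Rightarrow> (real^'n) dgfun) \<Rightarrow> ('d::finite \<Rightarrow> real^'n) \<Rightarrow> ('d \<Rightarrow> real)
     \<Rightarrow> 'n \<Rightarrow> real^'N^'N" where
  "F1_matrix M \<phi> \<omega> w j =
     (1 / (4 * pi)) *\<^sub>R (\<Sum>d\<in>UNIV. (w d * \<omega> d $ j) *\<^sub>R flux_matrix M \<phi> (\<omega> d))"

definition F1_matrix' ::
  "(real^'n) mesh \<Rightarrow> ('N::finite \<Rightarrow> (real^'n) dgfun) \<Rightarrow> ('d::finite \<Rightarrow> real^'n) \<Rightarrow> ('d \<Rightarrow> real)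
     \<Rightarrow> 'n \<Rightarrow> real^'N^'N" where
  "F1_matrix' M \<phi> \<omega> w j =
     (1 / (4 * pi)) *\<^sub>R (\<Sum>d\<in>UNIV. (w d * \<omega> d $ j) *\<^sub>R flux_matrix' M \<phi> (\<omega> d))"

definition D0_matrix ::
  "(real^'n) mesh \<Rightarrow> ('N::finite \<Rightarrow> (real^'n) dgfun) \<Rightarrow> (real^'n \<Rightarrow> real) \<Rightarrow> (real^'n \<Rightarrow> real)
     \<Rightarrow> ('d::finite \<Rightarrow> real^'n) \<Rightarrow> ('d \<Rightarrow> real) \<Rightarrow> real^'N^'N" where
  "D0_matrix M \<phi> \<sigma>t \<sigma>a \<omega> w =
     (let G = grad_matrix M \<phi>; Mt_inv = matrix_inv (mass_matrix M \<phi> \<sigma>t) in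
        (1 / 3) *\<^sub>R (\<Sum>j\<in>UNIV. transpose (G j) ** Mt_inv ** G j)
        - (\<Sum>j\<in>UNIV. F1_matrix' M \<phi> \<omega> w j ** Mt_inv ** G j)
        + (\<Sum>j\<in>UNIV. transpose (G j) ** Mt_inv ** F1_matrix M \<phi> \<omega> w j)
        + mass_matrix M \<phi> \<sigma>a)"

definition SIP_matrix ::
  "(real^'n) mesh \<Rightarrow> ('N::finite \<Rightarrow> (real^'n) dgfun) \<Rightarrow> (real^'n \<Rightarrow> real) \<Rightarrow> (real^'n \<Rightarrow> real)
     \<Rightarrow> ('d::finite \<Rightarrow> real^'n) \<Rightarrow> ('d \<Rightarrow> real) \<Rightarrow> real \<Rightarrow> real^'N^'N" where
  "SIP_matrix M \<phi> \<sigma>t \<sigma>a \<omega> w \<epsilon> =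
     (1 / \<epsilon>) *\<^sub>R F0_matrix M \<phi> \<omega> w + D0_matrix M \<phi> \<sigma>t \<sigma>a \<omega> w"

end

theory Submission
  imports Defs
begin

text \<open>
  Expanding the resolvents in the sweep matrix gives
  \<open>M\<^sub>t (I - S) = \<epsilon>\<^sup>2 D + \<epsilon>\<^sup>2 R + O(\<epsilon>\<^sup>3)\<close>, where the error \<open>R\<close> of second order is
  annihilated by \<open>P\<^sup>T\<close>: for a continuous \<open>v\<close> that vanishes on the boundary, integration by parts turns
  \<open>v\<^sup>T (\<Omega> \<cdot> G + F)\<close> into \<open>- v\<^sup>T (\<Omega> \<cdot> G)\<^sup>T\<close>. The matrix \<open>F\<^sub>0 / \<epsilon> + D\<^sub>0\<close> is a singular perturbation;
  its inverse is bounded, and of order \<open>\<epsilon>\<close> on the kernel of \<open>P\<^sup>T\<close>, because the kernel of \<open>F\<^sub>0\<close> is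
  exactly the range of \<open>P\<close>.

  The element maps are only continuously differentiable. For the divergence theorem on an element,
  the integrand is multiplied by a cutoff that vanishes on the frontier; its gradient concentrates on
  layers along the facets, and these produce the surface integrals in the limit. The same
  theorem, applied to bump functions, shows that a piecewise polynomial without jumps across
  faces is continuous also at vertices and edges.
\<close>

section \<open>Matrices\<close>

text \<open>The orders in \<epsilon> match because of the quadrature moments. The zero first moment
  removes the gradients and the mean-value fluxes from the first-order term and leaves F0, the jump
  penalty with weight \<alpha>/2; the second moment produces the factor 1/3 in D0. The lower bound
  on \<alpha> makes the form of F0 vanish only on functions without jumps. A second-order error R in
  M_t (I - S) would in general survive the division by \<epsilon>^2. It is harmless here because its
  values lie in the kernel of P^T, which is the range of the symmetric F0, and there the inverse
  gains one power of \<epsilon>. A facet integral is a volume integral over a cylinder of height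
  one, so the limit of the boundary layers and the comparison of the two parametrizations of a
  shared side both reduce to changes of variables in full dimension. That the two conormals on a
  shared side point in opposite directions is no axiom of the mesh: it is derived from the disjoint
  interiors of the elements.\<close>

lemma norm_matrix_vector_mult_le: "norm (A *v x) \<le> mat_norm A * norm x"
  unfolding mat_norm_def using onorm[OF matrix_vector_mul_bounded_linear] by blast

lemma mat_norm_nonneg: "0 \<le> mat_norm A"
  unfolding mat_norm_def by (rule onorm_pos_le[OF matrix_vector_mul_bounded_linear])

lemma mat_norm_le:
  assumes "\<And>x. norm (A *v x) \<le> c * norm x"
  shows "mat_norm A \<le> c"
  unfolding mat_norm_def by (rule onorm_le) (rule assms)

lemma matrix_vector_mult_sum_left:
  fixes A :: "'a \<Rightarrow> real^'n^'m"
  shows "(\<Sum>i\<in>I. A i) *v x = (\<Sum>i\<in>I. A i *v x)"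
  by (induction I rule: infinite_finite_induct) (simp_all add: matrix_vector_mult_add_rdistrib)

lemma matrix_vector_mult_sum_right:
  fixes A :: "real^'n^'m"
  shows "A *v (\<Sum>i\<in>I. x i) = (\<Sum>i\<in>I. A *v x i)"
  by (induction I rule: infinite_finite_induct) (simp_all add: matrix_vector_right_distrib)

lemma invertible_if_norm_ge:
  fixes A :: "real^'n^'n"
  assumes "c > 0" "\<And>x. c * norm x \<le> norm (A *v x)"
  shows "invertible A"
proof -
  have "x = 0" if "A *v x = 0" for x
    using assms(2)[of x] that \<open>c > 0\<close> by (simp add: mult_le_0_iff)
  then show ?thesis
    by (meson invertible_left_inverse matrix_left_invertible_ker)
qed

lemma matrix_inv_mult:
  fixes A :: "real^'n^'n"
  assumes "invertible A"
  shows matrix_inv_right: "A ** matrix_inv A = mat 1" and matrix_inv_left: "matrix_inv A ** A = mat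
      1"
proof -
  have "A ** matrix_inv A = mat 1 \<and> matrix_inv A ** A = mat 1"
    unfolding matrix_inv_def by (rule someI_ex) (use assms in \<open>simp add: invertible_def\<close>)
  then show "A ** matrix_inv A = mat 1" "matrix_inv A ** A = mat 1"
    by auto
qed

lemma matrix_inv_vector:
  fixes A :: "real^'n^'n"
  assumes "invertible A"
  shows "A *v (matrix_inv A *v x) = x" "matrix_inv A *v (A *v x) = x"
  using assms by (simp_all add: matrix_vector_mul_assoc matrix_inv_right matrix_inv_left)

text \<open>
  The component of \<open>x\<close> in the range of \<open>P\<close> is seen by \<open>D\<close> through \<open>P\<^sup>T D P\<close> only, while the other
  component is multiplied by the large factor \<open>1 / \<epsilon>\<close>.
\<close>
lemma singular_perturbation_estimate:
  fixes F D P :: "real^'n^'n"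
  assumes sym: "transpose F = F"
    and ker: "\<And>x. F *v x = 0 \<longleftrightarrow> x \<in> range (\<lambda>c. P *v c)"
    and proj: "P ** P = P"
    and inj: "inj_on (\<lambda>c. (transpose P ** D ** P) *v c) (range (\<lambda>c. P *v c))"
  obtains C \<epsilon>0 where "C > 0" "\<epsilon>0 > 0"
    "\<And>\<epsilon> x y. 0 < \<epsilon> \<Longrightarrow> \<epsilon> < \<epsilon>0 \<Longrightarrow> y = (1 / \<epsilon>) *\<^sub>R (F *v x) + D *v x
       \<Longrightarrow> norm x \<le> C * (norm (transpose P *v y) + \<epsilon> * norm y)"
proof -
  have PP: "P *v (P *v x) = P *v x" for x
    by (simp add: matrix_vector_mul_assoc proj)
  have FP: "F *v (P *v x) = 0" for x
    using ker by blast
  have "F ** P = 0"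
    by (metis FP matrix_eq matrix_vector_mul_assoc matrix_vector_mult_0)
  \<comment> \<open>Transposition uses the symmetry of \<open>F\<close>. It makes the large term
    (1/\<epsilon>) F x invisible to \<open>transpose P\<close>.\<close>
  then have "transpose P ** F = 0"
    by (metis matrix_transpose_mul sym transpose_transpose transpose_matrix_vector
        matrix_eq matrix_vector_mult_0 vector_matrix_mult_0_right vector_transpose_matrix)
  then have PtF: "transpose P *v (F *v x) = 0" for x
    by (simp add: matrix_vector_mul_assoc del: transpose_matrix_vector)
  \<comment> \<open>A vector killed by \<open>F\<close> lies in the range of \<open>P\<close> and is
    fixed by \<open>P\<close>, so \<open>F\<close> is injective on the kernel of \<open>P\<close>;
    in finite dimension this gives a lower bound.\<close>
  have 1: "\<exists>e>0. \<forall>x\<in>{x. P *v x = 0}. e * norm x \<le> norm (F *v x)"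
  proof (rule injective_imp_isometric)
    show "subspace {x. P *v x = 0}"
      by (auto simp: subspace_def matrix_vector_right_distrib matrix_vector_mult_scaleR)
    then show "closed {x. P *v x = 0}"
      by (rule closed_subspace)
    show "bounded_linear (\<lambda>x. F *v x)"
      by (rule matrix_vector_mul_bounded_linear)
    show "\<forall>x\<in>{x. P *v x = 0}. F *v x = 0 \<longrightarrow> x = 0"
      using ker PP by auto
  qed
  have sub: "subspace (range (\<lambda>c. P *v c))"
    by (simp add: linear_subspace_image)
  have 2: "\<exists>e>0. \<forall>x\<in>range (\<lambda>c. P *v c). e * norm x \<le> norm ((transpose P ** D ** P) *v x)"
  proof (rule injective_imp_isometric)
    show "closed (range (\<lambda>c. P *v c))"
      by (rule closed_subspace[OF sub])
    show "bounded_linear (\<lambda>x. (transpose P ** D ** P) *v x)"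
      by (rule matrix_vector_mul_bounded_linear)
    show "\<forall>x\<in>range (\<lambda>c. P *v c). (transpose P ** D ** P) *v x = 0 \<longrightarrow> x = 0"
    proof (intro ballI impI)
      fix x assume x: "x \<in> range (\<lambda>c. P *v c)" "(transpose P ** D ** P) *v x = 0"
      have "0 \<in> range (\<lambda>c. P *v c)"
        using sub by (simp add: subspace_0)
      then show "x = 0"
        using inj_onD[OF inj, of x 0] x by simp
    qed
  qed (fact sub)
  obtain a where a: "a > 0" "\<And>x. P *v x = 0 \<Longrightarrow> a * norm x \<le> norm (F *v x)"
    using 1 by auto
  obtain b where b: "b > 0" "\<And>x. b * norm (P *v x) \<le> norm ((transpose P ** D ** P) *v (P *v x))"
    using 2 by auto
  define m where "m = mat_norm D"
  define p where "p = mat_norm (transpose P ** D)"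
  have m0: "m \<ge> 0" and p0: "p \<ge> 0"
    by (simp_all add: m_def p_def mat_norm_nonneg)
  \<comment> \<open>\<open>q\<close> bounds the component outside the range of \<open>P\<close>,
    including its feedback \<open>p / b\<close> into the other component. The estimate for
    \<open>norm x\<close> then contains \<open>(q * m * \<epsilon>) * norm x\<close> on its right
    side, and \<open>\<epsilon>0\<close> makes this factor at most 1/2, so that it can be
    absorbed.\<close>
  define q where "q = (1 + p / b) / a"
  have q0: "q > 0"
    using a(1) b(1) p0 by (simp add: q_def add_pos_nonneg)
  define \<epsilon>0 where "\<epsilon>0 = 1 / (2 * (q * m + 1))"
  define C where "C = 2 * (1 / b + q)"
  show ?thesis
  proof
    show "C > 0" "\<epsilon>0 > 0"
      using q0 b(1) m0 by (auto simp: C_def \<epsilon>0_def intro!: add_pos_pos add_nonneg_pos)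
    fix \<epsilon> :: real and x y
    assume \<epsilon>: "0 < \<epsilon>" "\<epsilon> < \<epsilon>0" and y: "y = (1 / \<epsilon>) *\<^sub>R (F *v x) + D *v x"
    define v where "v = P *v x"
    define z where "z = x - v"
    have x: "x = v + z"
      by (simp add: z_def)
    have Pz: "P *v z = 0"
      by (simp add: z_def v_def matrix_vector_mult_diff_distrib PP)
    have Pv: "P *v v = v"
      by (simp add: v_def PP)
    have Fz: "F *v z = F *v x"
      by (simp add: z_def v_def matrix_vector_mult_diff_distrib FP)
    have "F *v x = \<epsilon> *\<^sub>R (y - D *v x)"
      using \<epsilon>(1) by (simp add: y)
    then have "norm (F *v x) = \<epsilon> * norm (y - D *v x)"
      using \<epsilon>(1) by simp
    also have "\<dots> \<le> \<epsilon> * (norm y + m * norm x)"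
      using \<epsilon>(1) norm_triangle_ineq4[of y "D *v x"] norm_matrix_vector_mult_le[of D x]
      by (intro mult_left_mono) (auto simp: m_def)
    finally have "a * norm z \<le> \<epsilon> * (norm y + m * norm x)"
      using a(2)[OF Pz] Fz by simp
    then have z: "norm z \<le> \<epsilon> * (norm y + m * norm x) / a"
      using a(1) by (simp add: field_simps)
    have "transpose P *v y = transpose P *v (D *v x)"
      by (simp add: y matrix_vector_right_distrib matrix_vector_mult_scaleR PtF del:
          transpose_matrix_vector)
    also have "\<dots> = transpose P *v (D *v v) + (transpose P ** D) *v z"
      by (simp add: x matrix_vector_right_distrib matrix_vector_mul_assoc del:
          transpose_matrix_vector)
    finally have "(transpose P ** D ** P) *v v = transpose P *v y - (transpose P ** D) *v z"
      by (metis Pv add_diff_cancel_right' matrix_vector_mul_assoc)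
    then have "b * norm v \<le> norm (transpose P *v y - (transpose P ** D) *v z)"
      using b(2)[of x] by (simp add: v_def[symmetric])
    also have "\<dots> \<le> norm (transpose P *v y) + p * norm z"
      using norm_triangle_ineq4[of "transpose P *v y" "(transpose P ** D) *v z"]
        norm_matrix_vector_mult_le[of "transpose P ** D" z] by (simp add: p_def)
    finally have v: "norm v \<le> norm (transpose P *v y) / b + p / b * norm z"
      using b(1) by (simp add: field_simps)
    have "norm x \<le> norm v + norm z"
      unfolding x by (rule norm_triangle_ineq)
    also have "\<dots> \<le> norm (transpose P *v y) / b + (1 + p / b) * norm z"
      using v by (simp add: algebra_simps)
    also have "\<dots> \<le> norm (transpose P *v y) / b + (1 + p / b) * (\<epsilon> * (norm y + m * norm x) / a)"
      using z p0 b(1) by (intro add_left_mono mult_left_mono) auto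
    also have "\<dots> = norm (transpose P *v y) / b + q * \<epsilon> * norm y + (q * m * \<epsilon>) * norm x"
      by (simp add: q_def add_divide_distrib algebra_simps)
    finally have *: "norm x \<le> norm (transpose P *v y) / b + q * \<epsilon> * norm y + (q * m * \<epsilon>) * norm x" .
    have "q * m * \<epsilon> \<le> q * m * \<epsilon>0"
      using \<epsilon> q0 m0 by (intro mult_left_mono) auto
    also have "\<dots> \<le> 1 / 2"
    proof -
      have "q * m \<ge> 0"
        using q0 m0 by simp
      then show ?thesis
        unfolding \<epsilon>0_def by (simp add: field_simps)
    qed
    finally have "(q * m * \<epsilon>) * norm x \<le> 1 / 2 * norm x"
      by (intro mult_right_mono) auto
    with * have "norm x \<le> 2 * (norm (transpose P *v y) / b + q * \<epsilon> * norm y)"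
      by simp
    also have "\<dots> \<le> C * (norm (transpose P *v y) + \<epsilon> * norm y)"
    proof -
      have "C * (norm (transpose P *v y) + \<epsilon> * norm y) -
          2 * (norm (transpose P *v y) / b + q * \<epsilon> * norm y)
          = 2 * (q * norm (transpose P *v y) + \<epsilon> * norm y / b)"
        by (simp add: C_def algebra_simps)
      moreover have "\<dots> \<ge> 0"
        using q0 b(1) \<epsilon> by simp
      ultimately show ?thesis
        by linarith
    qed
    finally show "norm x \<le> C * (norm (transpose P *v y) + \<epsilon> * norm y)" .
  qed
qed

text \<open>Everything follows from z = r + \<epsilon> T r for the resolvent value r. The expansion
  is a Neumann series cut off with an exact remainder, so no series has to converge; the bound 1/2
  yields the factor 2, uniformly in \<epsilon>.\<close>

lemma resolvent:
  fixes T :: "real^'n^'n"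
  assumes "0 < \<epsilon>" "\<epsilon> * mat_norm T \<le> 1 / 2"
  shows "invertible (mat 1 + \<epsilon> *\<^sub>R T)"
    and "norm (matrix_inv (mat 1 + \<epsilon> *\<^sub>R T) *v z) \<le> 2 * norm z"
    and "matrix_inv (mat 1 + \<epsilon> *\<^sub>R T) *v z = z - \<epsilon> *\<^sub>R (T *v z) + \<epsilon>\<^sup>2 *\<^sub>R (T *v (T *v z))
           - \<epsilon>^3 *\<^sub>R (T *v (T *v (T *v (matrix_inv (mat 1 + \<epsilon> *\<^sub>R T) *v z))))"
proof -
  have ge: "1 / 2 * norm x \<le> norm ((mat 1 + \<epsilon> *\<^sub>R T) *v x)" for x
  proof -
    have "norm (\<epsilon> *\<^sub>R (T *v x)) \<le> \<epsilon> * (mat_norm T * norm x)"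
      using assms(1) norm_matrix_vector_mult_le[of T x] by simp
    also have "\<dots> = (\<epsilon> * mat_norm T) * norm x"
      by simp
    also have "\<dots> \<le> 1 / 2 * norm x"
      by (intro mult_right_mono assms) simp
    finally have "norm (\<epsilon> *\<^sub>R (T *v x)) \<le> 1 / 2 * norm x" .
    moreover have "(mat 1 + \<epsilon> *\<^sub>R T) *v x = x + \<epsilon> *\<^sub>R (T *v x)"
      by (simp add: matrix_vector_mult_add_rdistrib scaleR_matrix_vector_assoc)
    moreover have "norm x \<le> norm (x + \<epsilon> *\<^sub>R (T *v x)) + norm (\<epsilon> *\<^sub>R (T *v x))"
      using norm_triangle_ineq4[of "x + \<epsilon> *\<^sub>R (T *v x)" "\<epsilon> *\<^sub>R (T *v x)"] by simp
    ultimately show ?thesis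
      by (simp del: norm_scaleR)
  qed
  show inv: "invertible (mat 1 + \<epsilon> *\<^sub>R T)"
    by (rule invertible_if_norm_ge[OF _ ge]) simp
  define r where "r = matrix_inv (mat 1 + \<epsilon> *\<^sub>R T) *v z"
  have r: "(mat 1 + \<epsilon> *\<^sub>R T) *v r = z"
    unfolding r_def by (rule matrix_inv_vector[OF inv])
  show "norm (matrix_inv (mat 1 + \<epsilon> *\<^sub>R T) *v z) \<le> 2 * norm z"
    using ge[of r] r by (simp add: r_def)
  have z: "z = r + \<epsilon> *\<^sub>R (T *v r)"
    using r by (simp add: matrix_vector_mult_add_rdistrib scaleR_matrix_vector_assoc)
  show "matrix_inv (mat 1 + \<epsilon> *\<^sub>R T) *v z = z - \<epsilon> *\<^sub>R (T *v z) + \<epsilon>\<^sup>2 *\<^sub>R (T *v (T *v z))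
           - \<epsilon>^3 *\<^sub>R (T *v (T *v (T *v (matrix_inv (mat 1 + \<epsilon> *\<^sub>R T) *v z))))"
    unfolding r_def[symmetric]
    by (simp add: z matrix_vector_right_distrib matrix_vector_mult_scaleR algebra_simps
        power2_eq_square power3_eq_cube)
qed

text \<open>Expanding the resolvents up to third order, the terms of order one cancel because the
  averages match, and the terms of order two cancel up to a remainder that \<open>P\<^sup>T\<close> annihilates.\<close>
theorem preconditioned_sweep_asymptotics:
  fixes Mt Ma F D P :: "real^'n^'n" and B :: "'d::finite \<Rightarrow> real^'n^'n" and w :: "'d \<Rightarrow> real"
  defines "T \<equiv> \<lambda>d. matrix_inv Mt ** B d"
  defines "A \<equiv> matrix_inv Mt ** Ma"
  defines "S \<equiv> \<lambda>\<epsilon>. \<Sum>d\<in>UNIV. w d *\<^sub>R (matrix_inv (mat 1 + \<epsilon> *\<^sub>R T d) **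
         ((1 / (4 * pi)) *\<^sub>R (mat 1 - \<epsilon>\<^sup>2 *\<^sub>R A)))"
  assumes Mt: "invertible Mt"
    and w: "(\<Sum>d\<in>UNIV. w d) = 4 * pi"
    and F: "F = (1 / (4 * pi)) *\<^sub>R (\<Sum>d\<in>UNIV. w d *\<^sub>R B d)"
    and sym: "transpose F = F"
    and ker: "\<And>x. F *v x = 0 \<longleftrightarrow> x \<in> range (\<lambda>c. P *v c)"
    and proj: "P ** P = P"
    and inj: "inj_on (\<lambda>c. (transpose P ** D ** P) *v c) (range (\<lambda>c. P *v c))"
    and rem: "\<And>x. transpose P *v (Ma *v x - (1 / (4 * pi)) *\<^sub>R
                 (\<Sum>d\<in>UNIV. w d *\<^sub>R (B d *v (matrix_inv Mt *v (B d *v x)))) - D *v x) = 0"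
  shows "\<exists>C. \<forall>\<^sub>F \<epsilon> in at_right 0. invertible (\<epsilon>\<^sup>2 *\<^sub>R ((1 / \<epsilon>) *\<^sub>R F + D)) \<and>
           mat_norm (matrix_inv (\<epsilon>\<^sup>2 *\<^sub>R ((1 / \<epsilon>) *\<^sub>R F + D)) ** Mt ** (mat 1 - S \<epsilon>) - mat 1) \<le> C *
               \<epsilon>"
proof -
  obtain C0 \<epsilon>0 where C0: "C0 > 0" "\<epsilon>0 > 0"
    "\<And>\<epsilon> x y. 0 < \<epsilon> \<Longrightarrow> \<epsilon> < \<epsilon>0 \<Longrightarrow> y = (1 / \<epsilon>) *\<^sub>R (F *v x) + D *v x
       \<Longrightarrow> norm x \<le> C0 * (norm (transpose P *v y) + \<epsilon> * norm y)"
    using singular_perturbation_estimate[OF sym ker proj inj] by blast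
  \<comment> \<open>The mismatch between the coefficient of \<epsilon>^2 in the expansion and
    \<open>D\<close>. It need not be small; \<open>rem\<close> says that \<open>transpose P\<close>
    annihilates it.\<close>
  define R where "R = (\<lambda>x. Ma *v x - (1 / (4 * pi)) *\<^sub>R
                 (\<Sum>d\<in>UNIV. w d *\<^sub>R (B d *v (matrix_inv Mt *v (B d *v x)))) - D *v x)"
  define Q where "Q = (\<lambda>x. (1 / (4 * pi)) *\<^sub>R (\<Sum>d\<in>UNIV. w d *\<^sub>R (B d *v (matrix_inv Mt *v (B d *v
      x)))))"
  define m where "m = (\<Sum>d\<in>UNIV. mat_norm (T d))"
  have m: "mat_norm (T d) \<le> m" for d
    unfolding m_def by (rule member_le_sum) (auto simp: mat_norm_nonneg)
  have m0: "m \<ge> 0"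
    unfolding m_def by (intro sum_nonneg mat_norm_nonneg)
  have linB: "linear (\<lambda>x. B d *v (matrix_inv Mt *v (B d *v x)))" for d
    using linear_compose[OF linear_compose[OF matrix_vector_mul_linear matrix_vector_mul_linear]
        matrix_vector_mul_linear,
        of "B d" "matrix_inv Mt" "B d"] by (simp add: o_def)
  have linQ: "linear Q"
    unfolding Q_def
    by (intro linear_compose_scale_right linear_compose_sum ballI linB)
  have linR: "linear R"
    using linQ unfolding R_def Q_def
    by (intro linear_compose_sub matrix_vector_mul_linear)
  obtain cR where cR: "cR > 0" "\<And>x. norm (R x) \<le> cR * norm x"
    using linear_bounded_pos[OF linR] by auto
  \<comment> \<open>The part of the expansion that still contains the resolvents; it enters with the
    factor \<epsilon>^3.\<close>
  define E where "E = (\<lambda>\<epsilon> e. \<Sum>d\<in>UNIV. w d *\<^sub>R (B d *v (T d *v (T d *v (matrix_inv (mat 1 + \<epsilon> *\<^sub>R T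
      d) *v
       ((1 / (4 * pi)) *\<^sub>R (e - \<epsilon>\<^sup>2 *\<^sub>R (A *v e))))))))"
  \<comment> \<open>All terms of order three and higher, divided by \<epsilon>^3. The first two
    arise where the correction -\<epsilon>^2 A of the source meets the first- and second-order terms
    of the resolvents.\<close>
  define L where "L = (\<lambda>\<epsilon> e. - (F *v (A *v e)) + \<epsilon> *\<^sub>R Q (A *v e) + E \<epsilon> e)"
  have key: "Mt *v ((mat 1 - S \<epsilon>) *v e) = \<epsilon> *\<^sub>R (F *v e) + \<epsilon>\<^sup>2 *\<^sub>R (D *v e) + \<epsilon>\<^sup>2 *\<^sub>R (R e + \<epsilon> *\<^sub>R L
      \<epsilon> e)"
    if \<epsilon>: "0 < \<epsilon>" "\<epsilon> * m \<le> 1 / 2" for \<epsilon> e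
  proof -
    define z where "z = (1 / (4 * pi)) *\<^sub>R (e - \<epsilon>\<^sup>2 *\<^sub>R (A *v e))"
    define r where "r = (\<lambda>d. matrix_inv (mat 1 + \<epsilon> *\<^sub>R T d) *v z)"
    have le: "\<epsilon> * mat_norm (T d) \<le> 1 / 2" for d
      using mult_left_mono[OF m[of d], of \<epsilon>] \<epsilon> by linarith
    have r: "r d = z - \<epsilon> *\<^sub>R (T d *v z) + \<epsilon>\<^sup>2 *\<^sub>R (T d *v (T d *v z)) - \<epsilon>^3 *\<^sub>R (T d *v (T d *v (T d
        *v r d)))" for d
      unfolding r_def by (rule resolvent(3)[OF \<epsilon>(1) le])
    have MtT: "Mt *v (T d *v x) = B d *v x" for d x
      unfolding T_def by (simp add: matrix_vector_mul_assoc[symmetric] matrix_inv_vector[OF Mt])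
    have MtA: "Mt *v (A *v x) = Ma *v x" for x
      unfolding A_def by (simp add: matrix_vector_mul_assoc[symmetric] matrix_inv_vector[OF Mt])
    have Mtr: "Mt *v r d = Mt *v z - \<epsilon> *\<^sub>R (B d *v z) + \<epsilon>\<^sup>2 *\<^sub>R (B d *v (T d *v z))
          - \<epsilon>^3 *\<^sub>R (B d *v (T d *v (T d *v r d)))" for d
      by (subst r) (simp add: matrix_vector_right_distrib matrix_vector_mult_diff_distrib
          matrix_vector_mult_scaleR MtT)
    have Se: "S \<epsilon> *v e = (\<Sum>d\<in>UNIV. w d *\<^sub>R r d)"
      unfolding S_def r_def z_def matrix_vector_mult_sum_left
      by (simp add: scaleR_matrix_vector_assoc[symmetric] matrix_vector_mul_assoc[symmetric]
          matrix_vector_mult_diff_rdistrib)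
    have "Mt *v (S \<epsilon> *v e) = (\<Sum>d\<in>UNIV. w d *\<^sub>R (Mt *v r d))"
      by (simp add: Se matrix_vector_mult_sum_right matrix_vector_mult_scaleR)
    also have "\<dots> = (\<Sum>d\<in>UNIV. w d *\<^sub>R (Mt *v z)) - \<epsilon> *\<^sub>R (\<Sum>d\<in>UNIV. w d *\<^sub>R (B d *v z))
        + \<epsilon>\<^sup>2 *\<^sub>R (\<Sum>d\<in>UNIV. w d *\<^sub>R (B d *v (T d *v z)))
        - \<epsilon>^3 *\<^sub>R (\<Sum>d\<in>UNIV. w d *\<^sub>R (B d *v (T d *v (T d *v r d))))"
      by (subst Mtr) (simp add: scaleR_right_diff_distrib scaleR_right_distrib sum.distrib
          sum_subtractf scaleR_sum_right mult.commute)
    also have "(\<Sum>d\<in>UNIV. w d *\<^sub>R (Mt *v z)) = (4 * pi) *\<^sub>R (Mt *v z)"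
      by (simp add: scaleR_sum_left[symmetric] w)
    also have "\<dots> = Mt *v e - \<epsilon>\<^sup>2 *\<^sub>R (Ma *v e)"
      by (simp add: z_def matrix_vector_mult_scaleR matrix_vector_mult_diff_distrib MtA)
    also have "(\<Sum>d\<in>UNIV. w d *\<^sub>R (B d *v z)) = (4 * pi) *\<^sub>R (F *v z)"
      by (simp add: F scaleR_matrix_vector_assoc[symmetric] matrix_vector_mult_sum_left)
    also have "\<dots> = F *v e - \<epsilon>\<^sup>2 *\<^sub>R (F *v (A *v e))"
      by (simp add: z_def matrix_vector_mult_scaleR matrix_vector_mult_diff_distrib)
    also have "(\<Sum>d\<in>UNIV. w d *\<^sub>R (B d *v (T d *v z))) = (4 * pi) *\<^sub>R Q z"
      by (simp add: Q_def T_def matrix_vector_mul_assoc[symmetric])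
    also have "\<dots> = Q e - \<epsilon>\<^sup>2 *\<^sub>R Q (A *v e)"
      by (simp add: z_def linear_cmul[OF linQ] linear_diff[OF linQ])
    also have "(\<Sum>d\<in>UNIV. w d *\<^sub>R (B d *v (T d *v (T d *v r d)))) = E \<epsilon> e"
      by (simp add: E_def r_def z_def)
    finally have MS: "Mt *v (S \<epsilon> *v e) = Mt *v e - \<epsilon>\<^sup>2 *\<^sub>R (Ma *v e)
       - \<epsilon> *\<^sub>R (F *v e - \<epsilon>\<^sup>2 *\<^sub>R (F *v (A *v e))) + \<epsilon>\<^sup>2 *\<^sub>R (Q e - \<epsilon>\<^sup>2 *\<^sub>R Q (A *v e)) - \<epsilon>^3 *\<^sub>R E \<epsilon>
           e" .
    have "Ma *v e = R e + Q e + D *v e"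
      by (simp add: R_def Q_def)
    then show ?thesis
      by (simp add: matrix_vector_mult_diff_rdistrib matrix_vector_mult_diff_distrib MS L_def
          algebra_simps power2_eq_square power3_eq_cube)
  qed
  obtain cQ where cQ: "cQ > 0" "\<And>x. norm (Q x) \<le> cQ * norm x"
    using linear_bounded_pos[OF linQ] by auto
  define a where "a = mat_norm A"
  have a0: "a \<ge> 0" and Aa: "norm (A *v x) \<le> a * norm x" for x
    by (simp_all add: a_def mat_norm_nonneg norm_matrix_vector_mult_le)
  define cE where "cE = (\<Sum>d\<in>UNIV. \<bar>w d\<bar> * (mat_norm (B d ** T d ** T d) * (2 * ((1 / (4 * pi)) * (1
      + a)))))"
  have Ebound: "norm (E \<epsilon> e) \<le> cE * norm e" if \<epsilon>: "0 < \<epsilon>" "\<epsilon> * m \<le> 1 / 2" "\<epsilon> \<le> 1" for \<epsilon> e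
  proof -
    define z where "z = (1 / (4 * pi)) *\<^sub>R (e - \<epsilon>\<^sup>2 *\<^sub>R (A *v e))"
    have "norm (\<epsilon>\<^sup>2 *\<^sub>R (A *v e)) \<le> 1 * (a * norm e)"
      unfolding norm_scaleR using \<epsilon> Aa[of e] by (intro mult_mono) (auto simp: power_le_one)
    then have "norm (e - \<epsilon>\<^sup>2 *\<^sub>R (A *v e)) \<le> (1 + a) * norm e"
      using norm_triangle_ineq4[of e "\<epsilon>\<^sup>2 *\<^sub>R (A *v e)"] by (simp add: algebra_simps)
    then have z: "norm z \<le> (1 / (4 * pi)) * ((1 + a) * norm e)"
      unfolding z_def norm_scaleR by (intro mult_mono) auto
    have "norm (E \<epsilon> e) \<le> (\<Sum>d\<in>UNIV. norm (w d *\<^sub>R (B d *v (T d *v (T d *v (matrix_inv (mat 1 + \<epsilon> *\<^sub>R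
        T d) *v z))))))"
      unfolding E_def z_def by (rule norm_sum)
    also have "\<dots> \<le> (\<Sum>d\<in>UNIV. \<bar>w d\<bar> * (mat_norm (B d ** T d ** T d) * (2 * ((1 / (4 * pi)) * (1 +
        a)))) * norm e)"
    proof (rule sum_mono)
      fix d
      have le: "\<epsilon> * mat_norm (T d) \<le> 1 / 2"
        using mult_left_mono[OF m[of d], of \<epsilon>] \<epsilon> by linarith
      have "norm (B d *v (T d *v (T d *v (matrix_inv (mat 1 + \<epsilon> *\<^sub>R T d) *v z))))
        \<le> mat_norm (B d ** T d ** T d) * norm (matrix_inv (mat 1 + \<epsilon> *\<^sub>R T d) *v z)"
        using norm_matrix_vector_mult_le[of "B d ** T d ** T d"
            "matrix_inv (mat 1 + \<epsilon> *\<^sub>R T d) *v z"]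
        by (simp add: matrix_vector_mul_assoc[symmetric])
      also have "\<dots> \<le> mat_norm (B d ** T d ** T d) * (2 * norm z)"
        by (intro mult_left_mono resolvent(2)[OF \<epsilon>(1) le] mat_norm_nonneg)
      also have "\<dots> \<le> mat_norm (B d ** T d ** T d) * (2 * ((1 / (4 * pi)) * ((1 + a) * norm e)))"
        using z by (intro mult_left_mono mat_norm_nonneg) auto
      finally have "\<bar>w d\<bar> * norm (B d *v (T d *v (T d *v (matrix_inv (mat 1 + \<epsilon> *\<^sub>R T d) *v z))))
         \<le> \<bar>w d\<bar> * (mat_norm (B d ** T d ** T d) * (2 * ((1 / (4 * pi)) * ((1 + a) * norm e))))"
        by (intro mult_left_mono) auto
      then show "norm (w d *\<^sub>R (B d *v (T d *v (T d *v (matrix_inv (mat 1 + \<epsilon> *\<^sub>R T d) *v z)))))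
        \<le> \<bar>w d\<bar> * (mat_norm (B d ** T d ** T d) * (2 * ((1 / (4 * pi)) * (1 + a)))) * norm e"
        by (simp add: algebra_simps)
    qed
    also have "\<dots> = cE * norm e"
      by (simp add: cE_def sum_distrib_right)
    finally show ?thesis .
  qed
  define cL where "cL = mat_norm F * a + cQ * a + cE"
  have Lbound: "norm (L \<epsilon> e) \<le> cL * norm e" if \<epsilon>: "0 < \<epsilon>" "\<epsilon> * m \<le> 1 / 2" "\<epsilon> \<le> 1" for \<epsilon> e
  proof -
    have 1: "norm (- (F *v (A *v e))) \<le> mat_norm F * a * norm e"
      using order_trans[OF norm_matrix_vector_mult_le mult_left_mono[OF Aa mat_norm_nonneg]]
      by (simp add: mult.assoc)
    have "norm (Q (A *v e)) \<le> cQ * (a * norm e)"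
      using order_trans[OF cQ(2) mult_left_mono[OF Aa]] cQ(1) by simp
    then have "norm (\<epsilon> *\<^sub>R Q (A *v e)) \<le> 1 * (cQ * (a * norm e))"
      unfolding norm_scaleR using \<epsilon> by (intro mult_mono) auto
    then have 2: "norm (\<epsilon> *\<^sub>R Q (A *v e)) \<le> cQ * a * norm e"
      by (simp add: mult.assoc)
    have "norm (L \<epsilon> e) \<le> norm (- (F *v (A *v e))) + norm (\<epsilon> *\<^sub>R Q (A *v e)) + norm (E \<epsilon> e)"
      unfolding L_def by (meson norm_triangle_ineq add_right_mono order_trans)
    also have "\<dots> \<le> cL * norm e"
      using 1 2 Ebound[OF \<epsilon>, of e] by (simp add: cL_def distrib_right)
    finally show ?thesis .
  qed
  have PtR: "transpose P *v R x = 0" for x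
    unfolding R_def by (rule rem)
  define p where "p = mat_norm (transpose P)"
  define C where "C = C0 * (p * cL + cR + cL)"
  \<comment> \<open>\<open>\<epsilon>0\<close> serves the singular perturbation estimate, 1 allows
    powers of \<epsilon> to be dropped, and 1 / (2 m + 1) ensures \<epsilon> m \<le> 1/2 for the
    resolvents.\<close>
  define \<epsilon>1 where "\<epsilon>1 = min (min \<epsilon>0 1) (1 / (2 * m + 1))"
  have \<epsilon>1: "\<epsilon>1 > 0"
    using C0(2) m0 by (simp add: \<epsilon>1_def add_nonneg_pos)
  have "invertible (\<epsilon>\<^sup>2 *\<^sub>R ((1 / \<epsilon>) *\<^sub>R F + D)) \<and>
           mat_norm (matrix_inv (\<epsilon>\<^sup>2 *\<^sub>R ((1 / \<epsilon>) *\<^sub>R F + D)) ** Mt ** (mat 1 - S \<epsilon>) - mat 1) \<le> C *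
               \<epsilon>"
    if \<epsilon>: "0 < \<epsilon>" "\<epsilon> < \<epsilon>1" for \<epsilon>
  proof -
    have e0: "\<epsilon> < \<epsilon>0" and e1: "\<epsilon> \<le> 1" and em: "\<epsilon> * m \<le> 1 / 2"
    proof -
      show "\<epsilon> < \<epsilon>0" "\<epsilon> \<le> 1"
        using \<epsilon> by (auto simp: \<epsilon>1_def)
      have "\<epsilon> * (2 * m + 1) \<le> 1"
        using \<epsilon> m0 by (auto simp: \<epsilon>1_def field_simps)
      then show "\<epsilon> * m \<le> 1 / 2"
        using \<epsilon> by (simp add: algebra_simps)
    qed
    define X where "X = \<epsilon>\<^sup>2 *\<^sub>R ((1 / \<epsilon>) *\<^sub>R F + D)"
    have X: "X *v x = \<epsilon>\<^sup>2 *\<^sub>R ((1 / \<epsilon>) *\<^sub>R (F *v x) + D *v x)" for x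
      by (simp add: X_def scaleR_matrix_vector_assoc[symmetric] matrix_vector_mult_add_rdistrib)
    \<comment> \<open>The perturbation estimate with right-hand side 0 gives injectivity.\<close>
    have "x = 0" if "X *v x = 0" for x
      using C0(3)[OF \<epsilon>(1) e0, of 0 x] that \<epsilon> by (auto simp: X)
    then have inv: "invertible X"
      by (meson invertible_left_inverse matrix_left_invertible_ker)
    have "mat_norm (matrix_inv X ** Mt ** (mat 1 - S \<epsilon>) - mat 1) \<le> C * \<epsilon>"
    proof (rule mat_norm_le)
      fix e :: "real^'n"
      \<comment> \<open>The error is read as the solution of X x = \<epsilon>^2 (R e + \<epsilon> L
        e). A bound on the norm of \<open>matrix_inv X\<close> alone would be too weak; the estimate
        exploits that \<open>transpose P\<close> sees only \<epsilon> L e of this right-hand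
        side.\<close>
      define x where "x = (matrix_inv X ** Mt ** (mat 1 - S \<epsilon>) - mat 1) *v e"
      have "X *v x = Mt *v ((mat 1 - S \<epsilon>) *v e) - X *v e"
        by (simp add: x_def matrix_vector_mult_diff_rdistrib matrix_vector_mult_diff_distrib
            matrix_vector_mul_assoc[symmetric] matrix_inv_vector[OF inv])
      also have "\<dots> = \<epsilon>\<^sup>2 *\<^sub>R (R e + \<epsilon> *\<^sub>R L \<epsilon> e)"
        using \<epsilon>(1) by (simp add: key[OF \<epsilon>(1) em] X scaleR_right_distrib power2_eq_square)
      finally have "R e + \<epsilon> *\<^sub>R L \<epsilon> e = (1 / \<epsilon>) *\<^sub>R (F *v x) + D *v x"
        using \<epsilon>(1) by (simp add: X)
      note est = C0(3)[OF \<epsilon>(1) e0 this]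
      have "transpose P *v (R e + \<epsilon> *\<^sub>R L \<epsilon> e) = \<epsilon> *\<^sub>R (transpose P *v L \<epsilon> e)"
        by (simp add: matrix_vector_right_distrib PtR matrix_vector_mult_scaleR del:
            transpose_matrix_vector)
      moreover have "norm (transpose P *v L \<epsilon> e) \<le> p * (cL * norm e)"
        unfolding p_def
        by (rule order_trans[OF norm_matrix_vector_mult_le mult_left_mono[OF Lbound[OF \<epsilon>(1) em e1]
            mat_norm_nonneg]])
      ultimately have 1: "norm (transpose P *v (R e + \<epsilon> *\<^sub>R L \<epsilon> e)) \<le> \<epsilon> * (p * (cL * norm e))"
        using \<epsilon>(1) by simp
      have "norm (\<epsilon> *\<^sub>R L \<epsilon> e) \<le> 1 * (cL * norm e)"
        unfolding norm_scaleR using \<epsilon> e1 Lbound[OF \<epsilon>(1) em e1] by (intro mult_mono) auto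
      then have "norm (R e + \<epsilon> *\<^sub>R L \<epsilon> e) \<le> cR * norm e + cL * norm e"
        using norm_triangle_ineq[of "R e" "\<epsilon> *\<^sub>R L \<epsilon> e"] cR(2)[of e] by simp
      then have 2: "\<epsilon> * norm (R e + \<epsilon> *\<^sub>R L \<epsilon> e) \<le> \<epsilon> * (cR * norm e + cL * norm e)"
        using \<epsilon>(1) by simp
      have "norm x \<le> C0 * (\<epsilon> * (p * (cL * norm e)) + \<epsilon> * (cR * norm e + cL * norm e))"
        by (rule order_trans[OF est mult_left_mono[OF add_mono[OF 1 2]]]) (use C0(1) in simp)
      also have "\<dots> = C * \<epsilon> * norm e"
        by (simp add: C_def algebra_simps)
      finally show "norm ((matrix_inv X ** Mt ** (mat 1 - S \<epsilon>) - mat 1) *v e) \<le> C * \<epsilon> * norm e"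
        by (simp add: x_def)
    qed
    with inv show ?thesis
      by (simp add: X_def)
  qed
  then show ?thesis
    using \<epsilon>1 by (intro exI[of _ C]) (auto simp: eventually_at_right_field)
qed

section \<open>Rank one updates\<close>

lemma orthogonal_matrix_inner:
  fixes A :: "real^'n^'n"
  assumes "orthogonal_matrix A"
  shows "(A *v x) \<bullet> (A *v y) = x \<bullet> y"
  using assms by (metis orthogonal_transformation_def orthogonal_transformation_matrix
      matrix_of_matrix_vector_mul matrix_vector_mul_linear)

text \<open>The matrix determinant lemma. After a rotation that takes a coordinate axis to
  \<open>n\<close>, the matrix is the identity with one column changed, and its determinant is read
  off as in Cramer's rule.\<close>

lemma det_rank_one_update:
  fixes a n :: "real^'n"
  assumes n: "norm n = 1"
  shows "det (matrix (\<lambda>x. x + (n \<bullet> x) *\<^sub>R a)) = 1 + n \<bullet> a"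
proof -
  fix k :: 'n
  obtain Q where Q: "orthogonal_matrix Q" "Q *v axis k 1 = n"
    using orthogonal_matrix_exists_basis[OF n] by blast
  define c where "c = transpose Q *v a"
  have Qc: "Q *v c = a"
    using Q(1) by (simp add: c_def orthogonal_matrix_def matrix_vector_mul_assoc del:
        transpose_matrix_vector)
  define M where "M = (\<chi> i j. if j = k then (mat 1 *v (axis k 1 + c)) $ i else (mat 1::real^'n^'n) $
      i $ j)"
  have detM: "det M = 1 + c $ k"
    unfolding M_def cramer_lemma by simp
  have Mv: "M *v x = x + (axis k 1 \<bullet> x) *\<^sub>R c" for x
  proof -
    have "(M *v x) $ i = (x + (axis k 1 \<bullet> x) *\<^sub>R c) $ i" for i
    proof -
      have "(M *v x) $ i = (\<Sum>j\<in>UNIV. (mat 1 :: real^'n^'n) $ i $ j * x $ j + (if j = k then c $ i *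
          x $ k else 0))"
        unfolding M_def matrix_vector_mul_lid
        unfolding matrix_vector_mult_def
        by (auto intro!: sum.cong simp: mat_def axis_def algebra_simps)
      also have "\<dots> = x $ i + c $ i * x $ k"
        by (simp add: sum.distrib mat_def if_distrib[of "\<lambda>t. t * _"] cong: if_cong)
      finally show ?thesis
        by (simp add: inner_axis' mult.commute)
    qed
    then show ?thesis
      by (simp add: vec_eq_iff)
  qed
  have "(\<lambda>x. x + (n \<bullet> x) *\<^sub>R a) = (\<lambda>x. (Q ** M ** transpose Q) *v x)"
  proof
    fix x
    define y where "y = transpose Q *v x"
    have x: "x = Q *v y"
      using Q(1) by (simp add: y_def orthogonal_matrix_def matrix_vector_mul_assoc del:
          transpose_matrix_vector)
    have "n \<bullet> x = axis k 1 \<bullet> y"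
      unfolding x Q(2)[symmetric] by (rule orthogonal_matrix_inner[OF Q(1)])
    then have "x + (n \<bullet> x) *\<^sub>R a = Q *v (M *v y)"
      by (simp add: x Mv matrix_vector_right_distrib matrix_vector_mult_scaleR Qc)
    then show "x + (n \<bullet> x) *\<^sub>R a = (Q ** M ** transpose Q) *v x"
      by (simp add: y_def matrix_vector_mul_assoc matrix_mul_assoc del: transpose_matrix_vector)
  qed
  then have "det (matrix (\<lambda>x. x + (n \<bullet> x) *\<^sub>R a)) = det (Q ** M ** transpose Q)"
    by simp
  also have "\<dots> = det M * (det Q * det (transpose Q))"
    by (simp add: det_mul)
  also have "det Q * det (transpose Q) = 1"
    using Q(1) by (metis det_I det_mul orthogonal_matrix_def)
  also have "det M = 1 + n \<bullet> a"
    using orthogonal_matrix_inner[OF Q(1), of "axis k 1" c] by (simp add: detM Q(2) Qc inner_axis')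
  finally show ?thesis
    by simp
qed

section \<open>Change of variables for arbitrary finite index types\<close>

text \<open>The change of variables theorem of the library asks for a well-ordered index type. The type
  \<open>'n wo\<close> is a copy of the finite type \<open>'n\<close> with an arbitrary well-order.\<close>

typedef 'n wo = "UNIV :: 'n set" morphisms of_wo to_wo ..

instance wo :: (finite) finite
proof
  have "(UNIV :: 'a wo set) = range to_wo"
    by (metis of_wo_inverse surj_def)
  then show "finite (UNIV :: 'a wo set)"
    by (metis finite_class.finite_UNIV finite_imageI)
qed

instantiation wo :: (finite) linorder
begin
definition less_eq_wo :: "'a wo \<Rightarrow> 'a wo \<Rightarrow> bool" where
  "less_eq_wo x y \<longleftrightarrow> to_nat (of_wo x) \<le> to_nat (of_wo y)"
definition less_wo :: "'a wo \<Rightarrow> 'a wo \<Rightarrow> bool" where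
  "less_wo x y \<longleftrightarrow> to_nat (of_wo x) < to_nat (of_wo y)"
instance
  by intro_classes (auto simp: less_eq_wo_def less_wo_def of_wo_inject)
end

instance wo :: (finite) wellorder
proof -
  have "wf {(x :: 'a wo, y). x < y}"
    by (auto simp add: trancl_def tranclp_less intro!: finite_acyclic_wf acyclicI)
  then show "OFCLASS('a wo, wellorder_class)"
    by (rule wf_wellorderI) intro_classes
qed

lemma bij_of_wo: "bij of_wo"
  by (metis UNIV_I bijI' of_wo_inject to_wo_inverse)

definition reindex :: "('m \<Rightarrow> 'n) \<Rightarrow> real^'n \<Rightarrow> real^'m" where
  "reindex \<beta> x = (\<chi> i. x $ \<beta> i)"

section \<open>Relabelling the coordinates along a bijection of index types\<close>

context
  fixes \<beta> :: "'m::finite \<Rightarrow> 'n::finite"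
  assumes \<beta>: "bij \<beta>"
begin

lemma reindex_inv: "reindex (inv \<beta>) (reindex \<beta> x) = x" "reindex \<beta> (reindex (inv \<beta>) y) = y"
  using \<beta> by (simp_all add: reindex_def vec_eq_iff bij_is_surj surj_f_inv_f bij_is_inj)

lemma linear_reindex: "linear (reindex \<beta>)"
  by (intro linearI) (simp_all add: reindex_def vec_eq_iff)

lemma norm_reindex: "norm (reindex \<beta> x) = norm x"
proof -
  have "(\<Sum>i\<in>UNIV. (x $ \<beta> i)\<^sup>2) = (\<Sum>j\<in>UNIV. (x $ j)\<^sup>2)"
    by (rule sum.reindex_bij_betw) (use \<beta> in simp)
  then show ?thesis
    by (simp add: norm_vec_def L2_set_def reindex_def)
qed

lemma continuous_reindex: "continuous_on S (reindex \<beta>)"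
  by (rule linear_continuous_on) (simp add: linear_reindex linear_linear)

lemma reindex_cbox: "reindex \<beta> ` cbox a b = cbox (reindex \<beta> a) (reindex \<beta> b)"
proof (intro equalityI subsetI)
  fix y assume "y \<in> cbox (reindex \<beta> a) (reindex \<beta> b)"
  then have "a $ \<beta> i \<le> y $ i \<and> y $ i \<le> b $ \<beta> i" for i
    by (simp add: mem_box_cart reindex_def)
  then have "a $ j \<le> y $ inv \<beta> j \<and> y $ inv \<beta> j \<le> b $ j" for j
    by (metis \<beta> bij_inv_eq_iff)
  then have "reindex (inv \<beta>) y \<in> cbox a b"
    by (simp add: mem_box_cart reindex_def)
  then show "y \<in> reindex \<beta> ` cbox a b"
    by (metis imageI reindex_inv(2))
qed (auto simp: mem_box_cart reindex_def)

lemma content_reindex: "measure lborel (cbox (reindex \<beta> a) (reindex \<beta> b)) = measure lborel (cbox a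
    b)"
proof -
  have "(\<Prod>i\<in>UNIV. b $ \<beta> i - a $ \<beta> i) = (\<Prod>j\<in>UNIV. b $ j - a $ j)"
    by (rule prod.reindex_bij_betw[of \<beta> UNIV UNIV "\<lambda>j. b $ j - a $ j"]) (use \<beta> in simp)
  moreover have "cbox (reindex \<beta> a) (reindex \<beta> b) = {} \<longleftrightarrow> cbox a b = {}"
    using reindex_cbox[of a b] by auto
  ultimately show ?thesis
    by (simp add: content_cbox_if_cart reindex_def)
qed

text \<open>Conjugation by \<beta> is a sign-preserving bijection between the permutations of the
  two index types, so the Leibniz sums agree term by term.\<close>

lemma det_reindex:
  fixes A :: "real^'n^'n"
  shows "det (\<chi> i j. A $ \<beta> i $ \<beta> j) = det A"
proof -
  have im: "\<beta> ` UNIV = UNIV" and inj: "inj \<beta>"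
    using \<beta> by (auto simp: bij_def)
  have bij: "bij_betw (map_permutation UNIV \<beta>) {p. p permutes UNIV} {p. p permutes UNIV}"
  proof (rule bij_betw_byWitness[where f' = "map_permutation UNIV (inv \<beta>)"])
    have inv: "inj (inv \<beta>)" "range (inv \<beta>) = UNIV" "inv \<beta> \<circ> \<beta> = id" "\<beta> \<circ> inv \<beta> = id"
      using bij_imp_bij_inv[OF \<beta>] \<beta> by (auto simp: bij_def surj_iff)
    show "\<forall>p\<in>{p. p permutes UNIV}. map_permutation UNIV (inv \<beta>) (map_permutation UNIV \<beta> p) = p"
      using im inj inv map_permutation_compose_inv[of \<beta> UNIV UNIV _ "inv \<beta>"] \<beta>
      by (auto simp: bij_betw_def)
    show "\<forall>p\<in>{p. p permutes UNIV}. map_permutation UNIV \<beta> (map_permutation UNIV (inv \<beta>) p) = p"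
      using im inj inv map_permutation_compose_inv[of "inv \<beta>" UNIV UNIV _ \<beta>] \<beta>
      by (auto simp: bij_betw_def inv_f_f surj_f_inv_f)
    show "map_permutation UNIV \<beta> ` {p. p permutes UNIV} \<subseteq> {p. p permutes UNIV}"
      using map_permutation_permutes[of \<beta> UNIV UNIV] \<beta> by auto
    show "map_permutation UNIV (inv \<beta>) ` {p. p permutes UNIV} \<subseteq> {p. p permutes UNIV}"
      using map_permutation_permutes[of "inv \<beta>" UNIV UNIV] bij_imp_bij_inv[OF \<beta>] by auto
  qed
  have app: "map_permutation UNIV \<beta> p (\<beta> i) = \<beta> (p i)" for p i
    using inj by (intro map_permutation_apply) auto
  have "det A = (\<Sum>p\<in>{p. p permutes UNIV}. of_int (sign (map_permutation UNIV \<beta> p)) *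
      (\<Prod>i\<in>UNIV. A $ i $ map_permutation UNIV \<beta> p i))"
    unfolding det_def by (rule sum.reindex_bij_betw[OF bij, symmetric])
  also have "\<dots> = (\<Sum>p\<in>{p. p permutes UNIV}. of_int (sign p) * (\<Prod>i\<in>UNIV. A $ \<beta> i $ \<beta> (p i)))"
  proof (rule sum.cong)
    fix p :: "'m \<Rightarrow> 'm" assume p: "p \<in> {p. p permutes UNIV}"
    have "(\<Prod>i\<in>UNIV. A $ i $ map_permutation UNIV \<beta> p i)
        = (\<Prod>i\<in>UNIV. A $ \<beta> i $ map_permutation UNIV \<beta> p (\<beta> i))"
      by (rule prod.reindex_bij_betw[symmetric]) (use \<beta> in simp)
    moreover have "sign (map_permutation UNIV \<beta> p) = sign p"
      using p inj by (intro sign_map_permutation) auto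
    ultimately show "of_int (sign (map_permutation UNIV \<beta> p)) *
      (\<Prod>i\<in>UNIV. A $ i $ map_permutation UNIV \<beta> p i) = of_int (sign p) * (\<Prod>i\<in>UNIV. A $ \<beta> i $ \<beta> (p
          i))"
      by (simp add: app)
  qed auto
  finally show ?thesis
    by (simp add: det_def)
qed

text \<open>Boxes go to boxes of equal content, which settles integrals over boxes. Since norms are
  preserved too, a box that contains a ball around 0 corresponds to a box that contains the ball of
  the same radius, and this transfers the limit that defines integrals over other sets.\<close>

lemma has_integral_reindex:
  fixes f :: "real^'n \<Rightarrow> real"
  assumes "(f has_integral i) S"
  shows "((\<lambda>y. f (reindex (inv \<beta>) y)) has_integral i) (reindex \<beta> ` S)"
proof -
  let ?r = "reindex \<beta>" and ?r' = "reindex (inv \<beta>)"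
  let ?F = "\<lambda>x. if x \<in> S then f x else 0" and ?F' = "\<lambda>y. if y \<in> ?r ` S then f (?r' y) else 0"
  have cont': "continuous (at y) ?r'" for y
    by (rule linear_continuous_at) (simp add: linear_linear linearI reindex_def vec_eq_iff)
  have img': "?r' ` cbox u v = cbox (?r' u) (?r' v)" for u v
  proof -
    have "cbox u v = ?r ` cbox (?r' u) (?r' v)"
      by (simp add: reindex_cbox reindex_inv)
    then show ?thesis
      by (simp add: image_image reindex_inv)
  qed
  have content': "measure lborel (?r' ` cbox u v) = 1 * measure lborel (cbox u v)" for u v
    using content_reindex[of "?r' u" "?r' v"] by (simp add: img' reindex_inv)
  have box: "(?F' has_integral k) (cbox (?r a) (?r b))" if "(?F has_integral k) (cbox a b)" for a b
      k
  proof -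
    have "((\<lambda>y. ?F (?r' y)) has_integral (1 / 1) *\<^sub>R k) (?r ` cbox a b)"
      by (rule has_integral_twiddle[OF _ _ _ cont' _ _ content' that])
        (auto simp: reindex_inv img' reindex_cbox)
    moreover have "?F (?r' y) = ?F' y" for y
      by (metis (no_types, lifting) image_iff reindex_inv)
    ultimately show ?thesis
      by (simp add: reindex_cbox)
  qed
  have iff: "?F integrable_on cbox (?r' a) (?r' b) \<Longrightarrow> ?F' integrable_on cbox a b
      \<and> integral (cbox a b) ?F' = integral (cbox (?r' a) (?r' b)) ?F" for a b
    using box[OF integrable_integral, of "?r' a" "?r' b"] by (auto simp: reindex_inv)
  note A = assms[unfolded has_integral_alt'[of f]]
  show ?thesis
    unfolding has_integral_alt'[of _ i]
  proof (intro conjI allI impI)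
    show "?F' integrable_on cbox a b" for a b
      using iff A by blast
    fix e :: real assume "e > 0"
    then obtain B where B: "B > 0" "\<And>a b. ball 0 B \<subseteq> cbox a b \<Longrightarrow> norm (integral (cbox a b) ?F - i) <
        e"
      using A by meson
    show "\<exists>B>0. \<forall>a b. ball 0 B \<subseteq> cbox a b \<longrightarrow> norm (integral (cbox a b) ?F' - i) < e"
    proof (intro exI conjI allI impI)
      fix a b :: "real^'m" assume ab: "ball 0 B \<subseteq> cbox a b"
      have "ball 0 B \<subseteq> cbox (?r' a) (?r' b)"
      proof
        fix x :: "real^'n" assume "x \<in> ball 0 B"
        then have "?r x \<in> cbox a b"
          using ab by (auto simp: norm_reindex)
        then have "?r' (?r x) \<in> cbox (?r' a) (?r' b)"
          using img' by blast
        then show "x \<in> cbox (?r' a) (?r' b)"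
          by (simp add: reindex_inv)
      qed
      then show "norm (integral (cbox a b) ?F' - i) < e"
        using B(2) iff A by metis
    qed (fact B(1))
  qed
qed

lemma absolutely_integrable_reindex:
  fixes f :: "real^'n \<Rightarrow> real"
  assumes "f absolutely_integrable_on S"
  shows "(\<lambda>y. f (reindex (inv \<beta>) y)) absolutely_integrable_on (reindex \<beta> ` S)"
    and "integral (reindex \<beta> ` S) (\<lambda>y. f (reindex (inv \<beta>) y)) = integral S f"
proof -
  have 1: "(f has_integral integral S f) S" "((\<lambda>x. norm (f x)) has_integral integral S (\<lambda>x. norm (f
      x))) S"
    using assms by (auto simp: absolutely_integrable_on_def)
  note 2 = has_integral_reindex[OF 1(1)] has_integral_reindex[OF 1(2)]
  then show "(\<lambda>y. f (reindex (inv \<beta>) y)) absolutely_integrable_on (reindex \<beta> ` S)"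
    by (auto simp: absolutely_integrable_on_def integrable_on_def)
  show "integral (reindex \<beta> ` S) (\<lambda>y. f (reindex (inv \<beta>) y)) = integral S f"
    using 2(1) by (rule integral_unique)
qed

end

text \<open>The map is conjugated with the relabelling to the well-ordered index type. This only
  relabels rows and columns of its derivative, so the determinant is unchanged. The real integrand
  enters the general theorem as a function into \<open>real^1\<close>.\<close>

theorem change_of_variables_compact:
  fixes f :: "real^'n::finite \<Rightarrow> real" and g :: "real^'n \<Rightarrow> real^'n"
  assumes S: "compact S"
    and der: "\<And>x. x \<in> S \<Longrightarrow> (g has_derivative g' x) (at x within S)"
    and inj: "inj_on g S"
    and f: "f absolutely_integrable_on (g ` S)"
  shows "(\<lambda>x. \<bar>det (matrix (g' x))\<bar> * f (g x)) absolutely_integrable_on S"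
    and "integral S (\<lambda>x. \<bar>det (matrix (g' x))\<bar> * f (g x)) = integral (g ` S) f"
proof -
  define r where "r = (reindex of_wo :: real^'n \<Rightarrow> real^'n wo)"
  define r' where "r' = (reindex (inv of_wo) :: real^'n wo \<Rightarrow> real^'n)"
  note bij = bij_of_wo[where 'a='n]
  have bij': "bij (inv (of_wo :: 'n wo \<Rightarrow> 'n))"
    by (rule bij_imp_bij_inv[OF bij])
  have r [simp]: "r' (r x) = x" "r (r' y) = y" for x y
    unfolding r_def r'_def by (rule reindex_inv[OF bij])+
  have lin: "linear r" "linear r'"
    unfolding r_def r'_def by (rule linear_reindex[OF bij] linear_reindex[OF bij'])+
  have invinv: "inv (inv (of_wo :: 'n wo \<Rightarrow> 'n)) = of_wo"
    by (rule inv_inv_eq[OF bij])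
  define G where "G = (\<lambda>y. r (g (r' y)))"
  define G' where "G' = (\<lambda>y h. r (g' (r' y) (r' h)))"
  have "compact (r ` S)"
    unfolding r_def by (rule compact_continuous_image[OF continuous_reindex[OF bij] S])
  then have leb: "r ` S \<in> sets lebesgue"
    by (rule fmeasurableD[OF lmeasurable_compact])
  have derG: "(G has_derivative G' y) (at y within r ` S)" if "y \<in> r ` S" for y
  proof -
    have y: "r' y \<in> S"
      using that by auto
    have im: "r' ` r ` S = S"
      by (simp add: image_image)
    have 1: "(r' has_derivative r') (at y within r ` S)"
      using lin by (simp add: bounded_linear_imp_has_derivative linear_linear)
    have 2: "(g has_derivative g' (r' y)) (at (r' y) within r' ` r ` S)"
      using der[OF y] by (simp add: im)
    have 3: "(r has_derivative r) (at (g (r' y)))"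
      using lin by (simp add: bounded_linear_imp_has_derivative linear_linear)
    show ?thesis
      using has_derivative_compose[OF has_derivative_in_compose[OF 1 2] 3]
      by (simp add: G_def[abs_def] G'_def)
  qed
  have injG: "inj_on G (r ` S)"
    using inj unfolding G_def inj_on_def by (metis image_iff r)
  have img: "G ` r ` S = r ` g ` S"
    by (simp add: G_def image_image)
  have F: "(\<lambda>y. f (r' y)) absolutely_integrable_on (r ` g ` S)"
    "integral (r ` g ` S) (\<lambda>y. f (r' y)) = integral (g ` S) f"
    unfolding r_def r'_def by (rule absolutely_integrable_reindex[OF bij f])+
  define fv :: "real^'n wo \<Rightarrow> real^1" where "fv = (\<lambda>y. vec (f (r' y)))"
  have "\<bar>det (matrix (G' y))\<bar> = \<bar>det (matrix (g' (r' y)))\<bar>" if "y \<in> r ` S" for y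
  proof -
    have r'ax: "r' (axis j 1) = axis (of_wo j) 1" for j
    proof -
      have "inv of_wo i = j \<longleftrightarrow> i = of_wo j" for i
        using bij bij_inv_eq_iff by metis
      then show ?thesis
        by (simp add: r'_def reindex_def axis_def vec_eq_iff)
    qed
    have "matrix (G' y) = (\<chi> i j. matrix (g' (r' y)) $ of_wo i $ of_wo j)"
      by (simp add: matrix_def G'_def r_def reindex_def vec_eq_iff r'ax)
    then show ?thesis
      by (simp add: det_reindex[OF bij])
  qed note detG = this
  have *: "(\<lambda>y. \<bar>det (matrix (G' y))\<bar> *\<^sub>R fv (G y)) absolutely_integrable_on (r ` S) \<and>
      integral (r ` S) (\<lambda>y. \<bar>det (matrix (G' y))\<bar> *\<^sub>R fv (G y)) = b \<longleftrightarrow>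
      fv absolutely_integrable_on (r ` g ` S) \<and> integral (r ` g ` S) fv = b" for b
    using has_absolute_integral_change_of_variables[OF leb derG injG, of fv b] by (simp add: img)
  have fv: "fv absolutely_integrable_on (r ` g ` S)" "integral (r ` g ` S) fv = vec (integral (g `
      S) f)"
    using F by (simp_all add: fv_def absolutely_integrable_on_1_iff integral_on_1_eq)
  have **: "(\<lambda>y. \<bar>det (matrix (G' y))\<bar> *\<^sub>R fv (G y)) absolutely_integrable_on (r ` S)"
      "integral (r ` S) (\<lambda>y. \<bar>det (matrix (G' y))\<bar> *\<^sub>R fv (G y)) = vec (integral (g ` S) f)"
    using * fv by auto
  have 1: "(\<lambda>y. \<bar>det (matrix (G' y))\<bar> * f (r' (G y))) absolutely_integrable_on (r ` S)"
    using **(1) by (simp add: fv_def absolutely_integrable_on_1_iff)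
  have 2: "integral (r ` S) (\<lambda>y. \<bar>det (matrix (G' y))\<bar> * f (r' (G y))) = integral (g ` S) f"
    using **(2) by (simp add: fv_def integral_on_1_eq)
  have eq: "\<bar>det (matrix (G' (r x)))\<bar> * f (r' (G (r x))) = \<bar>det (matrix (g' x))\<bar> * f (g x)"
    if "x \<in> S" for x
    using detG[of "r x"] that by (simp add: G_def)
  have im: "r' ` r ` S = S"
    by (simp add: image_image)
  have 3: "(\<lambda>x. \<bar>det (matrix (G' (r x)))\<bar> * f (r' (G (r x)))) absolutely_integrable_on S"
    "integral S (\<lambda>x. \<bar>det (matrix (G' (r x)))\<bar> * f (r' (G (r x)))) = integral (g ` S) f"
    using absolutely_integrable_reindex[OF bij' 1] unfolding invinv r_def[symmetric]
        r'_def[symmetric] im 2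
    by simp_all
  show "(\<lambda>x. \<bar>det (matrix (g' x))\<bar> * f (g x)) absolutely_integrable_on S"
    using 3(1) by (subst set_integrable_cong) (use eq in auto)
  show "integral S (\<lambda>x. \<bar>det (matrix (g' x))\<bar> * f (g x)) = integral (g ` S) f"
    using 3(2) by (subst integral_cong) (use eq in auto)
qed

section \<open>Polytopes with nonempty interior\<close>

lemma absolutely_integrable_continuous_compact:
  fixes f :: "'a::euclidean_space \<Rightarrow> real"
  assumes "compact S" "continuous_on S f"
  shows "f absolutely_integrable_on S"
proof -
  have "integrable lborel (\<lambda>x. indicator S x *\<^sub>R f x)"
    by (rule borel_integrable_compact[OF assms])
  moreover from this have "(\<lambda>x. indicator S x *\<^sub>R f x) \<in> borel_measurable lborel"
    by (rule borel_measurable_integrable)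
  ultimately show ?thesis
    by (simp add: set_integrable_def integrable_completion)
qed

text \<open>For a facet of a full-dimensional polytope this is the signed distance to its
  hyperplane, positive on the inner side. Any base point in \<open>f\<close> gives the same value,
  and the formula is visibly affine in \<open>x\<close>.\<close>

definition gap :: "(real^'n) set \<Rightarrow> (real^'n) set \<Rightarrow> real^'n \<Rightarrow> real" where
  "gap K f x = ref_normal K f \<bullet> ((SOME a. a \<in> f) - x)"

definition foot :: "(real^'n) set \<Rightarrow> (real^'n) set \<Rightarrow> real^'n \<Rightarrow> real^'n" where
  "foot K f z = z + gap K f z *\<^sub>R ref_normal K f"

text \<open>The domain of integration in \<open>facet_integral\<close>. It lies on the outer side of
  the facet, where the gap runs from 0 down to -1.\<close>

definition cylinder :: "(real^'n) set \<Rightarrow> (real^'n) set \<Rightarrow> (real^'n) set" where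
  "cylinder K f = {y + t *\<^sub>R ref_normal K f |y t. y \<in> f \<and> t \<in> {0..1}}"

text \<open>The first hyperplane contains \<open>b *\<^sub>R n\<close> and also that point moved by
  the tangential part of n'. Comparing the values of n' at both points forces n' to be orthogonal to
  its own tangential part, that is, equality in the Cauchy-Schwarz inequality.\<close>

lemma unit_normals_parallel:
  fixes n n' :: "'a::euclidean_space"
  assumes "norm n = 1" "norm n' = 1" and sub: "{x. n \<bullet> x = b} \<subseteq> {x. n' \<bullet> x = b'}"
  shows "n' = n \<and> b' = b \<or> n' = - n \<and> b' = - b"
proof -
  have nn: "n \<bullet> n = 1" "n' \<bullet> n' = 1"
    using assms by (auto simp: norm_eq_1)
  have "n \<bullet> (b *\<^sub>R n) = b" "n \<bullet> (b *\<^sub>R n + (n' - (n \<bullet> n') *\<^sub>R n)) = b"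
    using nn by (auto simp: inner_add_right inner_diff_right)
  then have b': "n' \<bullet> (b *\<^sub>R n) = b'" and 1: "n' \<bullet> (b *\<^sub>R n + (n' - (n \<bullet> n') *\<^sub>R n)) = b'"
    using sub by blast+
  then have "n' \<bullet> (n' - (n \<bullet> n') *\<^sub>R n) = 0"
    by (simp add: inner_add_right)
  then have "(n \<bullet> n')\<^sup>2 = 1"
    using nn by (simp add: inner_diff_right inner_commute power2_eq_square)
  then have "n \<bullet> n' = 1 \<or> n \<bullet> n' = -1"
    by (simp add: power2_eq_1_iff)
  then show ?thesis
  proof
    assume "n \<bullet> n' = 1"
    then have "(n' - n) \<bullet> (n' - n) = 0"
      using nn by (simp add: inner_diff_left inner_diff_right inner_commute)
    then have "n' = n"
      by simp
    then show ?thesis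
      using b' nn by simp
  next
    assume "n \<bullet> n' = -1"
    then have "(n' + n) \<bullet> (n' + n) = 0"
      using nn by (simp add: inner_add_left inner_add_right inner_commute)
    then have "n' = - n"
      by (simp add: eq_neg_iff_add_eq_0)
    then show ?thesis
      using b' nn by simp
  qed
qed

section \<open>Facets of a full-dimensional polytope and their outward normals\<close>

locale full_polytope =
  fixes K :: "(real^'n) set"
  assumes polytope: "polytope K" and interior: "interior K \<noteq> {}"
begin

lemma compact: "compact K" and convex: "convex K" and nonempty: "K \<noteq> {}" and closed: "closed K"
  using polytope interior interior_subset[of K]
  by (auto simp: polytope_imp_compact polytope_imp_convex polytope_imp_closed)

lemma aff_dim: "aff_dim K = int CARD('n)"
  using aff_dim_nonempty_interior[OF interior] by simp

lemma finite_facets: "finite {f. f facet_of K}"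
  using finite_polytope_facets[OF polytope] .

lemma facet_supporting:
  assumes f: "f facet_of K"
  obtains n b where "norm n = 1" "K \<subseteq> {x. n \<bullet> x \<le> b}" "f = K \<inter> {x. n \<bullet> x = b}"
proof -
  obtain a b where a: "a \<noteq> 0" "K \<subseteq> {x. a \<bullet> x \<le> b}" "f = K \<inter> {x. a \<bullet> x = b}"
    using facet_of_polyhedron[OF polytope_imp_polyhedron[OF polytope] f] by metis
  define n where "n = a /\<^sub>R norm a"
  have n: "n \<bullet> x = (a \<bullet> x) / norm a" for x
    by (simp add: n_def divide_inverse_commute)
  show ?thesis
  proof
    show "norm n = 1"
      using a(1) by (simp add: n_def)
    show "K \<subseteq> {x. n \<bullet> x \<le> b / norm a}" "f = K \<inter> {x. n \<bullet> x = b / norm a}"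
      using a by (auto simp: n divide_le_cancel)
  qed
qed

lemma not_subset_hyperplane:
  assumes "norm n = 1" "K \<subseteq> {x. n \<bullet> x = b}"
  shows False
proof -
  have "interior {x. n \<bullet> x = b} = {}"
    using assms(1) by (intro interior_hyperplane) auto
  then show False
    using interior_mono[OF assms(2)] interior by auto
qed

lemma affine_hull_facet:
  assumes f: "f facet_of K" and n: "norm n = 1" "f \<subseteq> {x. n \<bullet> x = b}"
  shows "affine hull f = {x. n \<bullet> x = b}"
proof -
  have n0: "n \<noteq> 0"
    using n(1) by auto
  have "aff_dim f = int CARD('n) - 1"
    using f by (simp add: facet_of_def aff_dim)
  then have "aff_dim (affine hull f) = aff_dim {x. n \<bullet> x = b}"
    using n0 by (simp add: aff_dim_hyperplane)
  moreover have "affine hull f \<subseteq> {x. n \<bullet> x = b}"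
    using n(2) by (intro hull_minimal affine_hyperplane)
  moreover have "affine hull f \<noteq> {}"
    using f by (simp add: facet_of_def)
  ultimately show ?thesis
    by (intro affine_dim_equal affine_hyperplane) auto
qed

text \<open>The affine hull of the facet is a hyperplane and determines the normal up to sign; with
  the opposite sign also supporting, the polytope would lie inside the hyperplane. This makes the
  description in \<open>ref_normal\<close> a proper definition.\<close>

lemma facet_normal_unique:
  assumes f: "f facet_of K"
    and n: "norm n = 1" "K \<subseteq> {x. n \<bullet> x \<le> b}" "f = K \<inter> {x. n \<bullet> x = b}"
    and n': "norm n' = 1" "K \<subseteq> {x. n' \<bullet> x \<le> b'}" "f = K \<inter> {x. n' \<bullet> x = b'}"
  shows "n = n'" "b = b'"
proof -
  have "{x. n \<bullet> x = b} = {x. n' \<bullet> x = b'}"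
    using affine_hull_facet[OF f n(1), of b] affine_hull_facet[OF f n'(1), of b'] n(3) n'(3) by auto
  then consider "n' = n \<and> b' = b" | "n' = - n \<and> b' = - b"
    using unit_normals_parallel[OF n(1) n'(1), of b b'] by auto
  then have "n = n' \<and> b = b'"
  proof cases
    case 2
    then have "K \<subseteq> {x. n \<bullet> x = b}"
      using n(2) n'(2) by fastforce
    then show ?thesis
      using not_subset_hyperplane n(1) by blast
  qed auto
  then show "n = n'" "b = b'"
    by auto
qed

lemma ref_normal_eqI:
  assumes f: "f facet_of K"
    and n: "norm n = 1" "K \<subseteq> {x. n \<bullet> x \<le> b}" "f = K \<inter> {x. n \<bullet> x = b}"
  shows "ref_normal K f = n"
  unfolding ref_normal_def
proof (rule the_equality)
  show "norm n = 1 \<and> (\<exists>b. K \<subseteq> {x. n \<bullet> x \<le> b} \<and> f = K \<inter> {x. n \<bullet> x = b})"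
    using n by blast
  fix m assume "norm m = 1 \<and> (\<exists>b. K \<subseteq> {x. m \<bullet> x \<le> b} \<and> f = K \<inter> {x. m \<bullet> x = b})"
  then show "m = n"
    using facet_normal_unique[OF f n] by metis
qed

lemma gap_eqI:
  assumes f: "f facet_of K"
    and n: "norm n = 1" "K \<subseteq> {x. n \<bullet> x \<le> b}" "f = K \<inter> {x. n \<bullet> x = b}"
  shows "gap K f x = b - n \<bullet> x"
proof -
  have "f \<noteq> {}"
    using f by (simp add: facet_of_def)
  then have "(SOME a. a \<in> f) \<in> f"
    by (simp add: some_in_eq)
  then have "n \<bullet> (SOME a. a \<in> f) = b"
    using n(3) by blast
  then show ?thesis
    unfolding gap_def ref_normal_eqI[OF f n] by (simp add: inner_diff_right)
qed

end

section \<open>A single facet: gap, orthogonal projection and cylinder\<close>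

locale polytope_facet = full_polytope K for K :: "(real^'n) set" +
  fixes f :: "(real^'n) set"
  assumes facet: "f facet_of K"
begin

lemma normal: "norm (ref_normal K f) = 1"
  using facet_supporting[OF facet] ref_normal_eqI[OF facet] by metis

lemma normal_inner [simp]: "ref_normal K f \<bullet> ref_normal K f = 1"
  using normal by (simp add: norm_eq_1)

lemma gap_nonneg: "x \<in> K \<Longrightarrow> 0 \<le> gap K f x"
  and mem_facet: "x \<in> f \<longleftrightarrow> x \<in> K \<and> gap K f x = 0"
proof -
  obtain n b where n: "norm n = 1" "K \<subseteq> {x. n \<bullet> x \<le> b}" "f = K \<inter> {x. n \<bullet> x = b}"
    using facet_supporting[OF facet] .
  note g = gap_eqI[OF facet n]
  show "x \<in> K \<Longrightarrow> 0 \<le> gap K f x"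
    using n(2) by (auto simp: g)
  show "x \<in> f \<longleftrightarrow> x \<in> K \<and> gap K f x = 0"
    unfolding g using n(3) by auto
qed

lemma gap_add: "gap K f (x + v) = gap K f x - ref_normal K f \<bullet> v"
  by (simp add: gap_def inner_diff_right inner_add_right)

lemma continuous_gap [continuous_intros]: "continuous_on S g \<Longrightarrow> continuous_on S (\<lambda>x. gap K f (g x))"
  unfolding gap_def by (intro continuous_intros)

lemma gap_foot [simp]: "gap K f (foot K f z) = 0"
  by (simp add: foot_def gap_add)

lemma continuous_foot: "continuous_on S (foot K f)"
  unfolding foot_def by (intro continuous_intros)

lemma facet_subset: "f \<subseteq> K" and facet_nonempty: "f \<noteq> {}" and facet_compact: "compact f"
  and facet_convex: "convex f"
proof -
  show "f \<subseteq> K" "f \<noteq> {}"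
    using facet by (auto simp: facet_of_def dest: face_of_imp_subset)
  show "compact f" "convex f"
    using facet face_of_imp_compact[OF convex compact] face_of_imp_convex
    by (auto simp: facet_of_def)
qed

lemma hyperplane: "affine hull f = {x. gap K f x = 0}"
proof -
  obtain n b where n: "norm n = 1" "K \<subseteq> {x. n \<bullet> x \<le> b}" "f = K \<inter> {x. n \<bullet> x = b}"
    using facet_supporting[OF facet] .
  show ?thesis
    unfolding gap_eqI[OF facet n] using affine_hull_facet[OF facet n(1), of b] n(3) by auto
qed

lemma closest_point_eq_foot: "closest_point (affine hull f) z = foot K f z"
proof (rule closest_point_unique[symmetric])
  show "convex (affine hull f)" "closed (affine hull f)"
    by (simp_all add: affine_imp_convex)
  show "foot K f z \<in> affine hull f"
    by (simp add: hyperplane)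
  show "\<forall>x\<in>affine hull f. dist z (foot K f z) \<le> dist z x"
  proof
    fix x assume "x \<in> affine hull f"
    then have "gap K f z = ref_normal K f \<bullet> (x - z)"
      using gap_add[of z "x - z"] by (simp add: hyperplane)
    then have "\<bar>gap K f z\<bar> \<le> norm (x - z)"
      using Cauchy_Schwarz_ineq2[of "ref_normal K f" "x - z"] by (simp add: normal)
    then show "dist z (foot K f z) \<le> dist z x"
      by (simp add: dist_norm foot_def normal norm_minus_commute)
  qed
qed

lemma mem_cylinder: "z \<in> cylinder K f \<longleftrightarrow> foot K f z \<in> f \<and> - gap K f z \<in> {0..1}"
proof
  assume "z \<in> cylinder K f"
  then obtain y t where z: "z = y + t *\<^sub>R ref_normal K f" "y \<in> f" "t \<in> {0..1}"
    by (auto simp: cylinder_def)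
  moreover have "gap K f z = - t"
    using z by (simp add: gap_add mem_facet)
  ultimately show "foot K f z \<in> f \<and> - gap K f z \<in> {0..1}"
    by (simp add: foot_def)
next
  assume *: "foot K f z \<in> f \<and> - gap K f z \<in> {0..1}"
  then have "z = foot K f z + (- gap K f z) *\<^sub>R ref_normal K f"
    by (simp add: foot_def)
  with * show "z \<in> cylinder K f"
    unfolding cylinder_def by blast
qed

lemma compact_cylinder: "compact (cylinder K f)"
proof -
  have "cylinder K f = (\<lambda>(y, t). y + t *\<^sub>R ref_normal K f) ` (f \<times> {0..1})"
    by (fastforce simp: cylinder_def)
  then show ?thesis
    by (auto intro!: compact_continuous_image compact_Times facet_compact continuous_intros
        simp: case_prod_unfold)
qed

lemma facet_integral_eq:
  "facet_integral f (ref_normal K f) g = integral (cylinder K f) (\<lambda>z. g (foot K f z))"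
  by (simp add: facet_integral_def cylinder_def closest_point_eq_foot)

lemma foot_cylinder: "foot K f ` cylinder K f \<subseteq> f"
  using mem_cylinder by auto

lemma facet_integrand_continuous:
  assumes "continuous_on f g"
  shows "continuous_on (cylinder K f) (\<lambda>z. g (foot K f z))"
  using assms foot_cylinder by (intro continuous_on_compose2[OF assms continuous_foot]) auto

lemma facet_integrable:
  fixes g :: "real^'n \<Rightarrow> real"
  assumes "continuous_on f g"
  shows "(\<lambda>z. g (foot K f z)) absolutely_integrable_on cylinder K f"
  by (intro absolutely_integrable_continuous_compact compact_cylinder facet_integrand_continuous
      assms)

lemma facet_integral_cong:
  assumes "\<And>y. y \<in> f \<Longrightarrow> g y = h y"
  shows "facet_integral f (ref_normal K f) g = facet_integral f (ref_normal K f) h"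
  unfolding facet_integral_eq using assms mem_cylinder by (intro integral_cong) auto

lemma facet_integral_add:
  assumes "continuous_on f g" "continuous_on f h"
  shows "facet_integral f (ref_normal K f) (\<lambda>y. g y + h y) =
    facet_integral f (ref_normal K f) g + facet_integral f (ref_normal K f) h"
  unfolding facet_integral_eq
  using facet_integrable[OF assms(1)] facet_integrable[OF assms(2)]
  by (intro integral_add) (auto simp: absolutely_integrable_on_def)

lemma facet_integral_cmult:
  "facet_integral f (ref_normal K f) (\<lambda>y. c * g y) = c * facet_integral f (ref_normal K f) g"
  unfolding facet_integral_eq by simp

text \<open>If the hyperplane of \<open>f\<close> lay in that of f', the normals would agree up to
  sign: equal normals give equal facets, opposite ones flatten the polytope.\<close>

lemma other_facet_normal:
  assumes "f' facet_of K" "f' \<noteq> f"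
  shows "{x. gap K f x = 0} \<inter> {x. gap K f' x \<noteq> 0} \<noteq> {}"
proof
  assume *: "{x. gap K f x = 0} \<inter> {x. gap K f' x \<noteq> 0} = {}"
  obtain n b where n: "norm n = 1" "K \<subseteq> {x. n \<bullet> x \<le> b}" "f = K \<inter> {x. n \<bullet> x = b}"
    using facet_supporting[OF facet] .
  obtain n' b' where n': "norm n' = 1" "K \<subseteq> {x. n' \<bullet> x \<le> b'}" "f' = K \<inter> {x. n' \<bullet> x = b'}"
    using facet_supporting[OF assms(1)] .
  have "{x. n \<bullet> x = b} \<subseteq> {x. n' \<bullet> x = b'}"
    using * unfolding gap_eqI[OF facet n] gap_eqI[OF assms(1) n'] by auto
  then consider "n' = n \<and> b' = b" | "n' = - n \<and> b' = - b"
    using unit_normals_parallel[OF n(1) n'(1)] by metis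
  then show False
  proof cases
    case 1
    then show ?thesis
      using assms(2) n(3) n'(3) by simp
  next
    case 2
    then have "K \<subseteq> {x. n \<bullet> x = b}"
      using n(2) n'(2) by fastforce
    then show ?thesis
      using not_subset_hyperplane n(1) by blast
  qed
qed

text \<open>The gap to f' after projection along the normal of \<open>f\<close> is affine. It is not
  identically zero because the two facets span different hyperplanes, so its zero set is a
  hyperplane or empty.\<close>

lemma negligible_over_other_facet:
  assumes "f' facet_of K" "f' \<noteq> f"
  shows "negligible {z. gap K f' (foot K f z) = 0}"
proof -
  let ?n = "ref_normal K f" and ?n' = "ref_normal K f'"
  define a where "a = ?n' - (?n' \<bullet> ?n) *\<^sub>R ?n"
  define c where "c = gap K f' (foot K f 0)"
  have eq: "gap K f' (foot K f z) = c - a \<bullet> z" for z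
    by (simp add: c_def a_def gap_def foot_def inner_diff_right inner_add_right inner_diff_left
        algebra_simps
        inner_commute)
  have "a \<noteq> 0 \<or> c \<noteq> 0"
  proof (rule ccontr)
    assume "\<not> (a \<noteq> 0 \<or> c \<noteq> 0)"
    then have "gap K f' (foot K f z) = 0" for z
      using eq by simp
    moreover have "foot K f x = x" if "gap K f x = 0" for x
      using that by (simp add: foot_def)
    ultimately have "gap K f' x = 0" if "gap K f x = 0" for x
      using that by metis
    then show False
      using other_facet_normal[OF assms] by auto
  qed
  then have "negligible {z. a \<bullet> z = c}"
    by (rule negligible_hyperplane)
  then show ?thesis
    by (rule negligible_subset) (auto simp: eq)
qed

text \<open>Described by strict gap inequalities so that it fits the cutoff functions: at such a
  point only the factor of \<open>f\<close> itself can be small. The points of the cylinder above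
  its complement form a null set.\<close>

definition facet_interior :: "(real^'n) set" where
  "facet_interior = {y \<in> f. \<forall>f'. f' facet_of K \<and> f' \<noteq> f \<longrightarrow> 0 < gap K f' y}"

lemma negligible_cylinder_boundary:
  "negligible {z \<in> cylinder K f. foot K f z \<notin> facet_interior}"
proof (rule negligible_subset)
  show "negligible (\<Union>f'\<in>{f'. f' facet_of K} - {f}. {z. gap K f' (foot K f z) = 0})"
    using finite_facets negligible_over_other_facet by (intro negligible_Union finite_imageI) auto
  show "{z \<in> cylinder K f. foot K f z \<notin> facet_interior}
    \<subseteq> (\<Union>f'\<in>{f'. f' facet_of K} - {f}. {z. gap K f' (foot K f z) = 0})"
  proof
    fix z assume "z \<in> {z \<in> cylinder K f. foot K f z \<notin> facet_interior}"
    then have z: "z \<in> cylinder K f" "foot K f z \<notin> facet_interior"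
      by auto
    then obtain f' where f': "f' facet_of K" "f' \<noteq> f" "\<not> 0 < gap K f' (foot K f z)"
      using mem_cylinder by (auto simp: facet_interior_def)
    interpret f': polytope_facet K f'
      by unfold_locales (fact f')
    have "foot K f z \<in> K"
      using z mem_cylinder facet_subset by auto
    then have "gap K f' (foot K f z) = 0"
      using f'.gap_nonneg f'(3) by force
    with f' show "z \<in> (\<Union>f'\<in>{f'. f' facet_of K} - {f}. {z. gap K f' (foot K f z) = 0})"
      by blast
  qed
qed

text \<open>A nonnegative affine function on \<open>f\<close> that vanishes at a relative interior
  point vanishes on all of \<open>f\<close>, since every segment through that point can be
  prolonged. Applied to the gap of another facet, this would put the hyperplane of \<open>f\<close>
  inside the hyperplane of that facet.\<close>

lemma rel_interior_subset_facet_interior: "rel_interior f \<subseteq> facet_interior"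
proof
  fix y assume y: "y \<in> rel_interior f"
  then have yf: "y \<in> f"
    using rel_interior_subset by blast
  have "0 < gap K f' y" if f': "f' facet_of K" "f' \<noteq> f" for f'
  proof (rule ccontr)
    interpret f': polytope_facet K f'
      by unfold_locales (fact f')
    assume "\<not> 0 < gap K f' y"
    moreover have nonneg: "0 \<le> gap K f' x" if "x \<in> f" for x
      using that facet_subset f'.gap_nonneg by blast
    ultimately have y0: "gap K f' y = 0"
      using yf by (metis less_le)
    have "gap K f' x = 0" if xf: "x \<in> f" for x
    proof -
      have "\<forall>x\<in>f. \<exists>e>1. (1 - e) *\<^sub>R x + e *\<^sub>R y \<in> f"
        using y by (simp only: convex_rel_interior_iff[OF facet_convex facet_nonempty, of y])
      then obtain e where e: "e > 1" "(1 - e) *\<^sub>R x + e *\<^sub>R y \<in> f"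
        using xf by metis
      have "(1 - e) *\<^sub>R x + e *\<^sub>R y = y + (1 - e) *\<^sub>R (x - y)"
        by (simp add: algebra_simps)
      then have "gap K f' ((1 - e) *\<^sub>R x + e *\<^sub>R y) = (1 - e) * gap K f' x + e * gap K f' y"
        by (simp add: gap_def inner_diff_right inner_add_right algebra_simps)
      then have "0 \<le> (1 - e) * gap K f' x"
        using nonneg[OF e(2)] y0 by simp
      then have "gap K f' x \<le> 0"
        using e(1) by (simp add: zero_le_mult_iff)
      then show ?thesis
        using nonneg[OF xf] by linarith
    qed
    then have "f \<subseteq> {x. gap K f' x = 0}"
      by blast
    moreover have "affine {x. gap K f' x = 0}"
      using f'.hyperplane by (metis affine_affine_hull)
    ultimately have "affine hull f \<subseteq> {x. gap K f' x = 0}"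
      by (rule hull_minimal)
    then show False
      using other_facet_normal[OF f'] hyperplane by auto
  qed
  with yf show "y \<in> facet_interior"
    by (simp add: facet_interior_def)
qed

end

section \<open>The polytope, its interior and its frontier in terms of gaps\<close>

context full_polytope
begin

lemma facet_locale: "f facet_of K \<Longrightarrow> polytope_facet K f"
  by unfold_locales

text \<open>In a minimal representation as an intersection of halfspaces every bounding hyperplane
  cuts out a facet, so the facets alone decide membership. The nonempty interior makes the affine
  hull the whole space.\<close>

lemma mem_iff_gaps: "x \<in> K \<longleftrightarrow> (\<forall>f. f facet_of K \<longrightarrow> 0 \<le> gap K f x)"
proof
  show "x \<in> K \<Longrightarrow> \<forall>f. f facet_of K \<longrightarrow> 0 \<le> gap K f x"
    using polytope_facet.gap_nonneg facet_locale by blast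
  assume x: "\<forall>f. f facet_of K \<longrightarrow> 0 \<le> gap K f x"
  have "affine hull K = UNIV"
    using interior by (rule affine_hull_nonempty_interior)
  obtain F where F: "finite F" "K = affine hull K \<inter> \<Inter>F"
    "\<And>h. h \<in> F \<Longrightarrow> \<exists>a b. a \<noteq> 0 \<and> h = {x. a \<bullet> x \<le> b}"
    "\<And>F'. F' \<subset> F \<Longrightarrow> K \<subset> affine hull K \<inter> \<Inter>F'"
    using polytope_imp_polyhedron[OF polytope] by (simp add: polyhedron_Int_affine_minimal) meson
  then obtain a b where ab: "\<And>h. h \<in> F \<Longrightarrow> a h \<noteq> 0 \<and> h = {x. a h \<bullet> x \<le> b h}"
    by metis
  have "x \<in> h" if h: "h \<in> F" for h
  proof -
    define C where "C = K \<inter> {x. a h \<bullet> x = b h}"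
    have C: "C facet_of K"
      using facet_of_polyhedron_explicit[OF F(1,2) ab F(4), of C] h by (auto simp: C_def)
    define n where "n = a h /\<^sub>R norm (a h)"
    have n: "n \<bullet> x = (a h \<bullet> x) / norm (a h)" for x
      by (simp add: n_def divide_inverse_commute)
    have ah: "a h \<noteq> 0"
      using ab h by blast
    have "gap K C x = b h / norm (a h) - n \<bullet> x"
    proof (rule gap_eqI[OF C])
      show "norm n = 1"
        using ah by (simp add: n_def)
      have "K \<subseteq> h"
        using F(2) h by blast
      then show "K \<subseteq> {x. n \<bullet> x \<le> b h / norm (a h)}"
        using ab[OF h] by (auto simp: n divide_le_cancel)
      show "C = K \<inter> {x. n \<bullet> x = b h / norm (a h)}"
        using ah by (auto simp: C_def n)
    qed
    moreover have "0 \<le> gap K C x"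
      using x C by blast
    ultimately have "n \<bullet> x \<le> b h / norm (a h)"
      by simp
    then have "a h \<bullet> x \<le> b h"
      using ah by (simp add: n divide_le_cancel)
    then show ?thesis
      using ab[OF h] by auto
  qed
  then show "x \<in> K"
    using F(2) \<open>affine hull K = UNIV\<close> by auto
qed

lemma mem_interior_iff_gaps: "x \<in> interior K \<longleftrightarrow> (\<forall>f. f facet_of K \<longrightarrow> 0 < gap K f x)"
proof
  assume x: "x \<in> interior K"
  show "\<forall>f. f facet_of K \<longrightarrow> 0 < gap K f x"
  proof (intro allI impI)
    fix f assume "f facet_of K"
    then interpret polytope_facet K f
      by (rule facet_locale)
    obtain e where e: "e > 0" "cball x e \<subseteq> K"
      using x by (auto simp: mem_interior_cball)
    have "x + e *\<^sub>R ref_normal K f \<in> K"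
      using e normal by (intro subsetD[OF e(2)]) (simp add: dist_norm)
    then show "0 < gap K f x"
      using gap_nonneg[of "x + e *\<^sub>R ref_normal K f"] e(1) by (simp add: gap_add)
  qed
next
  assume x: "\<forall>f. f facet_of K \<longrightarrow> 0 < gap K f x"
  let ?U = "\<Inter>f\<in>{f. f facet_of K}. {x. 0 < gap K f x}"
  have "open ?U"
    using finite_facets unfolding gap_def
    by (intro open_INT ballI open_Collect_less continuous_intros) auto
  moreover have "?U \<subseteq> K"
  proof
    fix y assume "y \<in> ?U"
    then have "\<forall>f. f facet_of K \<longrightarrow> 0 < gap K f y"
      by blast
    then show "y \<in> K"
      unfolding mem_iff_gaps by (simp add: less_imp_le)
  qed
  ultimately have "?U \<subseteq> interior K"
    by (intro interior_maximal)
  moreover have "x \<in> ?U"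
    using x by blast
  ultimately show "x \<in> interior K"
    by blast
qed

lemma frontier_eq_Union_facets: "frontier K = \<Union> {f. f facet_of K}"
proof -
  have "x \<in> frontier K \<longleftrightarrow> x \<in> K \<and> (\<exists>f. f facet_of K \<and> gap K f x = 0)" for x
  proof -
    have "x \<in> frontier K \<longleftrightarrow> x \<in> K \<and> x \<notin> interior K"
      using closed by (simp add: frontier_def closure_closed)
    also have "\<dots> \<longleftrightarrow> x \<in> K \<and> (\<exists>f. f facet_of K \<and> gap K f x = 0)"
    proof
      assume x: "x \<in> K \<and> x \<notin> interior K"
      then obtain f where "f facet_of K" "\<not> 0 < gap K f x"
        using mem_interior_iff_gaps by blast
      moreover from this x have "0 \<le> gap K f x"
        using mem_iff_gaps by blast
      ultimately show "x \<in> K \<and> (\<exists>f. f facet_of K \<and> gap K f x = 0)"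
        using x by (metis less_le)
    next
      assume "x \<in> K \<and> (\<exists>f. f facet_of K \<and> gap K f x = 0)"
      then show "x \<in> K \<and> x \<notin> interior K"
        using mem_interior_iff_gaps[of x] by (metis less_irrefl)
    qed
    finally show ?thesis .
  qed
  moreover have "x \<in> \<Union> {f. f facet_of K} \<longleftrightarrow> x \<in> K \<and> (\<exists>f. f facet_of K \<and> gap K f x = 0)" for x
    using polytope_facet.mem_facet facet_locale by blast
  ultimately show ?thesis
    by blast
qed

end

section \<open>Boundary layers\<close>

text \<open>A ramp with slope one. It is Lipschitz and has kinks only at 0 and 1, hence its
  composition with an affine gap is differentiable off two level sets.\<close>

definition clamp01 :: "real \<Rightarrow> real" where
  "clamp01 t = max 0 (min 1 t)"

lemma clamp01_range: "0 \<le> clamp01 t" "clamp01 t \<le> 1" "\<bar>clamp01 t\<bar> \<le> 1"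
  by (auto simp: clamp01_def)

lemma clamp01_eq_1: "1 \<le> t \<Longrightarrow> clamp01 t = 1"
  by (simp add: clamp01_def)

lemma clamp01_lipschitz: "\<bar>clamp01 s - clamp01 t\<bar> \<le> \<bar>s - t\<bar>"
  by (auto simp: clamp01_def)

lemma continuous_clamp01 [continuous_intros]:
  "continuous_on S g \<Longrightarrow> continuous_on S (\<lambda>x. clamp01 (g x))"
  unfolding clamp01_def by (intro continuous_intros)

lemma abs_prod_clamp01_le: "\<bar>\<Prod>i\<in>I. clamp01 (t i)\<bar> \<le> 1"
proof -
  have "\<bar>\<Prod>i\<in>I. clamp01 (t i)\<bar> = (\<Prod>i\<in>I. \<bar>clamp01 (t i)\<bar>)"
    by (rule abs_prod)
  also have "\<dots> \<le> (\<Prod>i\<in>I. 1)"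
    by (intro prod_mono) (simp add: clamp01_range)
  finally show ?thesis
    by simp
qed

context polytope_facet
begin

text \<open>Blows up a thin layer below the facet to the cylinder of height one above it.\<close>
definition stretch :: "real \<Rightarrow> real^'n \<Rightarrow> real^'n" where
  "stretch c z = z + ((1 + c) * gap K f z) *\<^sub>R ref_normal K f"

lemma gap_stretch: "gap K f (stretch c z) = - c * gap K f z"
  by (simp add: stretch_def gap_add algebra_simps)

lemma stretch_stretch:
  assumes "c \<noteq> 0"
  shows "stretch (1 / c) (stretch c z) = z"
proof -
  have "stretch (1 / c) (stretch c z)
      = stretch c z + ((1 + 1 / c) * (- c * gap K f z)) *\<^sub>R ref_normal K f"
    unfolding stretch_def[of "1 / c"] gap_stretch ..
  also have "(1 + 1 / c) * (- c * gap K f z) = - ((1 + c) * gap K f z)"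
    using assms by (simp add: field_simps)
  finally show ?thesis
    by (simp add: stretch_def)
qed

lemma continuous_stretch: "continuous_on S (stretch c)"
  unfolding stretch_def by (intro continuous_intros)

lemma stretch_has_derivative:
  "(stretch c has_derivative (\<lambda>h. h + (ref_normal K f \<bullet> h) *\<^sub>R (- (1 + c) *\<^sub>R ref_normal K f))) (at
      z within S)"
  unfolding stretch_def[abs_def] gap_def
  by (auto intro!: derivative_eq_intros simp: algebra_simps)

text \<open>The map fixes the directions along the facet and multiplies the normal direction by -c;
  the negative sign records that the layer below the facet is turned over to its upper side.\<close>

lemma det_stretch:
  "det (matrix (\<lambda>h. h + (ref_normal K f \<bullet> h) *\<^sub>R (- (1 + c) *\<^sub>R ref_normal K f))) = - c"
  using det_rank_one_update[OF normal, of "- (1 + c) *\<^sub>R ref_normal K f"] by simp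

definition other_facets :: "(real^'n) set set" where
  "other_facets = {f'. f' facet_of K} - {f}"

text \<open>The layer has thickness 1/m. Blowing it up by the factor m costs a Jacobian 1/m, which
  cancels the weight m, and the integrand then converges by dominated convergence to the trace on
  the facet, constant in the normal direction. The weights of the other facets tend to one above the
  interior of the facet.\<close>

lemma layer_limit:
  assumes cont: "continuous_on K \<Phi>"
  shows "(\<lambda>m. integral {x \<in> K. real (Suc m) * gap K f x \<le> 1}
            (\<lambda>x. real (Suc m) * (\<Prod>f'\<in>other_facets. clamp01 (real (Suc m) * gap K f' x)) * \<Phi> x))
         \<longlonglongrightarrow> facet_integral f (ref_normal K f) \<Phi>"
proof -
  define M where "M = (\<lambda>m. real (Suc m))"
  have M0: "M m > 0" and M1: "M m \<ge> 1" for m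
    by (simp_all add: M_def)
  define L where "L = (\<lambda>m. {x \<in> K. M m * gap K f x \<le> 1})"
  define W where "W = (\<lambda>m x. \<Prod>f'\<in>other_facets. clamp01 (M m * gap K f' x))"
  \<comment> \<open>The inverse of the blow-up: it compresses the outer side back into the
    layer.\<close>
  define g where "g = (\<lambda>m. stretch (1 / M m))"
  have g_inv: "g m (stretch (M m) x) = x" "stretch (M m) (g m z) = z" for m x z
    using stretch_stretch[of "M m"] stretch_stretch[of "1 / M m"] M0[of m] by (simp_all add: g_def)
  \<comment> \<open>In general not the cylinder, since neighbouring facets need not meet
    \<open>f\<close> at right angles. The cylinder appears only in the limit, up to a null
    set.\<close>
  define S where "S = (\<lambda>m. stretch (M m) ` L m)"
  have memS: "z \<in> S m \<longleftrightarrow> g m z \<in> L m" for z m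
  proof
    show "z \<in> S m \<Longrightarrow> g m z \<in> L m"
      by (auto simp: S_def g_inv)
    show "g m z \<in> L m \<Longrightarrow> z \<in> S m"
      unfolding S_def using g_inv(2)[of m z] by (intro image_eqI[of _ _ "g m z"]) simp_all
  qed
  have gapg: "gap K f (g m z) = - gap K f z / M m" for m z
    by (simp add: g_def gap_stretch)
  have compactL: "compact (L m)" for m
  proof -
    have "L m = K \<inter> {x. M m * gap K f x \<le> 1}"
      by (auto simp: L_def)
    moreover have "closed {x. M m * gap K f x \<le> 1}"
      by (intro closed_Collect_le continuous_intros)
    ultimately show ?thesis
      by (simp add: compact_Int_closed compact)
  qed
  then have compactS: "compact (S m)" for m
    unfolding S_def by (intro compact_continuous_image continuous_stretch)
  have contgap: "continuous_on A (gap K f')" for A f'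
    unfolding gap_def by (intro continuous_intros)
  have contW: "continuous_on A (W m)" for m A
    unfolding W_def by (intro continuous_intros contgap)
  define h where "h = (\<lambda>m z. if z \<in> S m then W m (g m z) * \<Phi> (g m z) else 0)"
  have contg: "continuous_on A (g m)" for A m
    unfolding g_def by (rule continuous_stretch)
  have gS: "g m ` S m = L m" for m
    by (simp add: S_def image_image g_inv)
  have cint: "continuous_on (L m) (\<lambda>x. W m x * \<Phi> x)" for m
    by (intro continuous_intros contW continuous_on_subset[OF cont]) (auto simp: L_def)
  have h_int: "h m integrable_on UNIV" for m
  proof -
    have "continuous_on (S m) (\<lambda>z. W m (g m z) * \<Phi> (g m z))"
      using continuous_on_compose2[OF cint contg] gS by blast
    then have "(\<lambda>z. W m (g m z) * \<Phi> (g m z)) integrable_on S m"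
      using absolutely_integrable_continuous_compact[OF compactS]
      by (simp add: absolutely_integrable_on_def)
    then show ?thesis
      unfolding h_def integrable_restrict_UNIV .
  qed
  have int_eq: "integral (L m) (\<lambda>x. M m * W m x * \<Phi> x) = integral UNIV (h m)" for m
  proof -
    let ?F = "\<lambda>x. M m * W m x * \<Phi> x"
    have "continuous_on (L m) ?F"
      using continuous_on_mult_left[OF cint[of m], of "M m"] by (simp add: mult.assoc)
    then have "?F absolutely_integrable_on (g m ` S m)"
      unfolding gS by (rule absolutely_integrable_continuous_compact[OF compactL])
    moreover have "inj_on (g m) (S m)"
      using g_inv by (intro inj_on_inverseI)
    ultimately have "integral (g m ` S m) ?F = integral (S m) (\<lambda>z. \<bar>- (1 / M m)\<bar> * ?F (g m z))"
      using change_of_variables_compact(2)[OF compactS[of m] stretch_has_derivative[of "1 / M m"],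
          of ?F]
      unfolding det_stretch g_def by simp
    also have "\<dots> = integral (S m) (\<lambda>z. W m (g m z) * \<Phi> (g m z))"
      using M0[of m] by (intro integral_cong) simp
    also have "\<dots> = integral UNIV (h m)"
      unfolding h_def by (rule Henstock_Kurzweil_Integration.integral_restrict_UNIV[symmetric])
    finally show ?thesis
      by (simp add: gS)
  qed
  define N where "N = {z \<in> cylinder K f. foot K f z \<notin> facet_interior}"
  have N: "negligible N"
    unfolding N_def by (rule negligible_cylinder_boundary)
  define h0 where "h0 = (\<lambda>z. if z \<in> cylinder K f then \<Phi> (foot K f z) else 0)"
  obtain B where B: "\<And>x. x \<in> K \<Longrightarrow> \<bar>\<Phi> x\<bar> \<le> B"
    using compact_imp_bounded[OF compact_continuous_image[OF cont compact]]
    by (auto simp: bounded_iff)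
  have B0: "B \<ge> 0"
    using B nonempty by (meson abs_ge_zero all_not_in_conv order_trans)
  obtain R where R: "\<And>x. x \<in> K \<Longrightarrow> norm x \<le> R"
    using compact_imp_bounded[OF compact] by (auto simp: bounded_iff)
  have g_lim: "(\<lambda>m. g m z) \<longlonglongrightarrow> foot K f z" for z
  proof -
    have "(\<lambda>m. 1 / M m) \<longlonglongrightarrow> 0"
      using LIMSEQ_inverse_real_of_nat by (simp add: M_def inverse_eq_divide)
    then have "(\<lambda>m. z + ((1 + 1 / M m) * gap K f z) *\<^sub>R ref_normal K f) \<longlonglongrightarrow>
        z + ((1 + 0) * gap K f z) *\<^sub>R ref_normal K f"
      by (intro tendsto_intros)
    then show ?thesis
      by (simp add: g_def stretch_def foot_def)
  qed
  have gap_lim: "(\<lambda>m. gap K f' (g m z)) \<longlonglongrightarrow> gap K f' (foot K f z)" for f' z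
    using g_lim[of z] unfolding gap_def by (intro tendsto_intros)
  have conv: "(\<lambda>m. if z \<in> N then 0 else h m z) \<longlonglongrightarrow> (if z \<in> N then 0 else h0 z)" for z
  proof (cases "z \<in> N")
    case False
    have "(\<lambda>m. h m z) \<longlonglongrightarrow> h0 z"
    proof (cases "z \<in> cylinder K f")
      case True
      then have fi: "foot K f z \<in> facet_interior" and fz: "foot K f z \<in> f" and t: "- gap K f z \<in>
          {0..1}"
        using False mem_cylinder by (auto simp: N_def)
      \<comment> \<open>The gap to another facet tends to its positive value at the foot of z, so
        multiplied by m it tends to infinity and the clamp reaches 1.\<close>
      have ev: "\<forall>\<^sub>F m in sequentially. 1 \<le> M m * gap K f' (g m z)" if f': "f' \<in> other_facets" for f'
      proof -
        have pos: "0 < gap K f' (foot K f z)"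
          using fi f' by (auto simp: facet_interior_def other_facets_def)
        have "filterlim (\<lambda>m. M m) at_top sequentially"
          unfolding M_def by (rule filterlim_compose[OF filterlim_real_sequentially filterlim_Suc])
        then have "filterlim (\<lambda>m. gap K f' (g m z) * M m) at_top sequentially"
          by (rule filterlim_tendsto_pos_mult_at_top[OF gap_lim pos])
        then have "\<forall>\<^sub>F m in sequentially. 1 \<le> gap K f' (g m z) * M m"
          by (simp add: filterlim_at_top)
        then show ?thesis
          by (simp add: mult.commute)
      qed
      have "finite other_facets"
        using finite_facets by (simp add: other_facets_def)
      then have all: "\<forall>\<^sub>F m in sequentially. \<forall>f'\<in>other_facets. 1 \<le> M m * gap K f' (g m z)"
        using ev by (intro eventually_ball_finite) auto
      then have inK: "\<forall>\<^sub>F m in sequentially. g m z \<in> K"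
      proof eventually_elim
        case (elim m)
        have "0 \<le> gap K f' (g m z)" if "f' facet_of K" for f'
        proof (cases "f' = f")
          case True
          then show ?thesis
            using t M0[of m] by (simp add: gapg divide_nonpos_pos)
        next
          case False
          then have "1 \<le> M m * gap K f' (g m z)"
            using elim that by (auto simp: other_facets_def)
          then show ?thesis
            using M0[of m] by (smt (verit) mult_nonneg_nonpos)
        qed
        then show ?case
          by (simp add: mem_iff_gaps)
      qed
      have "\<forall>\<^sub>F m in sequentially. \<Phi> (g m z) = h m z"
        using all inK
      proof eventually_elim
        case (elim m)
        have "W m (g m z) = 1"
          unfolding W_def using elim(1) by (intro prod.neutral ballI clamp01_eq_1) auto
        moreover have "z \<in> S m"
          using elim(2) t M0[of m] by (auto simp: memS L_def gapg)
        ultimately show ?case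
          by (simp add: h_def)
      qed
      moreover have "(\<lambda>m. \<Phi> (g m z)) \<longlonglongrightarrow> \<Phi> (foot K f z)"
        by (rule continuous_on_tendsto_compose[OF cont g_lim _ inK]) (use fz facet_subset in blast)
      ultimately have "(\<lambda>m. h m z) \<longlonglongrightarrow> \<Phi> (foot K f z)"
        by (rule Lim_transform_eventually[rotated])
      then show ?thesis
        using True by (simp add: h0_def)
    next
      \<comment> \<open>Outside the cylinder either the height is wrong, which excludes z from every
        \<open>S m\<close>, or the foot lies outside the closed polytope, and then
        \<open>g m z\<close> eventually does too.\<close>
      case out: False
      have "\<forall>\<^sub>F m in sequentially. z \<notin> S m"
      proof (cases "- gap K f z \<in> {0..1}")
        case True
        then have "foot K f z \<notin> K"
          using out by (auto simp: mem_cylinder mem_facet)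
        then have "\<forall>\<^sub>F m in sequentially. g m z \<in> - K"
          using g_lim[of z] closed by (intro topological_tendstoD[of _ "foot K f z"]) auto
        then show ?thesis
          by eventually_elim (auto simp: memS L_def)
      next
        case False
        have "z \<notin> S m" for m
        proof
          assume "z \<in> S m"
          then have "g m z \<in> K" "M m * gap K f (g m z) \<le> 1"
            by (auto simp: memS L_def)
          moreover from this have "0 \<le> gap K f (g m z)"
            using gap_nonneg by blast
          ultimately show False
            using False M0[of m] by (auto simp: gapg zero_le_divide_iff divide_le_0_iff)
        qed
        then show ?thesis
          by simp
      qed
      then have "\<forall>\<^sub>F m in sequentially. h m z = 0"
        by eventually_elim (simp add: h_def)
      then show ?thesis
        using out by (simp add: h0_def tendsto_eventually)
    qed
    then show ?thesis
      using False by simp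
  qed simp
  \<comment> \<open>The blow-up moves a point of the layer by (1 + 1/m) times a gap of modulus at
    most 1, hence by at most 2.\<close>
  have bound: "norm (if z \<in> N then 0 else h m z) \<le> (if z \<in> cball 0 (R + 2) then B else 0)" for m z
  proof (cases "z \<in> S m")
    case True
    then have gz: "g m z \<in> K" "M m * gap K f (g m z) \<le> 1" "0 \<le> gap K f (g m z)"
      using gap_nonneg by (auto simp: memS L_def)
    then have t: "\<bar>gap K f z\<bar> \<le> 1"
      using M0[of m] by (auto simp: gapg zero_le_divide_iff divide_le_0_iff)
    have "z = g m z - ((1 + 1 / M m) * gap K f z) *\<^sub>R ref_normal K f"
      by (simp add: g_def stretch_def)
    then have "norm z \<le> norm (g m z) + norm (((1 + 1 / M m) * gap K f z) *\<^sub>R ref_normal K f)"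
      by (metis norm_triangle_ineq4)
    also have "norm (((1 + 1 / M m) * gap K f z) *\<^sub>R ref_normal K f) = \<bar>1 + 1 / M m\<bar> * \<bar>gap K f z\<bar>"
      by (simp add: normal abs_mult)
    also have "\<dots> \<le> 2 * 1"
      using t M1[of m] by (intro mult_mono) (auto simp: divide_le_eq)
    finally have "z \<in> cball 0 (R + 2)"
      using R[OF gz(1)] by simp
    moreover have "\<bar>W m (g m z) * \<Phi> (g m z)\<bar> \<le> 1 * B"
      unfolding abs_mult using B[OF gz(1)] abs_prod_clamp01_le unfolding W_def
      by (intro mult_mono) auto
    ultimately show ?thesis
      using B0 True by (simp add: h_def)
  qed (use B0 in \<open>simp add: h_def\<close>)
  have "(\<lambda>m. integral UNIV (\<lambda>z. if z \<in> N then 0 else h m z)) \<longlonglongrightarrow> integral UNIV (\<lambda>z. if z \<in> N then 0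
      else h0 z)"
  proof (rule dominated_convergence(2)[OF _ _ bound conv])
    show "(\<lambda>z. if z \<in> N then 0 else h k z) integrable_on UNIV" for k
      by (rule integrable_spike[OF h_int[of k] N]) auto
    show "(\<lambda>z. if z \<in> cball 0 (R + 2) then B else 0) integrable_on UNIV"
      unfolding integrable_restrict_UNIV by (rule integrable_on_const) simp
  qed
  moreover have "integral UNIV (\<lambda>z. if z \<in> N then 0 else h m z) = integral UNIV (h m)" for m
    by (rule integral_spike[OF N]) auto
  moreover have "integral UNIV (\<lambda>z. if z \<in> N then 0 else h0 z) = integral UNIV h0"
    by (rule integral_spike[OF N]) auto
  moreover have "integral UNIV h0 = facet_integral f (ref_normal K f) \<Phi>"
    unfolding h0_def facet_integral_eq by (rule
        Henstock_Kurzweil_Integration.integral_restrict_UNIV)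
  ultimately show ?thesis
    by (simp add: int_eq[symmetric] L_def M_def W_def)
qed

end

section \<open>Compactly supported Lipschitz functions\<close>

text \<open>By translation invariance every difference quotient has integral zero. The Lipschitz
  constant and the bounded support provide a dominating function, so the limit of the quotients,
  which exists off a null set, has integral zero as well.\<close>

lemma integral_directional_derivative_zero:
  fixes G :: "real^'n \<Rightarrow> real"
  assumes lip: "\<And>x y. \<bar>G x - G y\<bar> \<le> L * norm (x - y)"
    and supp: "\<And>x. x \<notin> cball 0 R \<Longrightarrow> G x = 0"
    and N: "negligible N"
    and der: "\<And>x. x \<notin> N \<Longrightarrow> ((\<lambda>t. G (x + t *\<^sub>R e)) has_real_derivative G' x) (at 0)"
  shows "integral UNIV G' = 0"
proof -
  define v where "v = (\<lambda>k. (1 / real (Suc k)) *\<^sub>R e)"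
  define q where "q = (\<lambda>k x. real (Suc k) * (G (x + v k) - G x))"
  have L0: "L * norm x \<ge> 0" for x :: "real^'n"
    using order_trans[OF abs_ge_zero lip[of x 0]] by simp
  have "continuous_on UNIV G"
  proof -
    have "(\<bar>L\<bar> + 1)-lipschitz_on UNIV G"
    proof (rule lipschitz_onI)
      fix x y :: "real^'n"
      have "L * norm (x - y) \<le> (\<bar>L\<bar> + 1) * norm (x - y)"
        by (intro mult_right_mono) auto
      then show "dist (G x) (G y) \<le> (\<bar>L\<bar> + 1) * dist x y"
        using lip[of x y] by (simp add: dist_norm)
    qed simp
    then show ?thesis
      by (rule lipschitz_on_continuous_on)
  qed
  then have absG: "G absolutely_integrable_on cball 0 R"
    by (intro absolutely_integrable_continuous_compact[OF compact_cball]) (rule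
        continuous_on_subset[OF _ subset_UNIV])
  have eqG: "G = (\<lambda>x. if x \<in> cball 0 R then G x else 0)"
    using supp by auto
  have intG: "G integrable_on UNIV" "integral UNIV G = integral (cball 0 R) G"
  proof -
    show "integral UNIV G = integral (cball 0 R) G"
      using Henstock_Kurzweil_Integration.integral_restrict_UNIV[of "cball 0 R" G]
      unfolding eqG[symmetric] .
    show "G integrable_on UNIV"
      using absG integrable_restrict_UNIV[of "cball 0 R" G]
      unfolding eqG[symmetric] absolutely_integrable_on_def by blast
  qed
  have shift: "(\<lambda>x. G (x + u)) integrable_on UNIV" "integral UNIV (\<lambda>x. G (x + u)) = integral UNIV G"
      for u
  proof -
    have img: "(\<lambda>x. x + u) ` cball (- u) R = cball 0 R"
      using image_add_cball[of u "- u" R] by (simp add: add.commute[of _ u])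
    have der1: "((\<lambda>x. x + u) has_derivative (\<lambda>h. h)) (at x within cball (- u) R)" for x
      by (auto intro!: derivative_eq_intros)
    have det1: "det (matrix (\<lambda>h::real^'n. h)) = 1"
    proof -
      have "matrix (\<lambda>h::real^'n. h) = mat 1"
        by (simp add: matrix_def mat_def axis_def vec_eq_iff)
      then show ?thesis
        by simp
    qed
    have cov: "(\<lambda>x. G (x + u)) absolutely_integrable_on cball (- u) R"
      "integral (cball (- u) R) (\<lambda>x. G (x + u)) = integral (cball 0 R) G"
      using change_of_variables_compact[OF compact_cball der1, where f = G] absG
      unfolding img det1 by (simp_all add: inj_on_def)
    have eq: "(\<lambda>x. G (x + u)) = (\<lambda>x. if x \<in> cball (- u) R then G (x + u) else 0)"
    proof
      fix x
      have "x + u \<in> cball 0 R \<longleftrightarrow> x \<in> cball (- u) R"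
      proof -
        have "- u - x = - (x + u)"
          by simp
        then have "norm (- u - x) = norm (x + u)"
          by (metis norm_minus_cancel)
        then have "dist (- u) x = dist 0 (x + u)"
          by (simp only: dist_norm diff_0 norm_minus_cancel)
        then show ?thesis
          by (simp only: mem_cball)
      qed
      then show "G (x + u) = (if x \<in> cball (- u) R then G (x + u) else 0)"
        using supp by auto
    qed
    show "(\<lambda>x. G (x + u)) integrable_on UNIV"
      using cov(1) integrable_restrict_UNIV[of "cball (- u) R" "\<lambda>x. G (x + u)"]
      unfolding eq[symmetric] absolutely_integrable_on_def by blast
    show "integral UNIV (\<lambda>x. G (x + u)) = integral UNIV G"
      using cov(2) intG(2)
        Henstock_Kurzweil_Integration.integral_restrict_UNIV[of "cball (- u) R" "\<lambda>x. G (x + u)"]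
      unfolding eq[symmetric] by simp
  qed
  have q_int: "q k integrable_on UNIV" "integral UNIV (q k) = 0" for k
  proof -
    have 1: "(\<lambda>x. G (x + v k) - G x) integrable_on UNIV" "integral UNIV (\<lambda>x. G (x + v k) - G x) = 0"
      using shift[of "v k"] intG(1) by (auto intro: integrable_diff simp: integral_diff)
    then show "q k integrable_on UNIV" "integral UNIV (q k) = 0"
      unfolding q_def by (auto intro: integrable_on_mult_right)
  qed
  define B where "B = L * norm e"
  \<comment> \<open>The increments \<open>v k\<close> are no longer than \<open>e\<close>, so a ball
    enlarged by \<open>norm e\<close> carries the support of every difference quotient.\<close>
  have bound: "norm (if x \<in> N then 0 else q k x) \<le> (if x \<in> cball 0 (R + norm e) then B else 0)" for
      k x
  proof (cases "x \<in> cball 0 (R + norm e)")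
    case True
    have "\<bar>G (x + v k) - G x\<bar> \<le> L * norm (v k)"
      using lip[of "x + v k" x] by simp
    also have "\<dots> = B / real (Suc k)"
      by (simp add: v_def B_def)
    finally have "\<bar>q k x\<bar> \<le> B"
      by (simp add: q_def abs_mult pos_le_divide_eq mult.commute)
    then show ?thesis
      using True L0[of e] by (auto simp: B_def)
  next
    case False
    have "norm (v k) \<le> norm e"
      by (simp add: v_def divide_le_eq mult_le_cancel_left1)
    then have "x \<notin> cball 0 R" "x + v k \<notin> cball 0 R"
      using False norm_triangle_ineq4[of "x + v k" "v k"] norm_ge_zero[of e]
      unfolding mem_cball dist_0_norm add_diff_cancel_right' by linarith+
    then have "q k x = 0"
      using supp by (simp add: q_def)
    then show ?thesis
      using False by simp
  qed
  have conv: "(\<lambda>k. if x \<in> N then 0 else q k x) \<longlonglongrightarrow> (if x \<in> N then 0 else G' x)" for x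
  proof (cases "x \<in> N")
    case False
    have "(\<lambda>h. (G (x + h *\<^sub>R e) - G x) / h) \<midarrow>0\<rightarrow> G' x"
      using der[OF False] by (simp add: DERIV_def)
    moreover have "filterlim (\<lambda>k. 1 / real (Suc k)) (at 0) sequentially"
      using LIMSEQ_inverse_real_of_nat
      by (auto simp: filterlim_at inverse_eq_divide)
    ultimately have "(\<lambda>k. (G (x + (1 / real (Suc k)) *\<^sub>R e) - G x) / (1 / real (Suc k))) \<longlonglongrightarrow> G' x"
      by (rule filterlim_compose)
    then have "(\<lambda>k. q k x) \<longlonglongrightarrow> G' x"
      by (simp add: q_def v_def mult.commute)
    then show ?thesis
      using False by simp
  qed simp
  have "(\<lambda>k. integral UNIV (\<lambda>x. if x \<in> N then 0 else q k x)) \<longlonglongrightarrow> integral UNIV (\<lambda>x. if x \<in> N then 0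
      else G' x)"
  proof (rule dominated_convergence(2)[OF _ _ bound conv])
    show "(\<lambda>x. if x \<in> N then 0 else q k x) integrable_on UNIV" for k
      by (rule integrable_spike[OF q_int(1) N]) auto
    show "(\<lambda>z. if z \<in> cball 0 (R + norm e) then B else 0) integrable_on UNIV"
      unfolding integrable_restrict_UNIV by (rule integrable_on_const) simp
  qed
  moreover have "integral UNIV (\<lambda>x. if x \<in> N then 0 else q k x) = integral UNIV (q k)" for k
    by (rule integral_spike[OF N]) auto
  moreover have "integral UNIV (\<lambda>x. if x \<in> N then 0 else G' x) = integral UNIV G'"
    by (rule integral_spike[OF N]) auto
  ultimately have "(\<lambda>k. 0) \<longlonglongrightarrow> integral UNIV G'"
    by (simp add: q_int(2))
  then show ?thesis
    using LIMSEQ_unique tendsto_const by metis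
qed

section \<open>Curved elements\<close>

lemma norm_matrix_vector_mult_le_norm:
  fixes A :: "real^'n^'m"
  shows "norm (A *v x) \<le> norm A * norm x"
proof -
  have "norm (A *v x) = L2_set (\<lambda>k. norm ((A *v x) $ k)) UNIV"
    by (simp add: norm_vec_def)
  also have "\<dots> \<le> L2_set (\<lambda>k. norm (A $ k) * norm x) UNIV"
    by (intro L2_set_mono) (auto simp: matrix_vector_mul_component Cauchy_Schwarz_ineq2)
  also have "\<dots> = norm A * norm x"
    by (simp add: norm_vec_def[of A] L2_set_left_distrib)
  finally show ?thesis .
qed

lemma continuous_det [continuous_intros]:
  fixes A :: "'a::topological_space \<Rightarrow> real^'n^'n"
  assumes "continuous_on S A"
  shows "continuous_on S (\<lambda>x. det (A x))"
  unfolding det_def using assms by (intro continuous_intros)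

lemma continuous_matrix_vector_mult [continuous_intros]:
  fixes A :: "'a::topological_space \<Rightarrow> real^'n^'m"
  assumes "continuous_on S A" "continuous_on S v"
  shows "continuous_on S (\<lambda>x. A x *v v x)"
  unfolding matrix_vector_mult_def using assms by (intro continuous_intros)

lemma continuous_transpose [continuous_intros]:
  fixes A :: "'a::topological_space \<Rightarrow> real^'n^'m"
  assumes "continuous_on S A"
  shows "continuous_on S (\<lambda>x. transpose (A x))"
  unfolding transpose_def using assms by (intro continuous_intros)

text \<open>By Cramer's rule each entry of the inverse is a quotient of determinants.\<close>

lemma continuous_matrix_inv:
  fixes A :: "'a::topological_space \<Rightarrow> real^'n^'n"
  assumes A: "continuous_on S A" and inv: "\<And>x. x \<in> S \<Longrightarrow> invertible (A x)"
  shows "continuous_on S (\<lambda>x. matrix_inv (A x))"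
proof -
  have eq: "matrix_inv (A x) $ k $ l = det (\<chi> i j. if j = k then axis l 1 $ i else A x $ i $ j) /
      det (A x)"
    if "x \<in> S" for x k l
  proof -
    have "A x *v (matrix_inv (A x) *v axis l 1) = axis l 1"
      by (rule matrix_inv_vector[OF inv[OF that]])
    then have "matrix_inv (A x) *v axis l 1
        = (\<chi> k. det (\<chi> i j. if j = k then axis l 1 $ i else A x $ i $ j) / det (A x))"
      using cramer[of "A x"] inv[OF that] by (simp add: invertible_det_nz)
    then show ?thesis
      by (simp add: vec_eq_iff matrix_vector_mul_component inner_axis)
  qed
  have "continuous_on S (\<lambda>x. matrix_inv (A x) $ k $ l)" for k l
  proof -
    have "continuous_on S (\<lambda>x. if j = k then axis l 1 $ i else A x $ i $ j)" for i j
      using A by (cases "j = k") (auto intro!: continuous_intros)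
    then have "continuous_on S (\<lambda>x. det (\<chi> i j. if j = k then axis l 1 $ i else A x $ i $ j) / det
        (A x))"
      using A inv by (intro continuous_intros) (auto simp: invertible_det_nz)
    then show ?thesis
      by (rule continuous_on_cong[THEN iffD1, rotated -1]) (auto simp: eq)
  qed
  then have "continuous_on S (\<lambda>x. \<chi> k l. matrix_inv (A x) $ k $ l)"
    by (intro continuous_on_vec_lambda)
  then show ?thesis
    by simp
qed

lemma invertible_transpose_real:
  fixes A :: "real^'n^'n"
  shows "invertible (transpose A) \<longleftrightarrow> invertible A"
  by (simp add: invertible_det_nz)

lemma matrix_inv_transpose_inner:
  fixes A :: "real^'n^'n"
  assumes "invertible A"
  shows "(matrix_inv (transpose A) *v x) \<bullet> y = x \<bullet> (matrix_inv A *v y)"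
proof -
  define z where "z = matrix_inv (transpose A) *v x"
  have "transpose A *v z = x"
    unfolding z_def using assms by (intro matrix_inv_vector) (simp add: invertible_transpose_real)
  then have "x \<bullet> (matrix_inv A *v y) = (z v* A) \<bullet> (matrix_inv A *v y)"
    by simp
  also have "\<dots> = z \<bullet> (A *v (matrix_inv A *v y))"
    by (rule dot_lmul_matrix)
  finally show ?thesis
    by (simp add: matrix_inv_vector[OF assms] z_def)
qed

lemma directional_derivative:
  fixes G :: "'a::real_normed_vector \<Rightarrow> real"
  assumes "(G has_derivative D) (at x)"
  shows "((\<lambda>t. G (x + t *\<^sub>R e)) has_real_derivative D e) (at 0)"
proof -
  interpret D: bounded_linear D
    using assms by (rule has_derivative_bounded_linear)
  have "((\<lambda>t. x + t *\<^sub>R e) has_derivative (\<lambda>t. t *\<^sub>R e)) (at 0)"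
    by (auto intro!: derivative_eq_intros)
  moreover have "(G has_derivative D) (at (x + 0 *\<^sub>R e))"
    using assms by simp
  ultimately have "((\<lambda>t. G (x + t *\<^sub>R e)) has_derivative (\<lambda>t. D (t *\<^sub>R e))) (at 0)"
    by (rule has_derivative_compose)
  then show ?thesis
    by (simp add: has_field_derivative_def D.scaleR mult_commute_abs)
qed

locale curved_element = full_polytope K for K :: "(real^'n) set" +
  fixes T :: "real^'n \<Rightarrow> real^'n"
  assumes diffeo: "C1_diffeo_on K T"
begin

abbreviation J :: "real^'n \<Rightarrow> real^'n^'n" where
  "J y \<equiv> jacobian T (at y)"

definition Ti :: "real^'n \<Rightarrow> real^'n" where
  "Ti = inv_into K T"

definition cnormal :: "(real^'n) set \<Rightarrow> real^'n \<Rightarrow> real^'n" where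
  "cnormal f y = matrix_inv (transpose (J y)) *v ref_normal K f"

lemma T_inj: "inj_on T K"
  using diffeo by (simp add: C1_diffeo_on_def)

lemma Ti_T [simp]: "y \<in> K \<Longrightarrow> Ti (T y) = y"
  unfolding Ti_def by (rule inv_into_f_f[OF T_inj])

lemma T_Ti: "x \<in> T ` K \<Longrightarrow> T (Ti x) = x" "x \<in> T ` K \<Longrightarrow> Ti x \<in> K"
  unfolding Ti_def by (auto simp: f_inv_into_f inv_into_into)

lemma T_deriv: "y \<in> K \<Longrightarrow> (T has_derivative (\<lambda>h. J y *v h)) (at y within S)"
proof -
  assume "y \<in> K"
  then have "T differentiable (at y)"
    using diffeo by (auto simp: C1_diffeo_on_def)
  then show ?thesis
    using has_derivative_at_withinI jacobian_works by blast
qed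

lemma J_cont: "continuous_on K J"
  using diffeo by (auto simp: C1_diffeo_on_def intro: continuous_on_subset)

lemma J_invertible: "y \<in> K \<Longrightarrow> invertible (J y)"
  using diffeo by (auto simp: C1_diffeo_on_def invertible_det_nz)

lemma J_inv_cont: "continuous_on K (\<lambda>y. matrix_inv (J y))"
  by (intro continuous_matrix_inv J_cont J_invertible)

lemma T_cont: "continuous_on K T"
  using T_deriv by (meson differentiable_at_withinI differentiable_imp_continuous_within
      continuous_on_eq_continuous_within differentiable_def)

lemma image_compact: "Topological_Spaces.compact (T ` K)"
  by (rule compact_continuous_image[OF T_cont compact])

lemma det_J_cont: "continuous_on K (\<lambda>y. \<bar>det (J y)\<bar>)"
  by (intro continuous_intros J_cont)

lemma cnormal_cont: "continuous_on K (cnormal f)"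
  unfolding cnormal_def
  by (intro continuous_intros continuous_matrix_inv J_cont) (simp add: invertible_transpose_real
      J_invertible)

lemma cnormal_inner: "y \<in> K \<Longrightarrow> cnormal f y \<bullet> e = ref_normal K f \<bullet> (matrix_inv (J y) *v e)"
  unfolding cnormal_def by (rule matrix_inv_transpose_inner[OF J_invertible])

text \<open>Close to \<open>a\<close> the difference between T and its linearization has Lipschitz
  constant m/2, by the mean value inequality on a convex set, so T keeps half of the lower bound m
  of the linear map.\<close>

lemma local_lower_bound:
  assumes a: "a \<in> K"
  obtains m r where "m > 0" "r > 0"
    "\<And>x y. x \<in> K \<inter> ball a r \<Longrightarrow> y \<in> K \<inter> ball a r \<Longrightarrow> m * norm (x - y) \<le> norm (T x - T y)"
proof -
  have "inj (\<lambda>h. J a *v h)"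
    by (rule inj_matrix_vector_mult[OF J_invertible[OF a]])
  then obtain m where m: "m > 0" "\<And>h. m * norm h \<le> norm (J a *v h)"
    using linear_inj_bounded_below_pos matrix_vector_mul_linear by blast
  obtain r where r: "r > 0" "\<And>x. x \<in> K \<Longrightarrow> dist x a < r \<Longrightarrow> dist (J x) (J a) < m / 2"
    using J_cont a m(1) unfolding continuous_on_iff by (metis half_gt_zero)
  have "m / 2 * norm (x - y) \<le> norm (T x - T y)" if xy: "x \<in> K \<inter> ball a r" "y \<in> K \<inter> ball a r" for x
      y
  proof -
    have cvx: "convex (K \<inter> ball a r)"
      by (intro convex_Int convex convex_ball)
    have "norm ((\<lambda>z. T z - J a *v z) x - (\<lambda>z. T z - J a *v z) y) \<le> m / 2 * norm (x - y)"
    proof (rule differentiable_bound[OF cvx _ _ xy])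
      fix z assume z: "z \<in> K \<inter> ball a r"
      show "((\<lambda>z. T z - J a *v z) has_derivative (\<lambda>h. (J z - J a) *v h)) (at z within K \<inter> ball a r)"
        unfolding matrix_vector_mult_diff_rdistrib
        by (intro has_derivative_diff T_deriv bounded_linear_imp_has_derivative
            matrix_vector_mul_bounded_linear) (use z in auto)
      have "norm (J z - J a) \<le> m / 2"
        using r(2)[of z] z by (auto simp: dist_norm norm_minus_commute)
      then show "onorm (\<lambda>h. (J z - J a) *v h) \<le> m / 2"
        by (intro onorm_le order_trans[OF norm_matrix_vector_mult_le_norm mult_right_mono]) auto
    qed
    then have "norm ((T x - T y) - J a *v (x - y)) \<le> m / 2 * norm (x - y)"
      by (simp add: matrix_vector_mult_diff_distrib algebra_simps)
    moreover have "m * norm (x - y) \<le> norm (T x - T y) + norm ((T x - T y) - J a *v (x - y))"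
      using m(2)[of "x - y"] norm_triangle_ineq4[of "T x - T y" "(T x - T y) - J a *v (x - y)"] by
          simp
    ultimately show ?thesis
      by simp
  qed
  then show ?thesis
    using that[of "m / 2" r] m(1) r(1) by auto
qed

text \<open>If no constant worked, compactness would give convergent pairs of points with vanishing
  expansion ratio. The images of the two limits coincide, so the limits do by injectivity, and near
  the common limit the local bound is violated.\<close>

lemma T_lower_bound:
  obtains c where "c > 0" "\<And>x y. x \<in> K \<Longrightarrow> y \<in> K \<Longrightarrow> c * norm (x - y) \<le> norm (T x - T y)"
proof -
  have "\<exists>c>0. \<forall>x\<in>K. \<forall>y\<in>K. c * norm (x - y) \<le> norm (T x - T y)"
  proof (rule ccontr)
    assume neg: "\<not> ?thesis"
    have "\<exists>p. fst p \<in> K \<and> snd p \<in> K \<and> norm (T (fst p) - T (snd p)) < inverse (real (Suc n)) * norm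
        (fst p - snd p)" for n
    proof -
      have "\<exists>x\<in>K. \<exists>y\<in>K. \<not> inverse (real (Suc n)) * norm (x - y) \<le> norm (T x - T y)"
        using neg positive_imp_inverse_positive[of "real (Suc n)"] by (metis of_nat_0_less_iff
            zero_less_Suc)
      then obtain x y where "x \<in> K" "y \<in> K" "norm (T x - T y) < inverse (real (Suc n)) * norm (x -
          y)"
        by (auto simp: not_le)
      then show ?thesis
        by (intro exI[of _ "(x, y)"]) auto
    qed
    then obtain p where p: "\<And>n. fst (p n) \<in> K" "\<And>n. snd (p n) \<in> K"
      "\<And>n. norm (T (fst (p n)) - T (snd (p n))) < inverse (real (Suc n)) * norm (fst (p n) - snd (p
          n))"
      by metis
    have "seq_compact (K \<times> K)"
      using compact by (simp add: compact_Times compact_imp_seq_compact)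
    moreover have "\<forall>n. p n \<in> K \<times> K"
      using p by (auto simp: mem_Times_iff)
    ultimately obtain l s where l: "l \<in> K \<times> K" "strict_mono s" "(p \<circ> s) \<longlonglongrightarrow> l"
      unfolding seq_compact_def by metis
    define a b where "a = fst l" and "b = snd l"
    have ab: "a \<in> K" "b \<in> K"
      using l(1) by (auto simp: a_def b_def)
    define x y where "x = (\<lambda>n. fst (p (s n)))" and "y = (\<lambda>n. snd (p (s n)))"
    have lim: "x \<longlonglongrightarrow> a" "y \<longlonglongrightarrow> b"
      using tendsto_fst[OF l(3)] tendsto_snd[OF l(3)] by (simp_all add: x_def y_def a_def b_def
          o_def)
    have xy: "x n \<in> K" "y n \<in> K" for n
      using p by (auto simp: x_def y_def)
    have xyless: "norm (T (x n) - T (y n)) < inverse (real (Suc (s n))) * norm (x n - y n)" for n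
      using p(3)[of "s n"] by (simp add: x_def y_def)
    have Tlim: "(\<lambda>n. T (x n)) \<longlonglongrightarrow> T a" "(\<lambda>n. T (y n)) \<longlonglongrightarrow> T b"
      using continuous_on_tendsto_compose[OF T_cont lim(1) ab(1)] continuous_on_tendsto_compose[OF
          T_cont lim(2) ab(2)] xy
      by auto
    have inv0: "(\<lambda>n. inverse (real (Suc (s n)))) \<longlonglongrightarrow> 0"
      using LIMSEQ_subseq_LIMSEQ[OF LIMSEQ_inverse_real_of_nat l(2)] by (simp add: o_def)
    then have "(\<lambda>n. inverse (real (Suc (s n))) * norm (x n - y n)) \<longlonglongrightarrow> 0 * norm (a - b)"
      by (intro tendsto_intros lim)
    moreover have "(\<lambda>n. norm (T (x n) - T (y n))) \<longlonglongrightarrow> norm (T a - T b)"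
      by (intro tendsto_intros Tlim)
    ultimately have "norm (T a - T b) \<le> 0 * norm (a - b)"
      using xyless by (intro LIMSEQ_le[of _ _ _ "0 * norm (a - b)"]) (auto intro: less_imp_le)
    then have "a = b"
      using T_inj ab by (auto dest: inj_onD)
    obtain m r where mr: "m > 0" "r > 0"
      "\<And>x y. x \<in> K \<inter> ball a r \<Longrightarrow> y \<in> K \<inter> ball a r \<Longrightarrow> m * norm (x - y) \<le> norm (T x - T y)"
      using local_lower_bound[OF ab(1)] by blast
    have "\<forall>\<^sub>F n in sequentially. x n \<in> ball a r" "\<forall>\<^sub>F n in sequentially. y n \<in> ball a r"
      using topological_tendstoD[OF lim(1) open_ball, of a r] topological_tendstoD[OF lim(2)
          open_ball, of a r]
        mr(2) \<open>a = b\<close> by simp_all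
    moreover have "\<forall>\<^sub>F n in sequentially. inverse (real (Suc (s n))) < m"
      using inv0 mr(1) by (rule order_tendstoD(2))
    ultimately have "\<forall>\<^sub>F n in sequentially. False"
    proof eventually_elim
      case (elim n)
      have "m * norm (x n - y n) \<le> norm (T (x n) - T (y n))"
        using elim xy by (intro mr(3)) auto
      also have "\<dots> < inverse (real (Suc (s n))) * norm (x n - y n)"
        by (rule xyless)
      also have "\<dots> \<le> m * norm (x n - y n)"
        using elim by (intro mult_right_mono) auto
      finally show False
        by simp
    qed
    then show False
      by simp
  qed
  then show ?thesis
    using that by blast
qed

lemma Ti_lipschitz:
  obtains B where "B > 0" "\<And>x y. x \<in> T ` K \<Longrightarrow> y \<in> T ` K \<Longrightarrow> norm (Ti x - Ti y) \<le> B * norm (x - y)"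
proof -
  obtain c where c: "c > 0" "\<And>x y. x \<in> K \<Longrightarrow> y \<in> K \<Longrightarrow> c * norm (x - y) \<le> norm (T x - T y)"
    using T_lower_bound by blast
  have "norm (Ti x - Ti y) \<le> (1 / c) * norm (x - y)" if "x \<in> T ` K" "y \<in> T ` K" for x y
    using c(2)[of "Ti x" "Ti y"] that c(1) by (simp add: T_Ti field_simps)
  then show ?thesis
    using that[of "1 / c"] c(1) by auto
qed

lemma Ti_cont: "continuous_on (T ` K) Ti"
  using T_cont compact by (rule continuous_on_inv) simp

lemma Ti_deriv:
  assumes y: "y \<in> K"
  shows "(Ti has_derivative (\<lambda>h. matrix_inv (J y) *v h)) (at (T y) within T ` K)"
proof (rule has_derivative_inverse_within[OF T_deriv[OF y]])
  show "continuous (at (T y) within T ` K) Ti"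
    using Ti_cont y by (simp add: continuous_on_eq_continuous_within)
  show "(\<lambda>h. matrix_inv (J y) *v h) \<circ> (\<lambda>h. J y *v h) = id"
    by (simp add: fun_eq_iff matrix_inv_vector[OF J_invertible[OF y]])
qed (use y in auto)

lemma open_image_interior: "open (T ` interior K)"
  by (rule invariance_of_domain)
    (use T_cont T_inj interior_subset[of K] in \<open>auto intro: continuous_on_subset inj_on_subset\<close>)

lemma image_interior_subset: "T ` interior K \<subseteq> interior (T ` K)"
  by (intro interior_maximal image_mono interior_subset open_image_interior)

lemma Ti_deriv_interior:
  assumes y: "y \<in> interior K"
  shows "(Ti has_derivative (\<lambda>h. matrix_inv (J y) *v h)) (at (T y))"
proof -
  have "T y \<in> interior (T ` K)"
    using image_interior_subset y by blast
  then have "at (T y) within T ` K = at (T y)"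
    by (rule at_within_interior)
  moreover have "y \<in> K"
    using y interior_subset by blast
  ultimately show ?thesis
    using Ti_deriv[of y] by (simp only:)
qed

lemma frontier_image_subset: "frontier (T ` K) \<subseteq> T ` frontier K"
proof
  fix x assume "x \<in> frontier (T ` K)"
  then have "x \<in> T ` K" "x \<notin> interior (T ` K)"
    using compact_imp_closed[OF image_compact] by (simp_all add: frontier_def)
  then obtain y where "x = T y" "y \<in> K" "y \<notin> interior K"
    using image_interior_subset by blast
  then show "x \<in> T ` frontier K"
    using closed by (simp add: frontier_def)
qed

lemma negligible_image:
  assumes "negligible S" "S \<subseteq> K"
  shows "negligible (T ` S)"
proof (rule negligible_differentiable_image_negligible)
  show "T differentiable_on S"
    using T_deriv assms(2) unfolding differentiable_on_def differentiable_def by blast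
qed (use assms in auto)

lemma negligible_image_frontier: "negligible (T ` frontier K)"
  using closed by (intro negligible_image negligible_convex_frontier convex) (simp add:
      frontier_def)

lemma integral_image:
  assumes "Topological_Spaces.compact S" "S \<subseteq> K" and g: "continuous_on (T ` S) g"
  shows "integral (T ` S) g = integral S (\<lambda>y. \<bar>det (J y)\<bar> * g (T y))"
proof -
  have "Topological_Spaces.compact (T ` S)"
    by (rule compact_continuous_image[OF continuous_on_subset[OF T_cont assms(2)] assms(1)])
  then have "g absolutely_integrable_on T ` S"
    by (rule absolutely_integrable_continuous_compact[OF _ g])
  then have "integral S (\<lambda>x. \<bar>det (matrix (\<lambda>h. J x *v h))\<bar> * g (T x)) = integral (T ` S) g"
    using assms(2) T_inj
    by (intro change_of_variables_compact(2)[OF assms(1) T_deriv]) (auto intro: inj_on_subset)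
  then show ?thesis
    by simp
qed

end

section \<open>The divergence theorem on a curved element\<close>

context curved_element
begin

text \<open>As a product over the facets, it has a gradient that splits into one term per facet,
  supported in the layer of that facet. This is how the frontier integral falls apart into facet
  integrals.\<close>

definition cutoff :: "real \<Rightarrow> real^'n \<Rightarrow> real" where
  "cutoff M y = (\<Prod>f\<in>{f. f facet_of K}. clamp01 (M * gap K f y))"

definition layer :: "real \<Rightarrow> (real^'n) set \<Rightarrow> (real^'n) set" where
  "layer M f = {y \<in> K. M * gap K f y \<le> 1}"

lemma cutoff_abs_le: "\<bar>cutoff M y\<bar> \<le> 1"
  unfolding cutoff_def by (rule abs_prod_clamp01_le)

lemma continuous_gap_any: "continuous_on S (gap K f)"
  unfolding gap_def by (intro continuous_intros)

lemma cutoff_cont: "continuous_on S (cutoff M)"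
  unfolding cutoff_def by (intro continuous_intros continuous_gap_any)

lemma cutoff_frontier: "y \<in> frontier K \<Longrightarrow> cutoff M y = 0"
proof -
  assume "y \<in> frontier K"
  then obtain f where f: "f facet_of K" "y \<in> f"
    by (auto simp: frontier_eq_Union_facets)
  then have "clamp01 (M * gap K f y) = 0"
    using polytope_facet.mem_facet[OF facet_locale[OF f(1)]] by (simp add: clamp01_def)
  then show ?thesis
    unfolding cutoff_def using finite_facets f(1) by (intro prod_zero) auto
qed

lemma gap_diff_le:
  assumes "f facet_of K"
  shows "\<bar>gap K f x - gap K f y\<bar> \<le> norm (x - y)"
proof -
  have "gap K f x - gap K f y = ref_normal K f \<bullet> (y - x)"
    by (simp add: gap_def inner_diff_right)
  also have "\<bar>\<dots>\<bar> \<le> norm (ref_normal K f) * norm (y - x)"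
    by (rule Cauchy_Schwarz_ineq2)
  finally show ?thesis
    using polytope_facet.normal[OF facet_locale[OF assms]] by (simp add: norm_minus_commute)
qed

text \<open>Two products of factors bounded by 1 differ by at most the sum of the differences of the
  factors, and each gap has Lipschitz constant 1.\<close>

lemma cutoff_lipschitz:
  assumes "0 \<le> M"
  shows "\<bar>cutoff M x - cutoff M y\<bar> \<le> real (card {f. f facet_of K}) * M * norm (x - y)"
proof -
  have "\<bar>cutoff M x - cutoff M y\<bar> \<le> (\<Sum>f\<in>{f. f facet_of K}. \<bar>clamp01 (M * gap K f x) - clamp01 (M *
      gap K f y)\<bar>)"
    using norm_prod_diff[of "{f. f facet_of K}" "\<lambda>f. clamp01 (M * gap K f x)" "\<lambda>f. clamp01 (M * gap
        K f y)"]
    by (simp add: cutoff_def clamp01_range)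
  also have "\<dots> \<le> (\<Sum>f\<in>{f. f facet_of K}. M * norm (x - y))"
  proof (rule sum_mono)
    fix f assume f: "f \<in> {f. f facet_of K}"
    have "\<bar>clamp01 (M * gap K f x) - clamp01 (M * gap K f y)\<bar> \<le> \<bar>M * gap K f x - M * gap K f y\<bar>"
      by (rule clamp01_lipschitz)
    also have "\<dots> = M * \<bar>gap K f x - gap K f y\<bar>"
      using assms by (simp add: right_diff_distrib[symmetric] abs_mult)
    also have "\<dots> \<le> M * norm (x - y)"
      using assms f gap_diff_le by (intro mult_left_mono) auto
    finally show "\<bar>clamp01 (M * gap K f x) - clamp01 (M * gap K f y)\<bar> \<le> M * norm (x - y)" .
  qed
  finally show ?thesis
    by simp
qed

text \<open>In the interior all gaps are positive, so of the two kinks of the ramp only the level 1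
  can be met; it is excluded by assumption, and elsewhere the product rule applies.\<close>

lemma cutoff_deriv:
  assumes M: "M > 0" and y: "y \<in> interior K" and ne: "\<And>f. f facet_of K \<Longrightarrow> M * gap K f y \<noteq> 1"
  shows "(cutoff M has_derivative (\<lambda>v. \<Sum>f\<in>{f. f facet_of K}. (if y \<in> layer M f then - M *
      (ref_normal K f \<bullet> v) else 0)
     * (\<Prod>f'\<in>{f. f facet_of K} - {f}. clamp01 (M * gap K f' y)))) (at y)"
  unfolding cutoff_def[abs_def]
proof (rule has_derivative_prod)
  fix f assume "f \<in> {f. f facet_of K}"
  then have f: "f facet_of K"
    by simp
  have pos: "0 < gap K f y"
    using y f mem_interior_iff_gaps by blast
  have yK: "y \<in> K"
    using y interior_subset by blast
  have lin: "((\<lambda>x. M * gap K f x) has_derivative (\<lambda>v. - M * (ref_normal K f \<bullet> v))) (at y)"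
    unfolding gap_def by (auto intro!: derivative_eq_intros)
  show "((\<lambda>x. clamp01 (M * gap K f x)) has_derivative (\<lambda>v. if y \<in> layer M f then - M * (ref_normal K
      f \<bullet> v) else 0)) (at y)"
  proof (cases "M * gap K f y \<le> 1")
    case True
    then have lt: "M * gap K f y < 1"
      using ne[OF f] by simp
    have "((\<lambda>x. clamp01 (M * gap K f x)) has_derivative (\<lambda>v. - M * (ref_normal K f \<bullet> v))) (at y)"
    proof (rule has_derivative_transform_within_open[OF lin])
      show "open {x. 0 < M * gap K f x \<and> M * gap K f x < 1}"
        by (intro open_Collect_conj open_Collect_less continuous_intros continuous_gap_any)
      show "y \<in> {x. 0 < M * gap K f x \<and> M * gap K f x < 1}"
        using lt pos M by simp
    qed (simp add: clamp01_def)
    then show ?thesis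
      using True yK by (simp add: layer_def)
  next
    case False
    have "((\<lambda>x. clamp01 (M * gap K f x)) has_derivative (\<lambda>v. 0)) (at y)"
    proof (rule has_derivative_transform_within_open[OF has_derivative_const[of 1]])
      show "open {x. 1 < M * gap K f x}"
        by (intro open_Collect_less continuous_intros continuous_gap_any)
    qed (use False in \<open>auto simp: clamp01_def\<close>)
    then show ?thesis
      using False by (simp add: layer_def)
  qed
qed

lemma compact_layer: "Topological_Spaces.compact (layer M f)"
proof -
  have "layer M f = K \<inter> {x. M * gap K f x \<le> 1}"
    by (auto simp: layer_def)
  moreover have "closed {x. M * gap K f x \<le> 1}"
    by (intro closed_Collect_le continuous_intros continuous_gap_any)
  ultimately show ?thesis
    by (simp add: compact_Int_closed compact)
qed

lemma negligible_gap_level: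
  assumes "f facet_of K"
  shows "negligible {x. M * gap K f x = 1}"
proof -
  define a where "a = M *\<^sub>R ref_normal K f"
  define c where "c = M * gap K f 0 - 1"
  have "{x. M * gap K f x = 1} = {x. a \<bullet> x = c}"
    by (auto simp: a_def c_def gap_def inner_diff_right algebra_simps)
  moreover have "a \<noteq> 0 \<or> c \<noteq> 0"
    using polytope_facet.normal[OF facet_locale[OF assms]] by (auto simp: a_def c_def)
  ultimately show ?thesis
    using negligible_hyperplane by metis
qed

text \<open>The function \<open>h\<close> times the cutoff vanishes on the frontier of the element, so the derivative
  of its extension by zero has integral zero.\<close>
lemma cutoff_identity:
  assumes M: "M > 0"
    and lip: "\<And>a b. a \<in> T ` K \<Longrightarrow> b \<in> T ` K \<Longrightarrow> \<bar>h a - h b\<bar> \<le> L * norm (a - b)"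
    and der: "\<And>y. y \<in> interior K \<Longrightarrow> (h has_derivative D y) (at (T y))"
    and g: "continuous_on (T ` K) g" "\<And>y. y \<in> interior K \<Longrightarrow> g (T y) = D y e"
  shows "integral (T ` K) (\<lambda>x. g x * cutoff M (Ti x)) =
    (\<Sum>f\<in>{f. f facet_of K}. integral (layer M f) (\<lambda>y. M * (\<Prod>f'\<in>{f. f facet_of K} - {f}. clamp01 (M *
        gap K f' y))
        * (h (T y) * (\<bar>det (J y)\<bar> * (cnormal f y \<bullet> e)))))"
proof -
  define F where "F = {f. f facet_of K}"
  have F: "finite F"
    unfolding F_def by (rule finite_facets)
  define P where "P = (\<lambda>f y. \<Prod>f'\<in>F - {f}. clamp01 (M * gap K f' y))"
  define G where "G = (\<lambda>x. if x \<in> T ` K then h x * cutoff M (Ti x) else 0)"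
  define q where "q = (\<lambda>f x. h x * (M * (ref_normal K f \<bullet> (matrix_inv (J (Ti x)) *v e)) * P f (Ti
      x)))"
  \<comment> \<open>The derivative of \<open>G\<close> in direction \<open>e\<close> off
    \<open>N\<close>. The first term differentiates \<open>h\<close>, the sum differentiates the
    cutoff; its sign is negative because a gap decreases along the outward normal.\<close>
  define G' where "G' = (\<lambda>x. (if x \<in> T ` K then g x * cutoff M (Ti x) else 0)
      - (\<Sum>f\<in>F. if x \<in> T ` layer M f then q f x else 0))"
  \<comment> \<open>The points where \<open>G\<close> may fail to be differentiable: the image of
    the frontier and the images of the kinks of the ramps.\<close>
  define N where "N = T ` frontier K \<union> (\<Union>f\<in>F. T ` {y \<in> K. M * gap K f y = 1})"
  have clT: "closed (T ` K)"
    by (rule compact_imp_closed[OF image_compact])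
  have N: "negligible N"
  proof -
    have "negligible (T ` {y \<in> K. M * gap K f y = 1})" if "f \<in> F" for f
      using that negligible_gap_level by (intro negligible_image) (auto simp: F_def intro:
          negligible_subset)
    then show ?thesis
      unfolding N_def using F by (intro negligible_Un negligible_image_frontier negligible_Union
          finite_imageI) auto
  qed
  have hcont: "continuous_on (T ` K) h"
  proof -
    have "(\<bar>L\<bar> + 1)-lipschitz_on (T ` K) h"
    proof (rule lipschitz_onI)
      fix x y assume "x \<in> T ` K" "y \<in> T ` K"
      moreover have "L * norm (x - y) \<le> (\<bar>L\<bar> + 1) * norm (x - y)"
        by (intro mult_right_mono) auto
      ultimately show "dist (h x) (h y) \<le> (\<bar>L\<bar> + 1) * dist x y"
        using lip[of x y] by (simp add: dist_norm)
    qed simp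
    then show ?thesis
      by (rule lipschitz_on_continuous_on)
  qed
  obtain B where B: "\<And>x. x \<in> T ` K \<Longrightarrow> \<bar>h x\<bar> \<le> B"
    using compact_imp_bounded[OF compact_continuous_image[OF hcont image_compact]]
    by (auto simp: bounded_iff)
  obtain R where R: "\<And>x. x \<in> T ` K \<Longrightarrow> norm x \<le> R"
    using compact_imp_bounded[OF image_compact] unfolding bounded_iff by blast
  obtain B' where B': "B' > 0" "\<And>x y. x \<in> T ` K \<Longrightarrow> y \<in> T ` K \<Longrightarrow> norm (Ti x - Ti y) \<le> B' * norm (x -
      y)"
    using Ti_lipschitz by blast
  define c where "c = real (card F) * M"
  have c0: "c \<ge> 0"
    using M by (simp add: c_def)
  define L' where "L' = L + B * (c * B')"
  have B0: "B \<ge> 0"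
    using B nonempty by (meson abs_ge_zero all_not_in_conv imageI order_trans)
  have lipG1: "\<bar>G a - G b\<bar> \<le> L' * norm (a - b)" if ab: "a \<in> T ` K" "b \<in> T ` K" for a b
  proof -
    have "\<bar>cutoff M (Ti a) - cutoff M (Ti b)\<bar> \<le> c * norm (Ti a - Ti b)"
      using cutoff_lipschitz[of M] M by (simp add: c_def F_def)
    also have "\<dots> \<le> c * (B' * norm (a - b))"
      using B'(2)[OF ab] c0 by (rule mult_left_mono)
    finally have 1: "\<bar>cutoff M (Ti a) - cutoff M (Ti b)\<bar> \<le> c * (B' * norm (a - b))" .
    have "G a - G b = (h a - h b) * cutoff M (Ti a) + h b * (cutoff M (Ti a) - cutoff M (Ti b))"
      using ab by (simp add: G_def algebra_simps)
    then have "\<bar>G a - G b\<bar> \<le> \<bar>h a - h b\<bar> * \<bar>cutoff M (Ti a)\<bar> + \<bar>h b\<bar> * \<bar>cutoff M (Ti a) - cutoff M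
        (Ti b)\<bar>"
      by (metis abs_mult abs_triangle_ineq)
    also have "\<dots> \<le> (L * norm (a - b)) * 1 + B * (c * (B' * norm (a - b)))"
      using lip[OF ab] cutoff_abs_le[of M "Ti a"] B[OF ab(2)] 1 B0 order_trans[OF abs_ge_zero lip[OF
          ab]]
      by (intro add_mono mult_mono) auto
    finally show ?thesis
      by (simp add: L'_def algebra_simps)
  qed
  define L2 where "L2 = \<bar>L'\<bar>"
  have lipG2: "\<bar>G a - G b\<bar> \<le> L2 * norm (a - b)" if "a \<in> T ` K" "b \<in> T ` K" for a b
    unfolding L2_def using lipG1[OF that] by (meson abs_ge_self mult_right_mono norm_ge_zero
        order_trans)
  \<comment> \<open>A segment that leaves the element meets its frontier, where \<open>G\<close>
    vanishes. The part inside is no longer than the whole segment, so the same constant works across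
    the frontier.\<close>
  have cross: "\<bar>G a - G b\<bar> \<le> L2 * norm (a - b)" if a: "a \<in> T ` K" and b: "b \<notin> T ` K" for a b
  proof -
    have "closed_segment a b \<inter> frontier (T ` K) \<noteq> {}"
      using a b by (intro connected_Int_frontier) auto
    then obtain p where p: "p \<in> closed_segment a b" "p \<in> frontier (T ` K)"
      by blast
    then obtain y where y: "p = T y" "y \<in> frontier K"
      using frontier_image_subset by blast
    have yK: "y \<in> K"
      using y(2) closed by (simp add: frontier_def)
    have Gp: "G p = 0"
      using y yK by (simp add: G_def cutoff_frontier)
    have "\<bar>G a - G b\<bar> = \<bar>G a - G p\<bar>"
      using b Gp by (simp add: G_def)
    also have "\<dots> \<le> L2 * norm (a - p)"
      using y(1) yK by (intro lipG2 a) auto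
    also have "\<dots> \<le> L2 * norm (a - b)"
      using segment_bound(1)[OF p(1)] by (intro mult_left_mono) (auto simp: norm_minus_commute
          L2_def)
    finally show ?thesis .
  qed
  have lipG: "\<bar>G a - G b\<bar> \<le> L2 * norm (a - b)" for a b
  proof (cases "a \<in> T ` K"; cases "b \<in> T ` K")
    assume "a \<notin> T ` K" "b \<in> T ` K"
    then show ?thesis
      using cross[of b a] by (simp add: abs_minus_commute norm_minus_commute)
  next
    assume "a \<notin> T ` K" "b \<notin> T ` K"
    then show ?thesis
      by (simp add: G_def L2_def)
  qed (simp_all add: lipG2 cross)
  have derG: "((\<lambda>t. G (x + t *\<^sub>R e)) has_real_derivative G' x) (at 0)" if x: "x \<notin> N" for x
  proof (cases "x \<in> T ` K")
    case False
    have "(G has_derivative (\<lambda>_. 0)) (at x)"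
    proof (rule has_derivative_transform_within_open[OF has_derivative_const[of 0]])
      show "open (- T ` K)"
        using clT by (simp add: open_Compl)
    qed (use False in \<open>auto simp: G_def\<close>)
    moreover have "x \<notin> T ` layer M f" for f
      using False by (auto simp: layer_def)
    ultimately show ?thesis
      using directional_derivative[of G "\<lambda>_. 0" x e] False by (simp add: G'_def)
  next
    case True
    then obtain y where y: "x = T y" "y \<in> K"
      by blast
    have yi: "y \<in> interior K"
      using x y closed by (auto simp: N_def frontier_def)
    have ne: "M * gap K f y \<noteq> 1" if "f facet_of K" for f
      using x y that by (auto simp: N_def F_def)
    let ?D = "\<lambda>v. \<Sum>f\<in>{f. f facet_of K}. (if y \<in> layer M f then - M * (ref_normal K f \<bullet> v) else 0)
     * (\<Prod>f'\<in>{f. f facet_of K} - {f}. clamp01 (M * gap K f' y))"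
    have "(cutoff M has_derivative ?D) (at (Ti (T y)))"
      using cutoff_deriv[OF M yi ne] y by simp
    from has_derivative_compose[OF Ti_deriv_interior[OF yi] this]
    have 1: "((\<lambda>x. cutoff M (Ti x)) has_derivative (\<lambda>v. ?D (matrix_inv (J y) *v v))) (at (T y))" .
    have "((\<lambda>x. h x * cutoff M (Ti x)) has_derivative
       (\<lambda>v. h (T y) * ?D (matrix_inv (J y) *v v) + D y v * cutoff M (Ti (T y)))) (at (T y))"
      by (rule has_derivative_mult[OF der[OF yi] 1])
    then have "(G has_derivative
       (\<lambda>v. h (T y) * ?D (matrix_inv (J y) *v v) + D y v * cutoff M (Ti (T y)))) (at (T y))"
    proof (rule has_derivative_transform_within_open[OF _ open_image_interior])
      show "T y \<in> T ` interior K"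
        using yi by blast
      show "h x * cutoff M (Ti x) = G x" if "x \<in> T ` interior K" for x
        using that interior_subset[of K] by (auto simp: G_def)
    qed
    note d = directional_derivative[OF this, of e]
    have mem: "T y \<in> T ` layer M f \<longleftrightarrow> y \<in> layer M f" for f
      using inj_on_image_mem_iff[OF T_inj y(2), of "layer M f"] by (auto simp: layer_def)
    have "h (T y) * ?D (matrix_inv (J y) *v e) = - (\<Sum>f\<in>F. if y \<in> layer M f then q f (T y) else 0)"
      unfolding F_def[symmetric] sum_distrib_left sum_negf[symmetric] q_def P_def
      using y(2) by (intro sum.cong) (auto simp: mult_ac)
    then have "h (T y) * ?D (matrix_inv (J y) *v e) + D y e * cutoff M (Ti (T y)) = G' x"
      using True g(2)[OF yi] by (simp add: G'_def y(1) mem)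
    then show ?thesis
      using d y(1) by simp
  qed
  have "integral UNIV G' = 0"
  proof (rule integral_directional_derivative_zero[OF lipG _ N derG])
    show "G x = 0" if "x \<notin> cball 0 R" for x
      using that R[of x] by (auto simp: G_def)
  qed
  moreover have contP: "continuous_on S (P f)" for S f
    unfolding P_def by (intro continuous_intros continuous_gap_any)
  have contg: "continuous_on (T ` K) (\<lambda>x. g x * cutoff M (Ti x))"
    by (intro continuous_intros g(1) continuous_on_compose2[OF cutoff_cont[of UNIV] Ti_cont]) auto
  have contq: "continuous_on (T ` layer M f) (q f)" for f
  proof -
    have TiK: "Ti ` T ` K \<subseteq> K"
      by auto
    have "continuous_on (T ` K) (q f)"
      unfolding q_def
      by (intro continuous_intros hcont continuous_on_compose2[OF J_inv_cont Ti_cont TiK]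
          continuous_on_compose2[OF contP[of UNIV] Ti_cont]) auto
    then show ?thesis
      by (rule continuous_on_subset) (auto simp: layer_def)
  qed
  have layK: "layer M f \<subseteq> K" for f
    by (auto simp: layer_def)
  have cTl: "Topological_Spaces.compact (T ` layer M f)" for f
    by (rule compact_continuous_image[OF continuous_on_subset[OF T_cont layK] compact_layer])
  have i1: "(\<lambda>x. if x \<in> T ` K then g x * cutoff M (Ti x) else 0) integrable_on UNIV"
    unfolding integrable_restrict_UNIV
    using absolutely_integrable_continuous_compact[OF image_compact contg] by (simp add:
        absolutely_integrable_on_def)
  have i2: "(\<lambda>x. if x \<in> T ` layer M f then q f x else 0) integrable_on UNIV" for f
    unfolding integrable_restrict_UNIV
    using absolutely_integrable_continuous_compact[OF cTl contq] by (simp add: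
        absolutely_integrable_on_def)
  have "integral UNIV G' = integral (T ` K) (\<lambda>x. g x * cutoff M (Ti x)) - (\<Sum>f\<in>F. integral (T ` layer
      M f) (q f))"
    unfolding G'_def
    by (simp add: Henstock_Kurzweil_Integration.integral_diff[OF i1 integrable_sum[OF F i2]]
        integral_sum[OF F i2]
        Henstock_Kurzweil_Integration.integral_restrict_UNIV)
  \<comment> \<open>Pulled back to the reference element, the inverse Jacobian is moved from
    \<open>e\<close> onto the reference normal, which yields the conormal.\<close>
  moreover have "integral (T ` layer M f) (q f) = integral (layer M f)
     (\<lambda>y. M * P f y * (h (T y) * (\<bar>det (J y)\<bar> * (cnormal f y \<bullet> e))))" for f
    unfolding integral_image[OF compact_layer layK contq]
    using layK by (intro integral_cong) (auto simp: q_def cnormal_inner subset_iff)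
  ultimately show ?thesis
    by (simp add: F_def P_def)
qed

text \<open>The slope of the ramps in \<open>cutoff_identity\<close> tends to infinity. The cutoff
  tends to one off the null frontier, so the volume side converges by dominated convergence, and
  each layer integral converges to a facet integral by \<open>layer_limit\<close>. Differentiability
  of \<open>h\<close> is required only in the interior, together with a continuous extension
  \<open>g\<close> of its directional derivative.\<close>

theorem divergence_theorem:
  assumes lip: "\<And>a b. a \<in> T ` K \<Longrightarrow> b \<in> T ` K \<Longrightarrow> \<bar>h a - h b\<bar> \<le> L * norm (a - b)"
    and der: "\<And>y. y \<in> interior K \<Longrightarrow> (h has_derivative D y) (at (T y))"
    and g: "continuous_on (T ` K) g" "\<And>y. y \<in> interior K \<Longrightarrow> g (T y) = D y e"
    and hT: "continuous_on K (\<lambda>y. h (T y))"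
  shows "integral (T ` K) g = (\<Sum>f\<in>{f. f facet_of K}.
    facet_integral f (ref_normal K f) (\<lambda>y. h (T y) * (\<bar>det (J y)\<bar> * (cnormal f y \<bullet> e))))"
proof -
  define \<Phi> where "\<Phi> = (\<lambda>f y. h (T y) * (\<bar>det (J y)\<bar> * (cnormal f y \<bullet> e)))"
  have cont: "continuous_on K (\<Phi> f)" for f
    unfolding \<Phi>_def by (intro continuous_intros hT det_J_cont cnormal_cont)
  have "(\<lambda>m. \<Sum>f\<in>{f. f facet_of K}. integral (layer (real (Suc m)) f)
       (\<lambda>y. real (Suc m) * (\<Prod>f'\<in>{f. f facet_of K} - {f}. clamp01 (real (Suc m) * gap K f' y)) * \<Phi> f
           y))
     \<longlonglongrightarrow> (\<Sum>f\<in>{f. f facet_of K}. facet_integral f (ref_normal K f) (\<Phi> f))"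
  proof (rule tendsto_sum)
    fix f assume "f \<in> {f. f facet_of K}"
    then interpret polytope_facet K f
      by (intro facet_locale) simp
    show "(\<lambda>m. integral (layer (real (Suc m)) f)
       (\<lambda>y. real (Suc m) * (\<Prod>f'\<in>{f. f facet_of K} - {f}. clamp01 (real (Suc m) * gap K f' y)) * \<Phi> f
           y))
     \<longlonglongrightarrow> facet_integral f (ref_normal K f) (\<Phi> f)"
      using layer_limit[OF cont] unfolding layer_def other_facets_def .
  qed
  moreover have "(\<Sum>f\<in>{f. f facet_of K}. integral (layer (real (Suc m)) f)
       (\<lambda>y. real (Suc m) * (\<Prod>f'\<in>{f. f facet_of K} - {f}. clamp01 (real (Suc m) * gap K f' y)) * \<Phi> f
           y))
     = integral (T ` K) (\<lambda>x. g x * cutoff (real (Suc m)) (Ti x))" for m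
    unfolding \<Phi>_def by (rule cutoff_identity[OF _ lip der g, symmetric]) simp_all
  ultimately have lim1: "(\<lambda>m. integral (T ` K) (\<lambda>x. g x * cutoff (real (Suc m)) (Ti x)))
     \<longlonglongrightarrow> (\<Sum>f\<in>{f. f facet_of K}. facet_integral f (ref_normal K f) (\<Phi> f))"
    by simp
  define N where "N = T ` frontier K"
  obtain B where B: "\<And>x. x \<in> T ` K \<Longrightarrow> \<bar>g x\<bar> \<le> B"
    using compact_imp_bounded[OF compact_continuous_image[OF g(1) image_compact]]
    by (auto simp: bounded_iff)
  have "(\<lambda>m. integral (T ` K) (\<lambda>x. if x \<in> N then 0 else g x * cutoff (real (Suc m)) (Ti x)))
     \<longlonglongrightarrow> integral (T ` K) (\<lambda>x. if x \<in> N then 0 else g x)"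
  proof (rule dominated_convergence(2))
    show "(\<lambda>x. if x \<in> N then 0 else g x * cutoff (real (Suc k)) (Ti x)) integrable_on T ` K" for k
    proof (rule integrable_spike)
      have "continuous_on (T ` K) (\<lambda>x. g x * cutoff (real (Suc k)) (Ti x))"
        by (intro continuous_intros g(1) continuous_on_compose2[OF cutoff_cont[of UNIV] Ti_cont])
            auto
      then show "(\<lambda>x. g x * cutoff (real (Suc k)) (Ti x)) integrable_on T ` K"
        using absolutely_integrable_continuous_compact[OF image_compact] by (simp add:
            absolutely_integrable_on_def)
      show "negligible N"
        unfolding N_def by (rule negligible_image_frontier)
    qed auto
    show "(\<lambda>x. B) integrable_on T ` K"
      by (intro integrable_on_const lmeasurable_compact image_compact)
    show "norm (if x \<in> N then 0 else g x * cutoff (real (Suc k)) (Ti x)) \<le> B" if "x \<in> T ` K" for k x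
    proof -
      have "\<bar>g x * cutoff (real (Suc k)) (Ti x)\<bar> \<le> B * 1"
        unfolding abs_mult using B[OF that] cutoff_abs_le by (intro mult_mono) auto
      then show ?thesis
        using abs_ge_zero[of "g x"] B[OF that] by (auto simp del: of_nat_Suc)
    qed
    show "(\<lambda>k. if x \<in> N then 0 else g x * cutoff (real (Suc k)) (Ti x)) \<longlonglongrightarrow> (if x \<in> N then 0 else g
        x)"
      if x: "x \<in> T ` K" for x
    proof (cases "x \<in> N")
      case False
      then obtain y where y: "x = T y" "y \<in> interior K"
        using x closed by (auto simp: N_def frontier_def)
      then have yK: "y \<in> K"
        using interior_subset by blast
      \<comment> \<open>At an interior point the finitely many gaps are positive, so from some slope
        on every clamp equals 1 and the cutoff is constant in k.\<close>
      have "\<forall>\<^sub>F k in sequentially. \<forall>f\<in>{f. f facet_of K}. 1 \<le> real (Suc k) * gap K f y"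
      proof (intro eventually_ball_finite finite_facets ballI)
        fix f assume "f \<in> {f. f facet_of K}"
        then have "0 < gap K f y"
          using y(2) mem_interior_iff_gaps by blast
        moreover have "filterlim (\<lambda>k. real (Suc k)) at_top sequentially"
          by (rule filterlim_compose[OF filterlim_real_sequentially filterlim_Suc])
        ultimately have "filterlim (\<lambda>k. gap K f y * real (Suc k)) at_top sequentially"
          by (intro filterlim_tendsto_pos_mult_at_top[OF tendsto_const])
        then have "\<forall>\<^sub>F k in sequentially. 1 \<le> gap K f y * real (Suc k)"
          unfolding filterlim_at_top by blast
        then show "\<forall>\<^sub>F k in sequentially. 1 \<le> real (Suc k) * gap K f y"
          by (simp only: mult.commute)
      qed
      then have "\<forall>\<^sub>F k in sequentially. (if x \<in> N then 0 else g x * cutoff (real (Suc k)) (Ti x)) =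
          g x"
      proof eventually_elim
        case (elim k)
        then have "cutoff (real (Suc k)) y = 1"
          unfolding cutoff_def by (intro prod.neutral ballI clamp01_eq_1) auto
        then show ?case
          using False y yK by (simp del: of_nat_Suc)
      qed
      then show ?thesis
        using False by (simp add: tendsto_eventually del: of_nat_Suc)
    qed simp
  qed
  moreover have "integral (T ` K) (\<lambda>x. if x \<in> N then 0 else g x * cutoff (real (Suc m)) (Ti x))
      = integral (T ` K) (\<lambda>x. g x * cutoff (real (Suc m)) (Ti x))" for m
    by (rule integral_spike[OF negligible_image_frontier]) (auto simp: N_def)
  moreover have "integral (T ` K) (\<lambda>x. if x \<in> N then 0 else g x) = integral (T ` K) g"
    by (rule integral_spike[OF negligible_image_frontier]) (auto simp: N_def)
  ultimately have lim2: "(\<lambda>m. integral (T ` K) (\<lambda>x. g x * cutoff (real (Suc m)) (Ti x)))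
     \<longlonglongrightarrow> integral (T ` K) g"
    by simp
  show ?thesis
    using LIMSEQ_unique[OF lim2 lim1] by (simp add: \<Phi>_def)
qed

end

section \<open>Sides shared by two elements\<close>

context curved_element
begin

text \<open>A quantitative open mapping argument. If some \<open>q\<close> were missed, the segment
  from \<open>T p\<close> to \<open>q\<close> would leave the open image of the ball through the
  image of its sphere, whose points have distance at least c s from \<open>T p\<close>.\<close>

lemma ball_subset_image:
  assumes c: "c > 0" "\<And>x y. x \<in> K \<Longrightarrow> y \<in> K \<Longrightarrow> c * norm (x - y) \<le> norm (T x - T y)"
    and s: "s > 0" "cball p s \<subseteq> interior K"
  shows "ball (T p) (c * s) \<subseteq> T ` interior K"
proof
  fix q assume q: "q \<in> ball (T p) (c * s)"
  have sK: "cball p s \<subseteq> K"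
    using s(2) interior_subset by blast
  have sub: "ball p s \<subseteq> K"
    using sK ball_subset_cball by blast
  have op: "open (T ` ball p s)"
    by (rule invariance_of_domain)
      (auto intro: continuous_on_subset[OF T_cont sub] inj_on_subset[OF T_inj sub])
  have "q \<in> T ` ball p s"
  proof (rule ccontr)
    assume nq: "q \<notin> T ` ball p s"
    have "T p \<in> T ` ball p s"
      using s(1) by simp
    then have "closed_segment (T p) q \<inter> frontier (T ` ball p s) \<noteq> {}"
      using nq by (intro connected_Int_frontier) auto
    then obtain w where w: "w \<in> closed_segment (T p) q" "w \<in> frontier (T ` ball p s)"
      by blast
    have "compact (T ` cball p s)"
      by (rule compact_continuous_image[OF continuous_on_subset[OF T_cont sK] compact_cball])
    then have "closure (T ` ball p s) \<subseteq> T ` cball p s"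
      by (intro closure_minimal compact_imp_closed) auto
    moreover have "w \<in> closure (T ` ball p s)" "w \<notin> T ` ball p s"
      using w(2) op by (auto simp: frontier_def interior_open)
    ultimately obtain u where u: "w = T u" "u \<in> cball p s" "u \<notin> ball p s"
      by blast
    have p: "p \<in> K"
      using sK s(1) by auto
    have "norm (u - p) = s"
      using u(2,3) by (auto simp: dist_norm norm_minus_commute)
    then have "c * s \<le> norm (w - T p)"
      using c(2)[OF subsetD[OF sK u(2)] p] u(1) by simp
    also have "\<dots> \<le> norm (q - T p)"
      using segment_bound(1)[OF w(1)] .
    also have "\<dots> < c * s"
      using q by (simp add: dist_norm norm_minus_commute)
    finally show False
      by simp
  qed
  then show "q \<in> T ` interior K"
    using s(2) ball_subset_cball by blast
qed

end

locale shared_side =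
  E: curved_element K T + E': curved_element K T' + A: polytope_facet K f + A': polytope_facet K f'
  for K :: "(real^'n) set" and T T' f f' +
  assumes side: "T ` f = T' ` f'"
    and disjoint: "interior (T ` K) \<inter> interior (T' ` K) = {}"
begin

abbreviation n :: "real^'n" where "n \<equiv> ref_normal K f"
abbreviation n' :: "real^'n" where "n' \<equiv> ref_normal K f'"

definition transition :: "real^'n \<Rightarrow> real^'n" where
  "transition y = E'.Ti (T y)"

text \<open>Along the facet this is the derivative of \<open>transition\<close>. As a product of
  full Jacobians it also acts on the normal direction, which the comparison of conormals and
  determinants requires.\<close>

definition B :: "real^'n \<Rightarrow> real^'n^'n" where
  "B y = matrix_inv (E'.J (transition y)) ** E.J y"

text \<open>On the facet, the factor by which \<open>B\<close> scales normal components, and at the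
  same time the factor between the two conormals.\<close>

definition ratio :: "real^'n \<Rightarrow> real" where
  "ratio y = n' \<bullet> (B y *v n)"

lemma in_K: "y \<in> f \<Longrightarrow> y \<in> K" and in_K': "y \<in> f' \<Longrightarrow> y \<in> K"
  using A.facet_subset A'.facet_subset by blast+

lemma transition:
  assumes "y \<in> f"
  shows "transition y \<in> f'" "T' (transition y) = T y"
proof -
  have "T y \<in> T' ` f'"
    using assms side by blast
  then obtain z where z: "z \<in> f'" "T y = T' z"
    by blast
  then have "transition y = z"
    using in_K' by (simp add: transition_def)
  then show "transition y \<in> f'" "T' (transition y) = T y"
    using z by simp_all
qed

lemma transition_image: "transition ` f = f'"
proof
  show "transition ` f \<subseteq> f'"
    using transition(1) by blast
  show "f' \<subseteq> transition ` f"
  proof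
    fix z assume z: "z \<in> f'"
    then obtain y where y: "y \<in> f" "T y = T' z"
      using side by (metis imageE imageI)
    then have "transition y = z"
      using z in_K' by (simp add: transition_def)
    then show "z \<in> transition ` f"
      using y by blast
  qed
qed

lemma transition_inj: "inj_on transition f"
proof (rule inj_onI)
  fix x y assume "x \<in> f" "y \<in> f" "transition x = transition y"
  then have "T x = T y"
    using transition(2) by metis
  then show "x = y"
    using E.T_inj in_K \<open>x \<in> f\<close> \<open>y \<in> f\<close> by (meson inj_onD)
qed

lemma transition_deriv:
  assumes y: "y \<in> f"
  shows "(transition has_derivative (\<lambda>h. B y *v h)) (at y within f)"
proof -
  have "(E'.Ti has_derivative (\<lambda>h. matrix_inv (E'.J (transition y)) *v h)) (at (T y) within T' ` K)"
    using E'.Ti_deriv[of "transition y"] transition[OF y] in_K' by simp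
  moreover have "T ` f \<subseteq> T' ` K"
    using side in_K' by blast
  ultimately have "(E'.Ti has_derivative (\<lambda>h. matrix_inv (E'.J (transition y)) *v h)) (at (T y)
      within T ` f)"
    by (rule has_derivative_subset)
  from has_derivative_in_compose[OF E.T_deriv[OF in_K[OF y]] this]
  show ?thesis
    by (simp add: transition_def[abs_def] B_def matrix_vector_mul_assoc)
qed

lemma J_B: "y \<in> f \<Longrightarrow> E'.J (transition y) *v (B y *v h) = E.J y *v h"
  using matrix_inv_vector[OF E'.J_invertible] transition in_K'
  by (simp add: B_def matrix_vector_mul_assoc[symmetric])

lemma det_B: "y \<in> f \<Longrightarrow> det (E'.J (transition y)) * det (B y) = det (E.J y)"
proof -
  assume y: "y \<in> f"
  have "E'.J (transition y) ** B y = E.J y"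
    by (simp add: matrix_eq matrix_vector_mul_assoc[symmetric] J_B[OF y])
  then show ?thesis
    by (metis det_mul)
qed

text \<open>\<open>transition\<close> carries segments of \<open>f\<close> into the hyperplane of
  f', so the normal component of its derivative along z - y is zero for z in \<open>f\<close>. These
  differences span the direction of the hyperplane, because the affine hull of a facet is the whole
  hyperplane.\<close>

lemma B_tangent:
  assumes y: "y \<in> f" and v: "n \<bullet> v = 0"
  shows "n' \<bullet> (B y *v v) = 0"
proof -
  have 1: "n' \<bullet> (B y *v (z - y)) = 0" if z: "z \<in> f" for z
  proof -
    define c where "c = (\<lambda>t::real. y + t *\<^sub>R (z - y))"
    have cf: "c ` cbox 0 1 \<subseteq> f"
    proof
      fix x assume "x \<in> c ` cbox 0 1"
      then obtain t where t: "0 \<le> t" "t \<le> 1" "x = y + t *\<^sub>R (z - y)"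
        by (auto simp: c_def)
      then have "x = (1 - t) *\<^sub>R y + t *\<^sub>R z"
        by (simp add: algebra_simps)
      then show "x \<in> f"
        using t y z A.facet_convex by (simp add: convexD_alt)
    qed
    have "(c has_derivative (\<lambda>t. t *\<^sub>R (z - y))) (at 0 within cbox 0 1)"
      unfolding c_def by (auto intro!: derivative_eq_intros)
    moreover have "(transition has_derivative (\<lambda>h. B y *v h)) (at (c 0) within c ` cbox 0 1)"
      using has_derivative_subset[OF transition_deriv[OF y] cf] by (simp add: c_def)
    ultimately have "((\<lambda>t. transition (c t)) has_derivative (\<lambda>t. B y *v (t *\<^sub>R (z - y)))) (at 0
        within cbox 0 1)"
      by (rule has_derivative_in_compose)
    then have "((\<lambda>t. n' \<bullet> transition (c t)) has_derivative (\<lambda>t. n' \<bullet> (B y *v (t *\<^sub>R (z - y))))) (at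
        0 within cbox 0 1)"
      by (rule has_derivative_inner_right)
    then have 1: "((\<lambda>t. n' \<bullet> transition (c t)) has_vector_derivative (n' \<bullet> (B y *v (z - y)))) (at 0
        within cbox 0 1)"
      by (simp add: has_vector_derivative_def matrix_vector_mult_scaleR)
    have const: "n' \<bullet> transition (c t) = n' \<bullet> transition y" if "t \<in> cbox 0 1" for t
    proof -
      have "transition (c t) \<in> f'" "transition y \<in> f'"
        using cf that transition(1) y by blast+
      then have "gap K f' (transition (c t)) = gap K f' (transition y)"
        by (simp add: A'.mem_facet)
      then show ?thesis
        by (simp add: gap_def inner_diff_right)
    qed
    have "((\<lambda>t. n' \<bullet> transition (c t)) has_vector_derivative 0) (at 0 within cbox 0 1)"
      by (rule has_vector_derivative_transform[OF _ const has_vector_derivative_const]) simp_all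
    then show ?thesis
      using vector_derivative_unique_within_closed_interval[OF _ _ 1] by auto
  qed
  have lin: "linear (\<lambda>v. n' \<bullet> (B y *v v))"
    by (intro linearI) (simp_all add: matrix_vector_right_distrib inner_add_right
        matrix_vector_mult_scaleR)
  have "gap K f (y + v) = 0"
    using y v by (simp add: A.gap_add A.mem_facet)
  then have "y + v \<in> affine hull f"
    by (simp add: A.hyperplane)
  then obtain u where u: "y + v = y + u" "u \<in> span ((\<lambda>x. - y + x) ` (f - {y}))"
    unfolding affine_hull_span2[OF y] by blast
  moreover have "(\<lambda>x. - y + x) ` (f - {y}) \<subseteq> (\<lambda>x. - y + x) ` f"
    by blast
  ultimately have "v \<in> span ((\<lambda>x. - y + x) ` f)"
    using span_mono by (metis add_left_cancel subsetD)
  moreover have "n' \<bullet> (B y *v x) = 0" if "x \<in> (\<lambda>x. - y + x) ` f" for x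
    using that 1 by auto
  ultimately show ?thesis
    using linear_eq_0_on_span[OF lin] by blast
qed

lemma B_normal:
  assumes y: "y \<in> f"
  shows "n' \<bullet> (B y *v v) = ratio y * (n \<bullet> v)"
proof -
  have "n' \<bullet> (B y *v (v - (n \<bullet> v) *\<^sub>R n)) = 0"
    by (rule B_tangent[OF y]) (simp add: inner_diff_right)
  then show ?thesis
    by (simp add: ratio_def matrix_vector_mult_diff_distrib inner_diff_right
        matrix_vector_mult_scaleR)
qed

text \<open>With e = J h, the pairing of a conormal with e is the normal component of the reference
  direction h. Passing to the other reference element replaces h by B h, whose normal component is
  scaled by \<open>ratio\<close>.\<close>

lemma cnormal_ratio:
  assumes y: "y \<in> f"
  shows "E'.cnormal f' (transition y) \<bullet> e = ratio y * (E.cnormal f y \<bullet> e)"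
proof -
  define h where "h = matrix_inv (E.J y) *v e"
  have e: "E.J y *v h = e"
    unfolding h_def by (rule matrix_inv_vector[OF E.J_invertible[OF in_K[OF y]]])
  have "E'.cnormal f' (transition y) \<bullet> e = n' \<bullet> (matrix_inv (E'.J (transition y)) *v e)"
    using E'.cnormal_inner transition(1)[OF y] in_K' by blast
  also have "\<dots> = n' \<bullet> (B y *v h)"
    by (simp add: B_def e matrix_vector_mul_assoc[symmetric])
  also have "\<dots> = ratio y * (E.cnormal f y \<bullet> e)"
    using E.cnormal_inner[OF in_K[OF y]] by (simp add: B_normal[OF y] h_def)
  finally show ?thesis .
qed

text \<open>Otherwise n' would be orthogonal to the range of the invertible matrix
  \<open>B y\<close>.\<close>

lemma ratio_nonzero: "y \<in> f \<Longrightarrow> ratio y \<noteq> 0"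
proof
  assume y: "y \<in> f" and 0: "ratio y = 0"
  have "det (B y) \<noteq> 0"
    using det_B[OF y] E.J_invertible[OF in_K[OF y]] by (auto simp: invertible_det_nz)
  then have "invertible (B y)"
    by (simp add: invertible_det_nz)
  then have "n' \<bullet> n' = n' \<bullet> (B y *v (matrix_inv (B y) *v n'))"
    by (simp add: matrix_inv_vector)
  also have "\<dots> = 0"
    by (simp only: B_normal[OF y] 0 mult_zero_left)
  finally show False
    by simp
qed

text \<open>If the two conormals pointed to the same side, a curve leaving the common side into the second
  element would also run into the first one.\<close>
lemma ratio_neg:
  assumes y: "y \<in> A.facet_interior"
  shows "ratio y < 0"
proof (rule ccontr)
  assume "\<not> ratio y < 0"
  have yf: "y \<in> f"
    using y by (simp add: A.facet_interior_def)
  with \<open>\<not> ratio y < 0\<close> have pos: "ratio y > 0"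
    using ratio_nonzero by fastforce
  define y' where "y' = transition y"
  have y': "y' \<in> f'" "T' y' = T y"
    unfolding y'_def by (rule transition[OF yf])+
  obtain k where k: "k \<in> interior K"
    using E.interior by blast
  define v where "v = k - y'"
  \<comment> \<open>\<open>v\<close> points from y' into the interior of the second reference
    element, and \<open>d\<close> is the direction that gives T (y + t d) the same initial velocity
    as T' (y' + t v). A positive \<open>ratio\<close> makes \<open>d\<close> point inward as
    well.\<close>
  define d where "d = matrix_inv (E.J y) *v (E'.J y' *v v)"
  have Jd: "E.J y *v d = E'.J y' *v v"
    unfolding d_def by (rule matrix_inv_vector[OF E.J_invertible[OF in_K[OF yf]]])
  have Bd: "B y *v d = v"
  proof -
    have "B y *v d = matrix_inv (E'.J y') *v (E'.J y' *v v)"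
      by (simp add: B_def y'_def[symmetric] matrix_vector_mul_assoc[symmetric] Jd)
    then show ?thesis
      using matrix_inv_vector(2)[OF E'.J_invertible[OF in_K'[OF y'(1)]]] by simp
  qed
  have "0 < gap K f' k"
    using k A'.facet E.mem_interior_iff_gaps by blast
  moreover have "gap K f' (y' + v) = - (n' \<bullet> v)"
    using y'(1) by (simp only: A'.gap_add) (simp add: A'.mem_facet)
  ultimately have "n' \<bullet> v < 0"
    by (simp add: v_def)
  then have "ratio y * (n \<bullet> d) < 0"
    using B_normal[OF yf, of d] by (simp add: Bd)
  then have nd: "n \<bullet> d < 0"
    using pos by (simp add: mult_less_0_iff)
  \<comment> \<open>Along y + t d the gap to \<open>f\<close> equals 2 \<rho> t, so a ball of radius
    \<rho> t around that point keeps a positive gap.\<close>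
  define \<rho> where "\<rho> = - (n \<bullet> d) / 2"
  have \<rho>: "\<rho> > 0"
    using nd by (simp add: \<rho>_def)
  let ?U = "\<Inter>g\<in>{g. g facet_of K} - {f}. {x. 0 < gap K g x}"
  have "open ?U"
    using E.finite_facets unfolding gap_def
    by (intro open_INT ballI open_Collect_less continuous_intros) auto
  moreover have "y \<in> ?U"
    using y by (auto simp: A.facet_interior_def)
  ultimately obtain s where s: "s > 0" "ball y s \<subseteq> ?U"
    using open_contains_ball by metis
  obtain c where c: "c > 0" "\<And>x y. x \<in> K \<Longrightarrow> y \<in> K \<Longrightarrow> c * norm (x - y) \<le> norm (T x - T y)"
    using E.T_lower_bound by blast
  \<comment> \<open>The distance between the two curves in physical space is o(t), whereas by the
    lower bound for T the image of the ball contains a ball of radius c \<rho> t.\<close>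
  define r where "r = (\<lambda>t::real. T (y + t *\<^sub>R d) - T' (y' + t *\<^sub>R v))"
  have "(r has_derivative (\<lambda>t. E.J y *v (t *\<^sub>R d) - E'.J y' *v (t *\<^sub>R v))) (at 0)"
    unfolding r_def
  proof (rule has_derivative_diff)
    have "((\<lambda>t::real. y + t *\<^sub>R d) has_derivative (\<lambda>t. t *\<^sub>R d)) (at 0)"
      by (auto intro!: derivative_eq_intros)
    moreover have "(T has_derivative (\<lambda>h. E.J y *v h)) (at (y + 0 *\<^sub>R d))"
      using E.T_deriv[OF in_K[OF yf]] by simp
    ultimately show "((\<lambda>t. T (y + t *\<^sub>R d)) has_derivative (\<lambda>t. E.J y *v (t *\<^sub>R d))) (at 0)"
      by (rule has_derivative_compose)
    have "((\<lambda>t::real. y' + t *\<^sub>R v) has_derivative (\<lambda>t. t *\<^sub>R v)) (at 0)"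
      by (auto intro!: derivative_eq_intros)
    moreover have "(T' has_derivative (\<lambda>h. E'.J y' *v h)) (at (y' + 0 *\<^sub>R v))"
      using E'.T_deriv[OF in_K'[OF y'(1)]] by simp
    ultimately show "((\<lambda>t. T' (y' + t *\<^sub>R v)) has_derivative (\<lambda>t. E'.J y' *v (t *\<^sub>R v))) (at 0)"
      by (rule has_derivative_compose)
  qed
  then have "(r has_derivative (\<lambda>t. 0)) (at 0)"
    by (simp add: matrix_vector_mult_scaleR Jd)
  moreover have "c * \<rho> / 2 > 0"
    using c(1) \<rho> by simp
  ultimately obtain \<delta> where \<delta>: "\<delta> > 0" "\<And>t. norm t < \<delta> \<Longrightarrow> norm (r t - r 0) \<le> c * \<rho> / 2 * norm t"
    unfolding has_derivative_at_alt by (metis diff_zero)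
  \<comment> \<open>Small enough for three purposes: the curves are closer than c \<rho> t, the
    segment from y' towards \<open>k\<close> is not overshot, and the ball around y + t d stays
    where the gaps to the other facets are positive.\<close>
  define t where "t = min (min (\<delta> / 2) 1) (s / (2 * (norm d + \<rho>)))"
  have dr: "norm d + \<rho> > 0"
    using \<rho> by (simp add: add_nonneg_pos)
  have t: "0 < t" "t < \<delta>" "t \<le> 1" "t * (norm d + \<rho>) < s"
  proof -
    show "0 < t" "t < \<delta>" "t \<le> 1"
      using \<delta>(1) s(1) dr by (auto simp: t_def min_less_iff_disj)
    have "t * (norm d + \<rho>) \<le> s / (2 * (norm d + \<rho>)) * (norm d + \<rho>)"
      using dr by (intro mult_right_mono) (auto simp: t_def)
    also have "\<dots> = s / 2"
    proof -
      define q where "q = norm d + \<rho>"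
      show ?thesis
        using dr unfolding q_def[symmetric] by (simp add: field_simps)
    qed
    also have "\<dots> < s"
      using s(1) by simp
    finally show "t * (norm d + \<rho>) < s" .
  qed
  define p where "p = y + t *\<^sub>R d"
  have "cball p (\<rho> * t) \<subseteq> interior K"
  proof
    fix u assume u: "u \<in> cball p (\<rho> * t)"
    then have up: "norm (u - p) \<le> \<rho> * t"
      by (simp add: dist_norm norm_minus_commute)
    have "u - y = (u - p) + t *\<^sub>R d"
      by (simp add: p_def)
    then have "norm (u - y) \<le> norm (u - p) + norm (t *\<^sub>R d)"
      by (metis norm_triangle_ineq)
    also have "\<dots> \<le> t * (norm d + \<rho>)"
      using up t(1) by (simp add: distrib_left mult.commute)
    finally have "norm (u - y) < s"
      using t(4) by linarith
    then have "u \<in> ball y s"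
      by (simp add: dist_norm norm_minus_commute)
    moreover have "0 < gap K f u"
    proof -
      have "gap K f u = gap K f (y + (t *\<^sub>R d + (u - p)))"
        by (simp add: p_def)
      also have "\<dots> = gap K f y - n \<bullet> (t *\<^sub>R d + (u - p))"
        by (rule A.gap_add)
      also have "\<dots> = 2 * \<rho> * t - n \<bullet> (u - p)"
        using yf by (simp add: A.mem_facet inner_add_right \<rho>_def)
      finally have "gap K f u = 2 * \<rho> * t - n \<bullet> (u - p)" .
      moreover have "n \<bullet> (u - p) \<le> \<rho> * t"
        using Cauchy_Schwarz_ineq2[of n "u - p"] up by (simp add: A.normal)
      moreover have "\<rho> * t > 0"
        using \<rho> t(1) by simp
      ultimately show ?thesis
        by simp
    qed
    ultimately show "u \<in> interior K"
      unfolding E.mem_interior_iff_gaps using s(2) by blast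
  qed
  then have sub: "ball (T p) (c * (\<rho> * t)) \<subseteq> T ` interior K"
    using \<rho> t(1) by (intro E.ball_subset_image[OF c]) simp_all
  have "norm (r t) \<le> c * \<rho> / 2 * t"
    using \<delta>(2)[of t] t y'(2) by (simp add: r_def)
  also have "\<dots> < c * (\<rho> * t)"
    using c(1) \<rho> t(1) by simp
  finally have "T' (y' + t *\<^sub>R v) \<in> ball (T p) (c * (\<rho> * t))"
    by (simp add: r_def p_def dist_norm)
  then have "T' (y' + t *\<^sub>R v) \<in> interior (T ` K)"
    using sub E.image_interior_subset by blast
  moreover have "y' + t *\<^sub>R v \<in> interior K"
  proof -
    have "y' - t *\<^sub>R (y' - k) \<in> interior K"
      using in_K'[OF y'(1)] k t by (intro mem_interior_convex_shrink E.convex) auto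
    then show ?thesis
      by (simp add: v_def algebra_simps)
  qed
  then have "T' (y' + t *\<^sub>R v) \<in> interior (T' ` K)"
    using E'.image_interior_subset by blast
  ultimately show False
    using disjoint by blast
qed

text \<open>Extends \<open>transition\<close> to a height-preserving map between the cylinders, so
  that a change of variables in full dimension can compare the two facet integrals.\<close>

definition \<Phi> :: "real^'n \<Rightarrow> real^'n" where
  "\<Phi> z = transition (foot K f z) - gap K f z *\<^sub>R n'"

definition \<Phi>' :: "real^'n \<Rightarrow> real^'n \<Rightarrow> real^'n" where
  "\<Phi>' z h = B (foot K f z) *v (h - (n \<bullet> h) *\<^sub>R n) + (n \<bullet> h) *\<^sub>R n'"

lemma \<Phi>_props:
  assumes z: "z \<in> cylinder K f"
  shows "gap K f' (\<Phi> z) = gap K f z" "foot K f' (\<Phi> z) = transition (foot K f z)" "\<Phi> z \<in> cylinder K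
      f'"
proof -
  have tf: "transition (foot K f z) \<in> f'"
    using z transition(1) by (auto simp: A.mem_cylinder)
  have "gap K f' (transition (foot K f z) + (- gap K f z) *\<^sub>R n') = gap K f z"
    using tf by (simp only: A'.gap_add) (simp add: A'.mem_facet)
  then show g: "gap K f' (\<Phi> z) = gap K f z"
    by (simp add: \<Phi>_def)
  show ft: "foot K f' (\<Phi> z) = transition (foot K f z)"
    by (simp add: foot_def g) (simp add: \<Phi>_def foot_def)
  show "\<Phi> z \<in> cylinder K f'"
    using z tf by (simp add: A'.mem_cylinder A.mem_cylinder g ft)
qed

lemma \<Phi>_image: "\<Phi> ` cylinder K f = cylinder K f'"
proof
  show "\<Phi> ` cylinder K f \<subseteq> cylinder K f'"
    using \<Phi>_props(3) by blast
  show "cylinder K f' \<subseteq> \<Phi> ` cylinder K f"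
  proof
    fix z' assume z': "z' \<in> cylinder K f'"
    then obtain y where y: "y \<in> f" "foot K f' z' = transition y"
      using transition_image A'.mem_cylinder by blast
    define z where "z = y + (- gap K f' z') *\<^sub>R n"
    have g: "gap K f z = gap K f' z'"
      unfolding z_def using y(1) by (simp only: A.gap_add) (simp add: A.mem_facet)
    have ft: "foot K f z = y"
      by (simp add: foot_def g) (simp add: z_def)
    have "z \<in> cylinder K f"
      using y(1) z' by (simp add: A.mem_cylinder A'.mem_cylinder g ft)
    moreover have "\<Phi> z = z'"
      by (simp add: \<Phi>_def ft g y(2)[symmetric]) (simp add: foot_def)
    ultimately show "z' \<in> \<Phi> ` cylinder K f"
      by blast
  qed
qed

lemma \<Phi>_inj: "inj_on \<Phi> (cylinder K f)"
proof (rule inj_onI)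
  fix x z assume xz: "x \<in> cylinder K f" "z \<in> cylinder K f" "\<Phi> x = \<Phi> z"
  then have "transition (foot K f x) = transition (foot K f z)" "gap K f x = gap K f z"
    using \<Phi>_props(1,2) by metis+
  moreover have "foot K f x \<in> f" "foot K f z \<in> f"
    using xz by (auto simp: A.mem_cylinder)
  ultimately show "x = z"
    using transition_inj by (auto simp: foot_def dest!: inj_onD)
qed

lemma \<Phi>_deriv:
  assumes z: "z \<in> cylinder K f"
  shows "(\<Phi> has_derivative \<Phi>' z) (at z within cylinder K f)"
proof -
  have g: "(gap K f has_derivative (\<lambda>h. - (n \<bullet> h))) (at z within cylinder K f)"
    unfolding gap_def[abs_def] by (auto intro!: derivative_eq_intros)
  have ft: "(foot K f has_derivative (\<lambda>h. h - (n \<bullet> h) *\<^sub>R n)) (at z within cylinder K f)"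
    unfolding foot_def[abs_def] by (auto intro!: derivative_eq_intros g)
  have "foot K f z \<in> f"
    using z by (simp add: A.mem_cylinder)
  then have "(transition has_derivative (\<lambda>h. B (foot K f z) *v h)) (at (foot K f z) within foot K f
      ` cylinder K f)"
    by (rule has_derivative_subset[OF transition_deriv A.foot_cylinder])
  from has_derivative_in_compose[OF ft this]
  show ?thesis
    unfolding \<Phi>_def[abs_def] \<Phi>'_def[abs_def]
    by (auto intro!: derivative_eq_intros g)
qed

text \<open>Both linear maps agree on directions along the facet and differ in the image of the
  normal. Hence \<open>B\<close> is a rank one update composed with the derivative of \<Phi>, and
  the determinant of the update is \<open>ratio\<close>.\<close>

lemma det_\<Phi>':
  assumes z: "z \<in> cylinder K f"
  shows "det (B (foot K f z)) = ratio (foot K f z) * det (matrix (\<Phi>' z))"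
proof -
  define y where "y = foot K f z"
  have y: "y \<in> f"
    using z by (simp add: A.mem_cylinder y_def)
  define a where "a = B y *v n - n'"
  let ?R = "\<lambda>x. x + (n' \<bullet> x) *\<^sub>R a"
  have lin\<Phi>: "linear (\<Phi>' z)"
    unfolding \<Phi>'_def[abs_def]
    by (intro linearI)
      (simp_all add: matrix_vector_right_distrib matrix_vector_mult_diff_distrib inner_add_right
        matrix_vector_mult_scaleR algebra_simps)
  have linR: "linear ?R"
    by (intro linearI) (simp_all add: inner_add_right algebra_simps)
  have "?R (\<Phi>' z h) = B y *v h" for h
  proof -
    have "n' \<bullet> (B y *v (h - (n \<bullet> h) *\<^sub>R n)) = 0"
      by (rule B_tangent[OF y]) (simp add: inner_diff_right)
    then have "n' \<bullet> \<Phi>' z h = n \<bullet> h"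
      by (simp add: \<Phi>'_def y_def[symmetric] inner_add_right)
    then show ?thesis
      by (simp add: \<Phi>'_def y_def[symmetric] a_def matrix_vector_mult_diff_distrib
          matrix_vector_mult_scaleR algebra_simps)
  qed
  then have "matrix (?R \<circ> \<Phi>' z) = B y"
    by (simp add: o_def)
  then have "B y = matrix ?R ** matrix (\<Phi>' z)"
    using matrix_compose[OF lin\<Phi> linR] by simp
  then have "det (B y) = det (matrix ?R) * det (matrix (\<Phi>' z))"
    by (metis det_mul)
  also have "det (matrix ?R) = ratio y"
    by (simp add: det_rank_one_update[OF A'.normal] a_def ratio_def inner_diff_right)
  finally show ?thesis
    by (simp add: y_def)
qed

text \<open>The Jacobian of \<Phi> and the factor between the element Jacobians combine to the
  modulus of 1 / \<open>ratio\<close>, while the conormals differ by \<open>ratio\<close> itself;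
  what remains is its sign. The sign is known over the interior of the facet, and the rest of the
  cylinder is a null set.\<close>

theorem side_integral_opposite:
  assumes g: "continuous_on (T ` f) g"
  shows "facet_integral f' n' (\<lambda>y. g (T' y) * (\<bar>det (E'.J y)\<bar> * (E'.cnormal f' y \<bullet> e))) =
    - facet_integral f n (\<lambda>y. g (T y) * (\<bar>det (E.J y)\<bar> * (E.cnormal f y \<bullet> e)))"
proof -
  define q where "q = (\<lambda>y. g (T y) * (\<bar>det (E.J y)\<bar> * (E.cnormal f y \<bullet> e)))"
  define q' where "q' = (\<lambda>y. g (T' y) * (\<bar>det (E'.J y)\<bar> * (E'.cnormal f' y \<bullet> e)))"
  have "continuous_on f' q'"
    unfolding q'_def
    using g unfolding side
    by (intro continuous_intros continuous_on_compose2[OF g[unfolded side]] continuous_on_subset[OF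
        E'.T_cont A'.facet_subset]
        continuous_on_subset[OF E'.det_J_cont A'.facet_subset] continuous_on_subset[OF
            E'.cnormal_cont A'.facet_subset]) auto
  then have "(\<lambda>z. q' (foot K f' z)) absolutely_integrable_on \<Phi> ` cylinder K f"
    unfolding \<Phi>_image by (rule A'.facet_integrable)
  note cov = change_of_variables_compact(2)[OF A.compact_cylinder \<Phi>_deriv \<Phi>_inj this]
  have "facet_integral f' n' q' = integral (cylinder K f) (\<lambda>z. \<bar>det (matrix (\<Phi>' z))\<bar> * q' (foot K f'
      (\<Phi> z)))"
    using cov by (simp add: A'.facet_integral_eq \<Phi>_image)
  also have "\<dots> = integral (cylinder K f) (\<lambda>z. - q (foot K f z))"
  proof (rule integral_spike[OF A.negligible_cylinder_boundary])
    fix z assume z: "z \<in> cylinder K f - {z \<in> cylinder K f. foot K f z \<notin> A.facet_interior}"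
    define y where "y = foot K f z"
    have zc: "z \<in> cylinder K f" and yi: "y \<in> A.facet_interior"
      using z by (auto simp: y_def)
    then have yf: "y \<in> f"
      by (simp add: A.facet_interior_def)
    have "\<bar>det (E.J y)\<bar> = \<bar>det (E'.J (transition y))\<bar> * (\<bar>ratio y\<bar> * \<bar>det (matrix (\<Phi>' z))\<bar>)"
      unfolding det_B[OF yf, symmetric] using det_\<Phi>'[OF zc] by (simp add: y_def abs_mult)
    then have "\<bar>det (matrix (\<Phi>' z))\<bar> * q' (transition y) = - q y"
      using ratio_neg[OF yi] by (simp add: q_def q'_def transition(2)[OF yf] cnormal_ratio[OF yf])
    then show "- q (foot K f z) = \<bar>det (matrix (\<Phi>' z))\<bar> * q' (foot K f' (\<Phi> z))"
      by (simp add: \<Phi>_props(2)[OF zc] y_def)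
  qed
  also have "\<dots> = - facet_integral f n q"
    by (simp add: A.facet_integral_eq)
  finally show ?thesis
    by (simp add: q_def q'_def)
qed

end

section \<open>Meshes\<close>

definition C1_fun :: "(real^'n \<Rightarrow> real) \<Rightarrow> bool" where
  "C1_fun p \<longleftrightarrow> (\<exists>G :: real^'n \<Rightarrow> real^'n. continuous_on UNIV G \<and> (\<forall>y. (p has_derivative (\<lambda>v. G y \<bullet> v))
      (at y)))"

lemma C1_fun_continuous: "C1_fun p \<Longrightarrow> continuous_on S p"
  unfolding C1_fun_def
  by (metis continuous_on_subset differentiable_def differentiable_imp_continuous_on
      differentiable_on_def
      has_derivative_at_withinI subset_UNIV)

lemma C1_fun_const: "C1_fun (\<lambda>x. c)"
  unfolding C1_fun_def
  by (intro exI[of _ "\<lambda>_. 0"] conjI allI has_derivative_eq_rhs[OF has_derivative_const]) auto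

lemma C1_fun_coord: "C1_fun (\<lambda>x. x $ i)"
  unfolding C1_fun_def
  by (intro exI[of _ "\<lambda>_. axis i 1"] conjI allI
      has_derivative_eq_rhs[OF bounded_linear_imp_has_derivative[OF bounded_linear_vec_nth]])
    (auto simp: inner_axis')

lemma C1_fun_add:
  assumes "C1_fun p" "C1_fun q"
  shows "C1_fun (\<lambda>x. p x + q x)"
proof -
  obtain G H where "continuous_on UNIV G" "\<And>y. (p has_derivative (\<lambda>v. G y \<bullet> v)) (at y)"
    "continuous_on UNIV H" "\<And>y. (q has_derivative (\<lambda>v. H y \<bullet> v)) (at y)"
    using assms unfolding C1_fun_def by blast
  then show ?thesis
    unfolding C1_fun_def
    by (intro exI[of _ "\<lambda>y. G y + H y"] conjI allI continuous_intros has_derivative_eq_rhs[OF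
        has_derivative_add])
      (auto simp: inner_add_left)
qed

lemma C1_fun_mult:
  assumes "C1_fun p" "C1_fun q"
  shows "C1_fun (\<lambda>x. p x * q x)"
proof -
  obtain G H where GH: "continuous_on UNIV G" "\<And>y. (p has_derivative (\<lambda>v. G y \<bullet> v)) (at y)"
    "continuous_on UNIV H" "\<And>y. (q has_derivative (\<lambda>v. H y \<bullet> v)) (at y)"
    using assms unfolding C1_fun_def by blast
  have "((\<lambda>x. p x * q x) has_derivative (\<lambda>v. (p y *\<^sub>R H y + q y *\<^sub>R G y) \<bullet> v)) (at y)" for y
    using has_derivative_mult[OF GH(2)[of y] GH(4)[of y]]
    by (simp add: inner_add_left mult.commute)
  moreover have "continuous_on UNIV (\<lambda>y. p y *\<^sub>R H y + q y *\<^sub>R G y)"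
    by (intro continuous_intros GH C1_fun_continuous assms)
  ultimately show ?thesis
    unfolding C1_fun_def by blast
qed

lemma C1_fun_sum: "(\<And>i. i \<in> I \<Longrightarrow> C1_fun (p i)) \<Longrightarrow> C1_fun (\<lambda>x. \<Sum>i\<in>I. p i x)"
  by (induction I rule: infinite_finite_induct) (auto intro: C1_fun_const C1_fun_add)

lemma C1_fun_prod: "(\<And>i. i \<in> I \<Longrightarrow> C1_fun (p i)) \<Longrightarrow> C1_fun (\<lambda>x. \<Prod>i\<in>I. p i x)"
  by (induction I rule: infinite_finite_induct) (auto intro: C1_fun_const C1_fun_mult)

lemma C1_fun_power: "C1_fun p \<Longrightarrow> C1_fun (\<lambda>x. p x ^ k)"
  by (induction k) (auto intro: C1_fun_const C1_fun_mult)

lemma C1_fun_polys: "p \<in> polys A \<Longrightarrow> C1_fun p"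
  unfolding polys_def monomial_def
  by (auto intro!: C1_fun_sum C1_fun_mult C1_fun_prod C1_fun_power C1_fun_const C1_fun_coord)

section \<open>Smooth functions transported from the reference element to a curved element\<close>

context curved_element
begin

lemma pullback_derivative:
  assumes G: "continuous_on UNIV G" "\<And>y. (p has_derivative (\<lambda>v. G y \<bullet> v)) (at y)"
    and h: "\<And>y. y \<in> K \<Longrightarrow> h (T y) = p y"
    and y: "y \<in> interior K"
  shows "(h has_derivative (\<lambda>v. G y \<bullet> (matrix_inv (J y) *v v))) (at (T y))"
proof -
  have yK: "y \<in> K"
    using y interior_subset by blast
  have "(p has_derivative (\<lambda>v. G y \<bullet> v)) (at (Ti (T y)))"
    using G(2) yK by simp
  from has_derivative_compose[OF Ti_deriv_interior[OF y] this]
  have "((\<lambda>x. p (Ti x)) has_derivative (\<lambda>v. G y \<bullet> (matrix_inv (J y) *v v))) (at (T y))" .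
  then show ?thesis
  proof (rule has_derivative_transform_within_open[OF _ open_image_interior])
    show "T y \<in> T ` interior K"
      using y by blast
    show "p (Ti x) = h x" if "x \<in> T ` interior K" for x
      using that h interior_subset[of K] by auto
  qed
qed

text \<open>The curved element need not be convex, so a gradient bound there would not suffice. The
  Lipschitz bound is taken on the convex reference element and composed with that of the inverse
  map.\<close>

lemma pullback_lipschitz:
  assumes p: "C1_fun p" and h: "\<And>y. y \<in> K \<Longrightarrow> h (T y) = p y"
  obtains L where "\<And>a b. a \<in> T ` K \<Longrightarrow> b \<in> T ` K \<Longrightarrow> \<bar>h a - h b\<bar> \<le> L * norm (a - b)"
proof -
  obtain G where G: "continuous_on UNIV G" "\<And>y. (p has_derivative (\<lambda>v. G y \<bullet> v)) (at y)"
    using p unfolding C1_fun_def by blast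
  obtain C where C: "C > 0" "\<And>y. y \<in> K \<Longrightarrow> norm (G y) \<le> C"
    using compact_imp_bounded[OF compact_continuous_image[OF continuous_on_subset[OF G(1)
        subset_UNIV] compact]]
    by (auto simp: bounded_pos)
  have pl: "norm (p a - p b) \<le> C * norm (a - b)" if "a \<in> K" "b \<in> K" for a b
  proof (rule differentiable_bound[OF convex has_derivative_at_withinI[OF G(2)] _ that])
    fix y assume y: "y \<in> K"
    show "onorm (\<lambda>v. G y \<bullet> v) \<le> C"
      by (rule onorm_le)
        (use C(2)[OF y] in \<open>auto intro: order_trans[OF Cauchy_Schwarz_ineq2 mult_right_mono]\<close>)
  qed
  obtain B where B: "B > 0" "\<And>x y. x \<in> T ` K \<Longrightarrow> y \<in> T ` K \<Longrightarrow> norm (Ti x - Ti y) \<le> B * norm (x - y)"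
    using Ti_lipschitz by blast
  have "\<bar>h a - h b\<bar> \<le> (C * B) * norm (a - b)" if ab: "a \<in> T ` K" "b \<in> T ` K" for a b
  proof -
    have "\<bar>h a - h b\<bar> = norm (p (Ti a) - p (Ti b))"
      using h[of "Ti a"] h[of "Ti b"] ab by (simp add: T_Ti)
    also have "\<dots> \<le> C * norm (Ti a - Ti b)"
      using ab by (intro pl T_Ti)
    also have "\<dots> \<le> C * (B * norm (a - b))"
      using B(2)[OF ab] C(1) by (intro mult_left_mono) auto
    finally show ?thesis
      by (simp add: mult.assoc)
  qed
  then show ?thesis
    using that by blast
qed

lemma pullback_continuous:
  assumes p: "C1_fun p" and h: "\<And>y. y \<in> K \<Longrightarrow> h (T y) = p y"
  shows "continuous_on (T ` K) h"
proof -
  have "continuous_on (T ` K) (\<lambda>x. p (Ti x))"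
    by (intro continuous_on_compose2[OF C1_fun_continuous[OF p] Ti_cont]) auto
  then show ?thesis
    by (rule continuous_on_cong[THEN iffD1, rotated -1]) (use h in auto)
qed

text \<open>The chain rule holds in the interior, and its right-hand side is continuous up to the
  frontier. This continuous function replaces the Frechet derivative, whose values on the frontier
  are unspecified.\<close>

lemma pullback_gradient:
  assumes p: "C1_fun p" and h: "\<And>y. y \<in> K \<Longrightarrow> h (T y) = p y"
  obtains g where "continuous_on (T ` K) g"
    "\<And>y. y \<in> interior K \<Longrightarrow> h differentiable (at (T y))"
    "\<And>y. y \<in> interior K \<Longrightarrow> frechet_derivative h (at (T y)) e = g (T y)"
    "integral (T ` K) g = (\<Sum>f\<in>{f. f facet_of K}.
       facet_integral f (ref_normal K f) (\<lambda>y. h (T y) * (\<bar>det (J y)\<bar> * (cnormal f y \<bullet> e))))"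
proof -
  obtain G where G: "continuous_on UNIV G" "\<And>y. (p has_derivative (\<lambda>v. G y \<bullet> v)) (at y)"
    using p unfolding C1_fun_def by blast
  note d = pullback_derivative[where h = h and p = p, OF G h]
  define g where "g = (\<lambda>x. G (Ti x) \<bullet> (matrix_inv (J (Ti x)) *v e))"
  obtain L where L: "\<And>a b. a \<in> T ` K \<Longrightarrow> b \<in> T ` K \<Longrightarrow> \<bar>h a - h b\<bar> \<le> L * norm (a - b)"
    using pullback_lipschitz[of p h] p h by blast
  have TiK: "Ti ` T ` K \<subseteq> K"
    by auto
  have cg: "continuous_on (T ` K) g"
    unfolding g_def
    by (intro continuous_intros continuous_on_compose2[OF G(1) Ti_cont] continuous_on_compose2[OF
        J_inv_cont Ti_cont TiK]) auto
  have gT: "g (T y) = G y \<bullet> (matrix_inv (J y) *v e)" if "y \<in> interior K" for y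
    using that interior_subset[of K] by (auto simp: g_def)
  have hT: "continuous_on K (\<lambda>y. h (T y))"
    using C1_fun_continuous[OF p, of K] by (rule continuous_on_cong[THEN iffD1, rotated -1]) (use h
        in auto)
  show ?thesis
  proof (rule that[OF cg])
    show "h differentiable (at (T y))" if "y \<in> interior K" for y
      using d[OF _ that] by (auto simp: differentiable_def)
    show "frechet_derivative h (at (T y)) e = g (T y)" if "y \<in> interior K" for y
      using frechet_derivative_at[OF d[OF _ that], symmetric] gT[OF that] by simp
    show "integral (T ` K) g = (\<Sum>f\<in>{f. f facet_of K}.
       facet_integral f (ref_normal K f) (\<lambda>y. h (T y) * (\<bar>det (J y)\<bar> * (cnormal f y \<bullet> e))))"
      by (rule divergence_theorem[OF L d cg gT hT]) auto
  qed
qed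

lemma integral_eq_interior:
  fixes g1 g2 :: "real^'n \<Rightarrow> real"
  assumes "\<And>y. y \<in> interior K \<Longrightarrow> g1 (T y) = g2 (T y)"
  shows "integral (T ` K) g1 = integral (T ` K) g2"
proof (rule integral_spike[OF negligible_image_frontier])
  fix x assume "x \<in> T ` K - T ` frontier K"
  then obtain y where "x = T y" "y \<in> interior K"
    using closed by (auto simp: frontier_def)
  then show "g2 x = g1 x"
    using assms by simp
qed

lemma integrable_eq_interior:
  fixes g g1 :: "real^'n \<Rightarrow> real"
  assumes "continuous_on (T ` K) g" "\<And>y. y \<in> interior K \<Longrightarrow> g1 (T y) = g (T y)"
  shows "g1 integrable_on T ` K"
proof (rule integrable_spike[OF _ negligible_image_frontier])
  show "g integrable_on T ` K"
    using absolutely_integrable_continuous_compact[OF image_compact assms(1)]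
    by (simp add: absolutely_integrable_on_def)
  fix x assume "x \<in> T ` K - T ` frontier K"
  then obtain y where "x = T y" "y \<in> interior K"
    using closed by (auto simp: frontier_def)
  then show "g1 x = g x"
    using assms(2) by simp
qed

end

text \<open>The integral over a side of \<open>g\<close> times the component of the outward unit
  normal in direction \<open>e\<close>. The norm of the conormal in the surface element cancels
  against the normalization of the normal.\<close>

definition side_integral :: "(real^'n) mesh \<Rightarrow> (real^'n) side \<Rightarrow> (real^'n \<Rightarrow> real) \<Rightarrow> real^'n \<Rightarrow> real"
    where
  "side_integral M s g e = facet_integral (snd s) (ref_normal (refel M) (snd s))
     (\<lambda>y. g (emap M (fst s) y) * (\<bar>det (jacobian (emap M (fst s)) (at y))\<bar> * (conormal M s y \<bullet> e)))"

section \<open>Elements, sides and faces of a mesh\<close>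

locale mesh =
  fixes M :: "(real^'n) mesh"
  assumes valid: "valid_mesh M"
begin

abbreviation K :: "(real^'n) set" where "K \<equiv> refel M"

lemma valid_mesh_rules:
  shows "polytope K" "interior K \<noteq> {}" "finite (elems M)"
    and "\<forall>\<kappa>\<in>elems M. C1_diffeo_on K (emap M \<kappa>) \<and> \<kappa> = emap M \<kappa> ` K"
    and "\<Union> (elems M) = closure (dom M)"
    and "\<forall>\<kappa>\<in>elems M. \<forall>\<kappa>'\<in>elems M. \<kappa> \<noteq> \<kappa>' \<longrightarrow> interior \<kappa> \<inter> interior \<kappa>' = {}"
    and "\<forall>\<Gamma>\<in>faces M. set_face \<Gamma> \<subseteq> sides M"
    and "\<forall>s s'. Interior s s' \<in> faces M \<longrightarrow> fst s \<noteq> fst s' \<and> side_set M s = side_set M s'"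
    and "\<forall>s\<in>sides M. \<exists>!\<Gamma>. \<Gamma> \<in> faces M \<and> s \<in> set_face \<Gamma>"
    and "frontier (dom M) = (\<Union>s\<in>{s. Boundary s \<in> faces M}. side_set M s)"
  using valid unfolding valid_mesh_def by - (elim conjE, assumption)+

lemmas elem_disjoint = valid_mesh_rules(6)
  and frontier_dom = valid_mesh_rules(10)

sublocale full_polytope K
  using valid_mesh_rules(1,2) by (rule full_polytope.intro)

lemma element: "\<kappa> \<in> elems M \<Longrightarrow> curved_element K (emap M \<kappa>)"
  using valid_mesh_rules(4)
  by (intro curved_element.intro full_polytope_axioms curved_element_axioms.intro) blast

lemma elem_image: "\<kappa> \<in> elems M \<Longrightarrow> emap M \<kappa> ` K = \<kappa>"
  using valid_mesh_rules(4) by blast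

lemma finite_elems: "finite (elems M)"
  by (rule valid_mesh_rules(3))

lemma elem_compact: "\<kappa> \<in> elems M \<Longrightarrow> Topological_Spaces.compact \<kappa>"
  using curved_element.image_compact[OF element] elem_image by metis

lemma conormal_eq: "fst s \<in> elems M \<Longrightarrow> conormal M s y = curved_element.cnormal K (emap M (fst s))
    (snd s) y"
  by (simp add: conormal_def curved_element.cnormal_def[OF element])

lemma sides_iff: "s \<in> sides M \<longleftrightarrow> fst s \<in> elems M \<and> snd s facet_of K"
  by (cases s) (auto simp: sides_def)

lemma finite_sides: "finite (sides M)"
  unfolding sides_def using finite_elems finite_facets by simp

lemma face_sides: "\<Gamma> \<in> faces M \<Longrightarrow> set_face \<Gamma> \<subseteq> sides M"
  using valid_mesh_rules(7) by blast

lemma lead_side: "\<Gamma> \<in> faces M \<Longrightarrow> lead \<Gamma> \<in> sides M"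
  using face_sides[of \<Gamma>] by (cases \<Gamma>) auto

lemma finite_faces: "finite (faces M)"
proof (rule finite_subset)
  show "faces M \<subseteq> Boundary ` sides M \<union> (\<lambda>(s, t). Interior s t) ` (sides M \<times> sides M)"
  proof
    fix \<Gamma> assume "\<Gamma> \<in> faces M"
    then show "\<Gamma> \<in> Boundary ` sides M \<union> (\<lambda>(s, t). Interior s t) ` (sides M \<times> sides M)"
      using face_sides[of \<Gamma>] by (cases \<Gamma>) (auto intro: image_eqI[of _ _ "(_, _)"])
  qed
qed (use finite_sides in auto)

lemma interior_face:
  assumes "Interior s s' \<in> faces M"
  shows "s \<in> sides M" "s' \<in> sides M" "fst s \<noteq> fst s'" "side_set M s = side_set M s'"
proof -
  show "s \<in> sides M" "s' \<in> sides M"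
    using face_sides[OF assms] by auto
  show "fst s \<noteq> fst s'" "side_set M s = side_set M s'"
    using valid_mesh_rules(8) assms by blast+
qed

text \<open>Every side belongs to exactly one face, so the faces partition the sides into singletons
  and pairs.\<close>

lemma sum_sides:
  "(\<Sum>s\<in>sides M. F s) = (\<Sum>\<Gamma>\<in>faces M. \<Sum>s\<in>set_face \<Gamma>. F s)"
proof -
  have ex1: "\<exists>!\<Gamma>. \<Gamma> \<in> faces M \<and> s \<in> set_face \<Gamma>" if "s \<in> sides M" for s
    using valid_mesh_rules(9) that by blast
  have "sides M = (\<Union>\<Gamma>\<in>faces M. set_face \<Gamma>)"
    using face_sides ex1 by blast
  moreover have "set_face \<Gamma> \<inter> set_face \<Gamma>' = {}" if "\<Gamma> \<in> faces M" "\<Gamma>' \<in> faces M" "\<Gamma> \<noteq> \<Gamma>'" for \<Gamma> \<Gamma>'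
    using that ex1 face_sides by blast
  moreover have "finite (set_face \<Gamma>)" for \<Gamma> :: "(real^'n) side face"
    by (cases \<Gamma>) auto
  ultimately show ?thesis
    by (simp add: sum.UNION_disjoint finite_faces)
qed

lemma sum_elems_sides:
  "(\<Sum>\<kappa>\<in>elems M. \<Sum>f\<in>{f. f facet_of K}. F (\<kappa>, f)) = (\<Sum>s\<in>sides M. F s)"
  unfolding sides_def by (simp add: sum.cartesian_product)

lemma side_set_subset: "s \<in> sides M \<Longrightarrow> side_set M s \<subseteq> fst s"
  using elem_image polytope_facet.facet_subset[OF facet_locale]
  by (fastforce simp: sides_iff side_set_def)

lemma compact_side_set: "s \<in> sides M \<Longrightarrow> Topological_Spaces.compact (side_set M s)"
proof -
  assume s: "s \<in> sides M"
  then interpret E: curved_element K "emap M (fst s)"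
    using element sides_iff by blast
  interpret F: polytope_facet K "snd s"
    using s by (intro facet_locale) (simp add: sides_iff)
  show ?thesis
    unfolding side_set_def
    by (rule compact_continuous_image[OF continuous_on_subset[OF E.T_cont F.facet_subset]
        F.facet_compact])
qed

lemma side_integrand_continuous:
  assumes s: "s \<in> sides M" and g: "continuous_on (side_set M s) g"
  shows "continuous_on (snd s) (\<lambda>y. g (emap M (fst s) y))"
    and "continuous_on (snd s) (\<lambda>y. \<bar>det (jacobian (emap M (fst s)) (at y))\<bar>)"
    and "continuous_on (snd s) (conormal M s)"
    and "continuous_on (snd s) (\<lambda>y. g (emap M (fst s) y) * (\<bar>det (jacobian (emap M (fst s)) (at y))\<bar>
        * (conormal M s y \<bullet> e)))"
proof -
  interpret E: curved_element K "emap M (fst s)"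
    using element s sides_iff by blast
  interpret F: polytope_facet K "snd s"
    using s by (intro facet_locale) (simp add: sides_iff)
  show 1: "continuous_on (snd s) (\<lambda>y. g (emap M (fst s) y))"
    using g by (intro continuous_on_compose2[OF g] continuous_on_subset[OF E.T_cont F.facet_subset])
      (auto simp: side_set_def)
  show 2: "continuous_on (snd s) (\<lambda>y. \<bar>det (jacobian (emap M (fst s)) (at y))\<bar>)"
    by (rule continuous_on_subset[OF E.det_J_cont F.facet_subset])
  have "conormal M s = E.cnormal (snd s)"
    using s by (auto simp: conormal_eq sides_iff)
  then show 3: "continuous_on (snd s) (conormal M s)"
    using continuous_on_subset[OF E.cnormal_cont F.facet_subset] by simp
  show "continuous_on (snd s) (\<lambda>y. g (emap M (fst s) y) * (\<bar>det (jacobian (emap M (fst s)) (at y))\<bar>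
      * (conormal M s y \<bullet> e)))"
    by (intro continuous_intros 1 2 3)
qed

lemma side_integral_cong:
  assumes s: "s \<in> sides M" and g: "\<And>x. x \<in> side_set M s \<Longrightarrow> g x = h x"
  shows "side_integral M s g e = side_integral M s h e"
proof -
  interpret F: polytope_facet K "snd s"
    using s by (intro facet_locale) (simp add: sides_iff)
  show ?thesis
    unfolding side_integral_def using g by (intro F.facet_integral_cong) (auto simp: side_set_def)
qed

lemma side_integral_diff:
  assumes s: "s \<in> sides M" and g: "continuous_on (side_set M s) g" "continuous_on (side_set M s) h"
  shows "side_integral M s (\<lambda>x. g x - h x) e = side_integral M s g e - side_integral M s h e"
proof -
  interpret F: polytope_facet K "snd s"
    using s by (intro facet_locale) (simp add: sides_iff)
  have "continuous_on (side_set M s) (\<lambda>x. - h x)"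
    using g(2) by (intro continuous_intros)
  note F.facet_integral_add[OF side_integrand_continuous(4)[OF s g(1), of e]
      side_integrand_continuous(4)[OF s this, of e]]
  moreover have "side_integral M s (\<lambda>x. - h x) e = - side_integral M s h e"
    using F.facet_integral_cmult[of "-1"] by (simp add: side_integral_def)
  ultimately show ?thesis
    by (simp add: side_integral_def algebra_simps)
qed

lemma side_integral_0:
  assumes s: "s \<in> sides M" and "\<And>x. x \<in> side_set M s \<Longrightarrow> g x = 0"
  shows "side_integral M s g e = 0"
proof -
  interpret F: polytope_facet K "snd s"
    using s by (intro facet_locale) (simp add: sides_iff)
  have "side_integral M s g e = side_integral M s (\<lambda>x. 0) e"
    using assms by (intro side_integral_cong)
  then show ?thesis
    using F.facet_integral_cmult[of 0] by (simp add: side_integral_def)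
qed

lemma side_integral_opposite:
  assumes \<Gamma>: "Interior s s' \<in> faces M" and g: "continuous_on (side_set M s) g"
  shows "side_integral M s' g e = - side_integral M s g e"
proof -
  note s = interior_face[OF \<Gamma>]
  have el: "fst s \<in> elems M" "fst s' \<in> elems M"
    using s by (auto simp: sides_iff)
  interpret E: curved_element K "emap M (fst s)"
    by (rule element[OF el(1)])
  interpret E': curved_element K "emap M (fst s')"
    by (rule element[OF el(2)])
  interpret A: polytope_facet K "snd s"
    using s by (intro facet_locale) (simp add: sides_iff)
  interpret A': polytope_facet K "snd s'"
    using s by (intro facet_locale) (simp add: sides_iff)
  have "interior (fst s) \<inter> interior (fst s') = {}"
    using valid_mesh_rules(6) el s(3) by blast
  then interpret shared_side K "emap M (fst s)" "emap M (fst s')" "snd s" "snd s'"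
    using s(4) by unfold_locales (simp_all add: side_set_def elem_image el)
  show ?thesis
    using side_integral_opposite[of g e] g el
    by (simp add: side_integral_def side_set_def conormal_eq)
qed

lemma face_integral_normal:
  assumes \<Gamma>: "\<Gamma> \<in> faces M"
  shows "face_integral M \<Gamma> (\<lambda>x. (e \<bullet> face_normal M \<Gamma> x) * g x) = side_integral M (lead \<Gamma>) g e"
proof -
  define s where "s = lead \<Gamma>"
  have s: "s \<in> sides M"
    using lead_side[OF \<Gamma>] by (simp add: s_def)
  interpret E: curved_element K "emap M (fst s)"
    using element s sides_iff by blast
  interpret F: polytope_facet K "snd s"
    using s by (intro facet_locale) (simp add: sides_iff)
  show ?thesis
    unfolding face_integral_def side_integral_def Let_def s_def[symmetric]
  proof (rule F.facet_integral_cong)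
    fix y assume "y \<in> snd s"
    then have "y \<in> K"
      using F.facet_subset by blast
    then have "face_normal M \<Gamma> (emap M (fst s) y) = conormal M s y /\<^sub>R norm (conormal M s y)"
      by (simp add: face_normal_def Let_def s_def[symmetric] E.Ti_def[symmetric])
    then show "(e \<bullet> face_normal M \<Gamma> (emap M (fst s) y)) * g (emap M (fst s) y) *
          (\<bar>det (jacobian (emap M (fst s)) (at y))\<bar> * norm (conormal M s y)) =
          g (emap M (fst s) y) * (\<bar>det (jacobian (emap M (fst s)) (at y))\<bar> * (conormal M s y \<bullet> e))"
      by (cases "conormal M s y = 0") (simp_all add: inner_commute field_simps)
  qed
qed

lemma elem_gradient:
  assumes \<kappa>: "\<kappa> \<in> elems M" and p: "C1_fun p" and h: "\<And>y. y \<in> K \<Longrightarrow> h (emap M \<kappa> y) = p y"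
  obtains g where "continuous_on \<kappa> g"
    "\<And>y. y \<in> interior K \<Longrightarrow> h differentiable (at (emap M \<kappa> y))"
    "\<And>y. y \<in> interior K \<Longrightarrow> frechet_derivative h (at (emap M \<kappa> y)) e = g (emap M \<kappa> y)"
    "integral \<kappa> g = (\<Sum>f\<in>{f. f facet_of K}. side_integral M (\<kappa>, f) h e)"
proof -
  interpret E: curved_element K "emap M \<kappa>"
    by (rule element[OF \<kappa>])
  obtain g where g: "continuous_on (emap M \<kappa> ` K) g"
    "\<And>y. y \<in> interior K \<Longrightarrow> h differentiable (at (emap M \<kappa> y))"
    "\<And>y. y \<in> interior K \<Longrightarrow> frechet_derivative h (at (emap M \<kappa> y)) e = g (emap M \<kappa> y)"
    "integral (emap M \<kappa> ` K) g = (\<Sum>f\<in>{f. f facet_of K}.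
       facet_integral f (ref_normal K f) (\<lambda>y. h (emap M \<kappa> y) * (\<bar>det (E.J y)\<bar> * (E.cnormal f y \<bullet>
           e))))"
    using E.pullback_gradient[OF p h] by blast
  show ?thesis
    using that[of g] g \<kappa> unfolding elem_image[OF \<kappa>] by (simp add: side_integral_def conormal_eq)
qed

end

section \<open>Discontinuous Galerkin forms\<close>

definition lincomb :: "real \<Rightarrow> 'v dgfun \<Rightarrow> 'v dgfun \<Rightarrow> 'v dgfun" where
  "lincomb a u v = (\<lambda>\<kappa> x. a * u \<kappa> x + v \<kappa> x)"

text \<open>Restricted to a set of functions, since the integrals are additive only for integrable
  integrands. The combination \<open>lincomb\<close> covers addition and scaling in one equation per
  argument.\<close>

definition bilinear_on :: "'v dgfun set \<Rightarrow> ('v dgfun \<Rightarrow> 'v dgfun \<Rightarrow> real) \<Rightarrow> bool" where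
  "bilinear_on U b \<longleftrightarrow> (\<forall>a. \<forall>u\<in>U. \<forall>u'\<in>U. \<forall>v\<in>U.
     b (lincomb a u u') v = a * b u v + b u' v \<and> b v (lincomb a u u') = a * b v u + b v u')"

lemma jump_lincomb: "jump (lincomb a u v) \<Gamma> x = a * jump u \<Gamma> x + jump v \<Gamma> x"
  by (cases \<Gamma>) (simp_all add: lincomb_def algebra_simps)

lemma average_lincomb: "average (lincomb a u v) \<Gamma> x = a * average u \<Gamma> x + average v \<Gamma> x"
  by (cases \<Gamma>) (simp_all add: lincomb_def field_simps)

lemma bilinear_on_combine:
  assumes "bilinear_on U b" "bilinear_on U b'"
  shows "bilinear_on U (\<lambda>u v. c * b u v + c' * b' u v)"
  using assms unfolding bilinear_on_def by (simp add: algebra_simps)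

lemma bilinear_on_sum:
  assumes "\<And>i. i \<in> I \<Longrightarrow> bilinear_on U (b i)"
  shows "bilinear_on U (\<lambda>u v. \<Sum>i\<in>I. b i u v)"
  using assms unfolding bilinear_on_def
  by (simp add: sum.distrib sum_distrib_left)

section \<open>Integrals of continuous functions over faces\<close>

context mesh
begin

text \<open>Continuity is asked for after pulling back to the reference facet: that is what the face
  integral uses, and there the unit normal is simply the normalized conormal.\<close>

definition face_cont :: "(real^'n) side face \<Rightarrow> (real^'n \<Rightarrow> real) \<Rightarrow> bool" where
  "face_cont \<Gamma> g \<longleftrightarrow> continuous_on (snd (lead \<Gamma>)) (\<lambda>y. g (emap M (fst (lead \<Gamma>)) y))"

lemma face_contI: "\<Gamma> \<in> faces M \<Longrightarrow> continuous_on (face_set M \<Gamma>) g \<Longrightarrow> face_cont \<Gamma> g"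
  unfolding face_cont_def face_set_def by (rule side_integrand_continuous(1)[OF lead_side])

lemma face_cont_mult: "face_cont \<Gamma> g \<Longrightarrow> face_cont \<Gamma> h \<Longrightarrow> face_cont \<Gamma> (\<lambda>x. g x * h x)"
  and face_cont_const: "face_cont \<Gamma> (\<lambda>x. c)"
  and face_cont_abs: "face_cont \<Gamma> g \<Longrightarrow> face_cont \<Gamma> (\<lambda>x. \<bar>g x\<bar>)"
  unfolding face_cont_def by (intro continuous_intros; assumption)+

lemma face_cont_sum: "(\<And>i. i \<in> I \<Longrightarrow> face_cont \<Gamma> (g i)) \<Longrightarrow> face_cont \<Gamma> (\<lambda>x. \<Sum>i\<in>I. g i x)"
  unfolding face_cont_def by (intro continuous_intros)

lemma facet_of_face: "\<Gamma> \<in> faces M \<Longrightarrow> polytope_facet K (snd (lead \<Gamma>))"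
  using lead_side[of \<Gamma>] by (intro facet_locale) (simp add: sides_iff)

text \<open>Its pairing with the image of the reference normal under the Jacobian equals 1.\<close>

lemma conormal_nonzero:
  assumes s: "s \<in> sides M" and y: "y \<in> snd s"
  shows "conormal M s y \<noteq> 0"
proof
  assume 0: "conormal M s y = 0"
  interpret E: curved_element K "emap M (fst s)"
    using element s sides_iff by blast
  interpret F: polytope_facet K "snd s"
    using s by (intro facet_locale) (simp add: sides_iff)
  have yK: "y \<in> K"
    using y F.facet_subset by blast
  have "E.cnormal (snd s) y \<bullet> (E.J y *v ref_normal K (snd s)) = 1"
    unfolding E.cnormal_inner[OF yK] by (simp add: matrix_inv_vector[OF E.J_invertible[OF yK]])
  then show False
    using 0 s by (simp add: conormal_eq sides_iff)
qed

lemma face_normal_image: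
  assumes \<Gamma>: "\<Gamma> \<in> faces M" and y: "y \<in> snd (lead \<Gamma>)"
  shows "face_normal M \<Gamma> (emap M (fst (lead \<Gamma>)) y) = conormal M (lead \<Gamma>) y /\<^sub>R norm (conormal M
      (lead \<Gamma>) y)"
proof -
  interpret E: curved_element K "emap M (fst (lead \<Gamma>))"
    using element lead_side[OF \<Gamma>] sides_iff by blast
  interpret F: polytope_facet K "snd (lead \<Gamma>)"
    by (rule facet_of_face[OF \<Gamma>])
  have "y \<in> K"
    using y F.facet_subset by blast
  then show ?thesis
    by (simp add: face_normal_def Let_def E.Ti_def[symmetric])
qed

lemma face_cont_normal: 
  assumes \<Gamma>: "\<Gamma> \<in> faces M"
  shows "face_cont \<Gamma> (\<lambda>x. e \<bullet> face_normal M \<Gamma> x)"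
proof -
  have "continuous_on (snd (lead \<Gamma>)) (\<lambda>y. e \<bullet> (conormal M (lead \<Gamma>) y /\<^sub>R norm (conormal M (lead \<Gamma>)
      y)))"
    using side_integrand_continuous(3)[OF lead_side[OF \<Gamma>] continuous_on_const] conormal_nonzero[OF
        lead_side[OF \<Gamma>]]
    by (intro continuous_intros) auto
  then show ?thesis
    unfolding face_cont_def
    by (rule continuous_on_cong[THEN iffD1, rotated -1]) (simp_all add: face_normal_image[OF \<Gamma>])
qed

lemma face_integrand_continuous:
  assumes \<Gamma>: "\<Gamma> \<in> faces M" and g: "face_cont \<Gamma> g"
  shows "continuous_on (snd (lead \<Gamma>)) (\<lambda>y. g (emap M (fst (lead \<Gamma>)) y) *
    (\<bar>det (jacobian (emap M (fst (lead \<Gamma>))) (at y))\<bar> * norm (conormal M (lead \<Gamma>) y)))"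
  using g side_integrand_continuous(2,3)[OF lead_side[OF \<Gamma>] continuous_on_const]
  unfolding face_cont_def by (intro continuous_on_mult continuous_on_norm)

lemma face_integral_add:
  assumes "\<Gamma> \<in> faces M" "face_cont \<Gamma> g" "face_cont \<Gamma> h"
  shows "face_integral M \<Gamma> (\<lambda>x. g x + h x) = face_integral M \<Gamma> g + face_integral M \<Gamma> h"
  using polytope_facet.facet_integral_add[OF facet_of_face[OF assms(1)]
      face_integrand_continuous[OF assms(1,2)] face_integrand_continuous[OF assms(1,3)]]
  by (simp add: face_integral_def Let_def distrib_right)

lemma face_integral_cmult:
  assumes "\<Gamma> \<in> faces M"
  shows "face_integral M \<Gamma> (\<lambda>x. c * g x) = c * face_integral M \<Gamma> g"
  using polytope_facet.facet_integral_cmult[OF facet_of_face[OF assms]]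
  by (simp add: face_integral_def Let_def mult.assoc)

lemma face_integral_cong:
  assumes "\<Gamma> \<in> faces M" "\<And>x. x \<in> face_set M \<Gamma> \<Longrightarrow> g x = h x"
  shows "face_integral M \<Gamma> g = face_integral M \<Gamma> h"
  unfolding face_integral_def Let_def
  using assms(2)
  by (intro polytope_facet.facet_integral_cong[OF facet_of_face[OF assms(1)]])
    (auto simp: face_set_def side_set_def)

lemma face_integral_zero:
  assumes "\<Gamma> \<in> faces M" "\<And>x. x \<in> face_set M \<Gamma> \<Longrightarrow> g x = 0"
  shows "face_integral M \<Gamma> g = 0"
  using face_integral_cong[OF assms(1), of g "\<lambda>x. 0 * g x"] face_integral_cmult[OF assms(1), of 0 g]
      assms(2)
  by simp

lemma face_integral_sum:
  assumes \<Gamma>: "\<Gamma> \<in> faces M" and "finite I" "\<And>i. i \<in> I \<Longrightarrow> face_cont \<Gamma> (g i)"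
  shows "face_integral M \<Gamma> (\<lambda>x. \<Sum>i\<in>I. g i x) = (\<Sum>i\<in>I. face_integral M \<Gamma> (g i))"
  using assms(2,3)
proof (induction I rule: finite_induct)
  case empty
  then show ?case
    using face_integral_zero[OF \<Gamma>] by simp
next
  case (insert i I)
  then show ?case
    using face_integral_add[OF \<Gamma>, of "g i" "\<lambda>x. \<Sum>i\<in>I. g i x"] by (simp add: face_cont_sum)
qed

end

section \<open>Coefficient vectors, traces and bilinear forms on the discontinuous space\<close>

locale dg_mesh = mesh M for M :: "(real^'n) mesh" +
  fixes A :: "('n \<Rightarrow> nat) set" and \<phi> :: "'N::finite \<Rightarrow> (real^'n) dgfun"
  assumes basis: "is_basis \<phi> (dg_space A M)"
begin

abbreviation U :: "(real^'n) dgfun set" where "U \<equiv> dg_space A M"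

abbreviation fc :: "real^'N \<Rightarrow> (real^'n) dgfun" where "fc \<equiv> from_coeffs \<phi>"

lemma U_lincomb:
  assumes "u \<in> U" "v \<in> U"
  shows "lincomb a u v \<in> U"
proof -
  have "\<exists>p\<in>polys A. \<forall>y\<in>K. lincomb a u v \<kappa> (emap M \<kappa> y) = p y" if \<kappa>: "\<kappa> \<in> elems M" for \<kappa>
  proof -
    obtain p q where pq: "p \<in> polys A" "\<forall>y\<in>K. u \<kappa> (emap M \<kappa> y) = p y" "q \<in> polys A" "\<forall>y\<in>K. v \<kappa> (emap
        M \<kappa> y) = q y"
      using assms \<kappa> unfolding dg_space_def by blast
    then obtain c d where cd: "p = (\<lambda>x. \<Sum>a\<in>A. c a * monomial a x)" "q = (\<lambda>x. \<Sum>a\<in>A. d a * monomial a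
        x)"
      unfolding polys_def by blast
    have "(\<lambda>x. a * p x + q x) = (\<lambda>x. \<Sum>i\<in>A. (a * c i + d i) * monomial i x)"
      by (simp add: cd sum_distrib_left distrib_right sum.distrib mult.assoc)
    then have "(\<lambda>x. a * p x + q x) \<in> polys A"
      unfolding polys_def mem_Collect_eq by (rule exI[of _ "\<lambda>i. a * c i + d i"])
    then show ?thesis
      using pq by (intro bexI[of _ "\<lambda>x. a * p x + q x"]) (auto simp: lincomb_def)
  qed
  then show ?thesis
    using assms unfolding dg_space_def by (auto simp: lincomb_def)
qed

lemma U_zero: "(\<lambda>\<kappa> x. 0) \<in> U"
proof -
  have "(\<lambda>x. 0) \<in> polys A"
    unfolding polys_def by (auto intro!: exI[of _ "\<lambda>_. 0"])
  then show ?thesis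
    unfolding dg_space_def by auto
qed

lemma basis_U: "\<phi> i \<in> U"
  using basis by (simp add: is_basis_def)

lemma partial_sum_U: "(\<lambda>\<kappa> x. \<Sum>i\<in>I. c $ i * \<phi> i \<kappa> x) \<in> U"
proof (induction I rule: infinite_finite_induct)
  case (insert i I)
  then show ?case
    using U_lincomb[OF basis_U[of i] insert(3), of "c $ i"] by (simp add: lincomb_def)
qed (simp_all add: U_zero)

lemma fc_U: "fc c \<in> U"
  unfolding from_coeffs_def by (rule partial_sum_U)

lemma fc_eq_0: "fc c = (\<lambda>\<kappa> x. 0) \<longleftrightarrow> c = 0"
proof
  assume "fc c = (\<lambda>\<kappa> x. 0)"
  moreover have "fc 0 = (\<lambda>\<kappa> x. 0)"
    by (simp add: from_coeffs_def)
  moreover have "\<exists>!c. (\<lambda>\<kappa> x. 0) = fc c"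
    using basis U_zero unfolding is_basis_def by blast
  ultimately show "c = 0"
    by metis
qed (simp add: from_coeffs_def)

text \<open>The basis expansion is built up one summand at a time. All partial sums lie in the
  space, so bilinearity on the space is enough.\<close>

lemma form_matrix_inner:
  assumes b: "bilinear_on U b"
  shows "d \<bullet> (form_matrix \<phi> b *v c) = b (fc c) (fc d)"
proof -
  have zero: "b (\<lambda>\<kappa> x. 0) v = 0" "b v (\<lambda>\<kappa> x. 0) = 0" if "v \<in> U" for v
  proof -
    have "lincomb 1 (\<lambda>\<kappa> x. 0) (\<lambda>\<kappa> x. 0) = (\<lambda>(\<kappa>::(real^'n) set) (x::real^'n). 0::real)"
      by (simp add: lincomb_def)
    then show "b (\<lambda>\<kappa> x. 0) v = 0" "b v (\<lambda>\<kappa> x. 0) = 0"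
      using b[unfolded bilinear_on_def, rule_format, OF U_zero U_zero that, of 1] by simp_all
  qed
  have step: "(\<lambda>\<kappa> x. \<Sum>i\<in>insert i I. c $ i * \<phi> i \<kappa> x) = lincomb (c $ i) (\<phi> i) (\<lambda>\<kappa> x. \<Sum>i\<in>I. c $ i * \<phi>
      i \<kappa> x)"
    if "finite I" "i \<notin> I" for i I c
    using that by (simp add: lincomb_def)
  have left: "b (\<lambda>\<kappa> x. \<Sum>i\<in>I. c $ i * \<phi> i \<kappa> x) v = (\<Sum>i\<in>I. c $ i * b (\<phi> i) v)" if "finite I" "v \<in> U"
      for I c v
    using that(1)
  proof (induction I rule: finite_induct)
    case (insert i I)
    show ?case
      unfolding step[OF insert(1,2)]
      using b[unfolded bilinear_on_def, rule_format, OF basis_U[of i] partial_sum_U[of c I] that(2),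
          of "c $ i"] insert
      by simp
  qed (simp add: zero that)
  have right: "b v (\<lambda>\<kappa> x. \<Sum>i\<in>I. c $ i * \<phi> i \<kappa> x) = (\<Sum>i\<in>I. c $ i * b v (\<phi> i))" if "finite I" "v \<in> U"
      for I c v
    using that(1)
  proof (induction I rule: finite_induct)
    case (insert i I)
    show ?case
      unfolding step[OF insert(1,2)]
      using b[unfolded bilinear_on_def, rule_format, OF basis_U[of i] partial_sum_U[of c I] that(2),
          of "c $ i"] insert
      by simp
  qed (simp add: zero that)
  have "b (fc c) (fc d) = (\<Sum>i\<in>UNIV. d $ i * (\<Sum>k\<in>UNIV. c $ k * b (\<phi> k) (\<phi> i)))"
    using left[OF finite_class.finite_UNIV basis_U] right[OF finite_class.finite_UNIV fc_U, of c d]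
    by (simp add: from_coeffs_def)
  then show ?thesis
    by (simp add: inner_vec_def matrix_vector_mult_def form_matrix_def mult.commute)
qed

lemma branch:
  assumes "u \<in> U" "\<kappa> \<in> elems M"
  obtains p where "C1_fun p" "\<And>y. y \<in> K \<Longrightarrow> u \<kappa> (emap M \<kappa> y) = p y"
  using assms C1_fun_polys unfolding dg_space_def by blast

lemma branch_continuous:
  assumes "u \<in> U" "\<kappa> \<in> elems M"
  shows "continuous_on \<kappa> (u \<kappa>)"
proof -
  obtain p where "C1_fun p" "\<And>y. y \<in> K \<Longrightarrow> u \<kappa> (emap M \<kappa> y) = p y"
    using branch[OF assms] by blast
  then show ?thesis
    using curved_element.pullback_continuous[OF element[OF assms(2)]] elem_image[OF assms(2)] by
        metis
qed

lemma branch_continuous_side: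
  assumes u: "u \<in> U" and \<Gamma>: "\<Gamma> \<in> faces M" and s: "s \<in> set_face \<Gamma>"
  shows "continuous_on (face_set M \<Gamma>) (u (fst s))"
proof -
  have sM: "s \<in> sides M"
    using face_sides[OF \<Gamma>] s by blast
  have "face_set M \<Gamma> = side_set M s"
    using s \<Gamma> interior_face(4) by (cases \<Gamma>) (auto simp: face_set_def)
  then have "face_set M \<Gamma> \<subseteq> fst s"
    using side_set_subset[OF sM] by simp
  then show ?thesis
    using branch_continuous[OF u] sM by (auto simp: sides_iff intro: continuous_on_subset)
qed

lemma jump_cont:
  assumes "u \<in> U" "\<Gamma> \<in> faces M"
  shows "continuous_on (face_set M \<Gamma>) (jump u \<Gamma>)" "continuous_on (face_set M \<Gamma>) (average u \<Gamma>)"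
proof -
  have "continuous_on (face_set M \<Gamma>) (jump u \<Gamma>) \<and> continuous_on (face_set M \<Gamma>) (average u \<Gamma>)"
  proof (cases \<Gamma>)
    case (Boundary s)
    then show ?thesis
      using branch_continuous_side[OF assms, of s] by (simp add: jump.simps[abs_def]
          average.simps[abs_def] fun_eq_iff cong: continuous_on_cong)
  next
    case (Interior s s')
    then have "continuous_on (face_set M \<Gamma>) (u (fst s))" "continuous_on (face_set M \<Gamma>) (u (fst s'))"
      using branch_continuous_side[OF assms] by simp_all
    then have "continuous_on (face_set M \<Gamma>) (\<lambda>x. u (fst s) x - u (fst s') x)"
      "continuous_on (face_set M \<Gamma>) (\<lambda>x. (u (fst s) x + u (fst s') x) / 2)"
      by (intro continuous_intros; simp)+
    then show ?thesis
      by (simp add: Interior cong: continuous_on_cong)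
  qed
  then show "continuous_on (face_set M \<Gamma>) (jump u \<Gamma>)" "continuous_on (face_set M \<Gamma>) (average u \<Gamma>)"
    by auto
qed

text \<open>The common features of \<open>jump\<close> and \<open>average\<close>, so that the
  bilinearity of all face forms follows from one lemma.\<close>

definition trace :: "((real^'n) dgfun \<Rightarrow> (real^'n) side face \<Rightarrow> real^'n \<Rightarrow> real) \<Rightarrow> bool" where
  "trace t \<longleftrightarrow> (\<forall>a u v \<Gamma> x. t (lincomb a u v) \<Gamma> x = a * t u \<Gamma> x + t v \<Gamma> x) \<and>
     (\<forall>u\<in>U. \<forall>\<Gamma>\<in>faces M. face_cont \<Gamma> (t u \<Gamma>))"

lemma trace_jump: "trace jump" and trace_average: "trace average"
  unfolding trace_def using jump_lincomb average_lincomb jump_cont face_contI by blast+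

lemma face_form_bilinear:
  assumes k: "\<And>\<Gamma>. \<Gamma> \<in> faces M \<Longrightarrow> face_cont \<Gamma> (k \<Gamma>)" and t: "trace t1" "trace t2"
  shows "bilinear_on U (\<lambda>u v. \<Sum>\<Gamma>\<in>faces M. face_integral M \<Gamma> (\<lambda>x. k \<Gamma> x * t1 u \<Gamma> x * t2 v \<Gamma> x))"
proof (rule bilinear_on_sum)
  fix \<Gamma> assume \<Gamma>: "\<Gamma> \<in> faces M"
  have lin: "t1 (lincomb a u v) \<Gamma> x = a * t1 u \<Gamma> x + t1 v \<Gamma> x" "t2 (lincomb a u v) \<Gamma> x = a * t2 u \<Gamma>
      x + t2 v \<Gamma> x" for a u v x
    using t by (auto simp: trace_def)
  have cont: "face_cont \<Gamma> (\<lambda>x. k \<Gamma> x * t1 u \<Gamma> x * t2 v \<Gamma> x)" if "u \<in> U" "v \<in> U" for u v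
    using that t \<Gamma> k by (auto simp: trace_def intro!: face_cont_mult)
  have combine: "face_integral M \<Gamma> (\<lambda>x. a * g x + h x) = a * face_integral M \<Gamma> g + face_integral M \<Gamma>
      h"
    if "face_cont \<Gamma> g" "face_cont \<Gamma> h" for a g h
    using face_integral_add[OF \<Gamma> face_cont_mult[OF face_cont_const[of _ a] that(1)] that(2)]
    by (simp add: face_integral_cmult[OF \<Gamma>])
  show "bilinear_on U (\<lambda>u v. face_integral M \<Gamma> (\<lambda>x. k \<Gamma> x * t1 u \<Gamma> x * t2 v \<Gamma> x))"
    unfolding bilinear_on_def
  proof (intro allI ballI conjI)
    fix a u u' v assume u: "u \<in> U" "u' \<in> U" "v \<in> U"
    have "(\<lambda>x. k \<Gamma> x * t1 (lincomb a u u') \<Gamma> x * t2 v \<Gamma> x)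
      = (\<lambda>x. a * (k \<Gamma> x * t1 u \<Gamma> x * t2 v \<Gamma> x) + k \<Gamma> x * t1 u' \<Gamma> x * t2 v \<Gamma> x)"
      by (simp add: lin algebra_simps)
    then show "face_integral M \<Gamma> (\<lambda>x. k \<Gamma> x * t1 (lincomb a u u') \<Gamma> x * t2 v \<Gamma> x) =
       a * face_integral M \<Gamma> (\<lambda>x. k \<Gamma> x * t1 u \<Gamma> x * t2 v \<Gamma> x) + face_integral M \<Gamma> (\<lambda>x. k \<Gamma> x * t1
           u' \<Gamma> x * t2 v \<Gamma> x)"
      using combine[OF cont[OF u(1,3)] cont[OF u(2,3)]] by simp
    have "(\<lambda>x. k \<Gamma> x * t1 v \<Gamma> x * t2 (lincomb a u u') \<Gamma> x)
      = (\<lambda>x. a * (k \<Gamma> x * t1 v \<Gamma> x * t2 u \<Gamma> x) + k \<Gamma> x * t1 v \<Gamma> x * t2 u' \<Gamma> x)"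
      by (simp add: lin algebra_simps)
    then show "face_integral M \<Gamma> (\<lambda>x. k \<Gamma> x * t1 v \<Gamma> x * t2 (lincomb a u u') \<Gamma> x) =
       a * face_integral M \<Gamma> (\<lambda>x. k \<Gamma> x * t1 v \<Gamma> x * t2 u \<Gamma> x) + face_integral M \<Gamma> (\<lambda>x. k \<Gamma> x * t1 v
           \<Gamma> x * t2 u' \<Gamma> x)"
      using combine[OF cont[OF u(3,1)] cont[OF u(3,2)]] by simp
  qed
qed

definition grad_form :: "real^'n \<Rightarrow> (real^'n) dgfun \<Rightarrow> (real^'n) dgfun \<Rightarrow> real" where
  "grad_form e u v = (\<Sum>\<kappa>\<in>elems M. integral \<kappa> (\<lambda>x. frechet_derivative (u \<kappa>) (at x) e * v \<kappa> x))"

lemma branch_gradient: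
  assumes u: "u \<in> U" and \<kappa>: "\<kappa> \<in> elems M"
  obtains g where "continuous_on \<kappa> g" "\<And>y. y \<in> interior K \<Longrightarrow> u \<kappa> differentiable (at (emap M \<kappa> y))"
    "\<And>y. y \<in> interior K \<Longrightarrow> frechet_derivative (u \<kappa>) (at (emap M \<kappa> y)) e = g (emap M \<kappa> y)"
proof -
  note goal = that
  obtain p where p: "C1_fun p" "\<And>y. y \<in> K \<Longrightarrow> u \<kappa> (emap M \<kappa> y) = p y"
    using branch[OF u \<kappa>] by blast
  show ?thesis
  proof (rule elem_gradient[OF \<kappa> p(1), of "u \<kappa>" e])
    show "u \<kappa> (emap M \<kappa> y) = p y" if "y \<in> K" for y
      using that by (rule p(2))
    show thesis if "continuous_on \<kappa> g" "\<And>y. y \<in> interior K \<Longrightarrow> u \<kappa> differentiable (at (emap M \<kappa> y))"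
      "\<And>y. y \<in> interior K \<Longrightarrow> frechet_derivative (u \<kappa>) (at (emap M \<kappa> y)) e = g (emap M \<kappa> y)" for g
      by (rule goal[OF that])
  qed
qed

lemma branch_differentiable:
  assumes "u \<in> U" "\<kappa> \<in> elems M" "y \<in> interior K"
  shows "u \<kappa> differentiable (at (emap M \<kappa> y))"
proof -
  obtain g :: "real^'n \<Rightarrow> real" where "\<And>y. y \<in> interior K \<Longrightarrow> u \<kappa> differentiable (at (emap M \<kappa> y))"
    by (rule branch_gradient[OF assms(1,2), where e = 0]) blast
  then show ?thesis
    using assms(3) by blast
qed

lemma grad_integrable:
  assumes u: "u \<in> U" and v: "v \<in> U" and \<kappa>: "\<kappa> \<in> elems M"
  shows "(\<lambda>x. frechet_derivative (u \<kappa>) (at x) e * v \<kappa> x) integrable_on \<kappa>"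
proof -
  obtain g where g: "continuous_on \<kappa> g"
    "\<And>y. y \<in> interior K \<Longrightarrow> frechet_derivative (u \<kappa>) (at (emap M \<kappa> y)) e = g (emap M \<kappa> y)"
    using branch_gradient[OF u \<kappa>] by metis
  have "continuous_on (emap M \<kappa> ` K) (\<lambda>x. g x * v \<kappa> x)"
    unfolding elem_image[OF \<kappa>] by (intro continuous_intros g(1) branch_continuous v \<kappa>)
  from curved_element.integrable_eq_interior[OF element[OF \<kappa>] this,
      of "\<lambda>x. frechet_derivative (u \<kappa>) (at x) e * v \<kappa> x"]
  show ?thesis
    by (simp add: g(2) elem_image[OF \<kappa>])
qed

lemma grad_form_bilinear: "bilinear_on U (grad_form e)"
  unfolding grad_form_def
proof (rule bilinear_on_sum)
  fix \<kappa> assume \<kappa>: "\<kappa> \<in> elems M"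
  interpret E: curved_element K "emap M \<kappa>"
    by (rule element[OF \<kappa>])
  show "bilinear_on U (\<lambda>u v. integral \<kappa> (\<lambda>x. frechet_derivative (u \<kappa>) (at x) e * v \<kappa> x))"
    unfolding bilinear_on_def
  proof (intro allI ballI conjI)
    fix a u u' v assume u: "u \<in> U" "u' \<in> U" "v \<in> U"
    have fd: "frechet_derivative (lincomb a u u' \<kappa>) (at (emap M \<kappa> y)) e =
       a * frechet_derivative (u \<kappa>) (at (emap M \<kappa> y)) e + frechet_derivative (u' \<kappa>) (at (emap M \<kappa>
           y)) e"
      if y: "y \<in> interior K" for y
    proof -
      have "u \<kappa> differentiable (at (emap M \<kappa> y))" "u' \<kappa> differentiable (at (emap M \<kappa> y))"
        by (rule branch_differentiable[OF u(1) \<kappa> y] branch_differentiable[OF u(2) \<kappa> y])+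
      then have "((\<lambda>x. a * u \<kappa> x + u' \<kappa> x) has_derivative (\<lambda>v. a * frechet_derivative (u \<kappa>) (at
          (emap M \<kappa> y)) v +
          frechet_derivative (u' \<kappa>) (at (emap M \<kappa> y)) v)) (at (emap M \<kappa> y))"
        unfolding frechet_derivative_works by (intro has_derivative_add has_derivative_mult_right)
      from frechet_derivative_at[OF this] show ?thesis
        by (simp add: lincomb_def) (metis)
    qed
    have "integral \<kappa> (\<lambda>x. frechet_derivative (lincomb a u u' \<kappa>) (at x) e * v \<kappa> x)
      = integral \<kappa> (\<lambda>x. a * (frechet_derivative (u \<kappa>) (at x) e * v \<kappa> x) + frechet_derivative (u' \<kappa>)
          (at x) e * v \<kappa> x)"
      using E.integral_eq_interior[of "\<lambda>x. frechet_derivative (lincomb a u u' \<kappa>) (at x) e * v \<kappa> x"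
          "\<lambda>x. a * (frechet_derivative (u \<kappa>) (at x) e * v \<kappa> x) + frechet_derivative (u' \<kappa>) (at x) e
              * v \<kappa> x"]
      unfolding elem_image[OF \<kappa>] by (simp add: fd algebra_simps)
    also have "\<dots> = a * integral \<kappa> (\<lambda>x. frechet_derivative (u \<kappa>) (at x) e * v \<kappa> x) + integral \<kappa> (\<lambda>x.
        frechet_derivative (u' \<kappa>) (at x) e * v \<kappa> x)"
      using grad_integrable[OF u(1,3) \<kappa>] grad_integrable[OF u(2,3) \<kappa>]
      by (simp add: Henstock_Kurzweil_Integration.integral_add integrable_on_mult_right)
    finally show "integral \<kappa> (\<lambda>x. frechet_derivative (lincomb a u u' \<kappa>) (at x) e * v \<kappa> x) = \<dots>" .
    have "integral \<kappa> (\<lambda>x. frechet_derivative (v \<kappa>) (at x) e * lincomb a u u' \<kappa> x)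
      = integral \<kappa> (\<lambda>x. a * (frechet_derivative (v \<kappa>) (at x) e * u \<kappa> x) + frechet_derivative (v \<kappa>)
          (at x) e * u' \<kappa> x)"
      by (simp add: lincomb_def algebra_simps)
    also have "\<dots> = a * integral \<kappa> (\<lambda>x. frechet_derivative (v \<kappa>) (at x) e * u \<kappa> x) + integral \<kappa> (\<lambda>x.
        frechet_derivative (v \<kappa>) (at x) e * u' \<kappa> x)"
      using grad_integrable[OF u(3,1) \<kappa>] grad_integrable[OF u(3,2) \<kappa>]
      by (simp add: Henstock_Kurzweil_Integration.integral_add integrable_on_mult_right)
    finally show "integral \<kappa> (\<lambda>x. frechet_derivative (v \<kappa>) (at x) e * lincomb a u u' \<kappa> x) = \<dots>" .
  qed
qed

lemma vanishing_traces:
  assumes v: "continuous_vanishing M v" and \<Gamma>: "\<Gamma> \<in> faces M" and x: "x \<in> face_set M \<Gamma>"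
  shows "jump v \<Gamma> x = 0"
    and "\<Gamma> = Boundary s \<Longrightarrow> v (fst s) x = 0"
    and "s \<in> set_face \<Gamma> \<Longrightarrow> average v \<Gamma> x = v (fst s) x"
proof -
  obtain w where w: "\<And>\<kappa> x. \<kappa> \<in> elems M \<Longrightarrow> x \<in> \<kappa> \<Longrightarrow> v \<kappa> x = w x" "\<And>x. x \<in> frontier (dom M) \<Longrightarrow> w x = 0"
    using v unfolding continuous_vanishing_def by blast
  have vw: "v (fst s) x = w x" if s: "s \<in> set_face \<Gamma>" for s
  proof -
    have sM: "s \<in> sides M"
      using face_sides[OF \<Gamma>] s by blast
    have "face_set M \<Gamma> = side_set M s"
      using s \<Gamma> interior_face(4) by (cases \<Gamma>) (auto simp: face_set_def)
    then have "x \<in> fst s"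
      using side_set_subset[OF sM] x by blast
    then show ?thesis
      using sM w(1) by (simp add: sides_iff)
  qed
  show b: "v (fst s) x = 0" if "\<Gamma> = Boundary s" for s
  proof -
    have "x \<in> frontier (dom M)"
      unfolding frontier_dom using that x \<Gamma> by (intro UN_I[of s]) (simp_all add: face_set_def)
    then show ?thesis
      using vw[of s] w(2) that by simp
  qed
  show "jump v \<Gamma> x = 0"
    using b vw by (cases \<Gamma>) auto
  show "average v \<Gamma> x = v (fst s) x" if "s \<in> set_face \<Gamma>"
    using vw that by (cases \<Gamma>) auto
qed

text \<open>The divergence theorem is applied to u v on every element and the sides are regrouped by
  faces. On an interior face the two normals are opposite and \<open>v\<close> equals its average
  from both sides, so the jump of \<open>u\<close> remains; on boundary faces \<open>v\<close>
  vanishes.\<close>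

lemma integration_by_parts:
  assumes u: "u \<in> U" and v: "v \<in> U" "continuous_vanishing M v"
  shows "grad_form e u v + grad_form e v u =
    (\<Sum>\<Gamma>\<in>faces M. face_integral M \<Gamma> (\<lambda>x. (e \<bullet> face_normal M \<Gamma> x) * jump u \<Gamma> x * average v \<Gamma> x))"
proof -
  define F where "F = (\<lambda>s. side_integral M s (\<lambda>x. u (fst s) x * v (fst s) x) e)"
  have "integral \<kappa> (\<lambda>x. frechet_derivative (u \<kappa>) (at x) e * v \<kappa> x) + integral \<kappa> (\<lambda>x.
      frechet_derivative (v \<kappa>) (at x) e * u \<kappa> x)
    = (\<Sum>f\<in>{f. f facet_of K}. F (\<kappa>, f))" if \<kappa>: "\<kappa> \<in> elems M" for \<kappa>
  proof -
    interpret E: curved_element K "emap M \<kappa>"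
      by (rule element[OF \<kappa>])
    obtain p q where pq: "C1_fun p" "\<And>y. y \<in> K \<Longrightarrow> u \<kappa> (emap M \<kappa> y) = p y"
      "C1_fun q" "\<And>y. y \<in> K \<Longrightarrow> v \<kappa> (emap M \<kappa> y) = q y"
      using branch[OF u \<kappa>] branch[OF v(1) \<kappa>] by metis
    obtain g where g: "continuous_on \<kappa> g"
      "\<And>y. y \<in> interior K \<Longrightarrow> frechet_derivative (\<lambda>x. u \<kappa> x * v \<kappa> x) (at (emap M \<kappa> y)) e = g (emap M \<kappa>
          y)"
      "integral \<kappa> g = (\<Sum>f\<in>{f. f facet_of K}. side_integral M (\<kappa>, f) (\<lambda>x. u \<kappa> x * v \<kappa> x) e)"
      by (rule elem_gradient[OF \<kappa> C1_fun_mult[OF pq(1,3)], of "\<lambda>x. u \<kappa> x * v \<kappa> x" e]) (use pq in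
          auto)
    have fd: "g (emap M \<kappa> y) = frechet_derivative (u \<kappa>) (at (emap M \<kappa> y)) e * v \<kappa> (emap M \<kappa> y)
       + frechet_derivative (v \<kappa>) (at (emap M \<kappa> y)) e * u \<kappa> (emap M \<kappa> y)" if y: "y \<in> interior K" for
           y
    proof -
      have "u \<kappa> differentiable (at (emap M \<kappa> y))" "v \<kappa> differentiable (at (emap M \<kappa> y))"
        by (rule branch_differentiable[OF u \<kappa> y] branch_differentiable[OF v(1) \<kappa> y])+
      then have "((\<lambda>x. u \<kappa> x * v \<kappa> x) has_derivative (\<lambda>h. u \<kappa> (emap M \<kappa> y) * frechet_derivative (v
          \<kappa>) (at (emap M \<kappa> y)) h +
          frechet_derivative (u \<kappa>) (at (emap M \<kappa> y)) h * v \<kappa> (emap M \<kappa> y))) (at (emap M \<kappa> y))"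
        unfolding frechet_derivative_works by (rule has_derivative_mult)
      from fun_cong[OF frechet_derivative_at[OF this], of e] g(2)[OF y] show ?thesis
        by (simp add: mult.commute)
    qed
    have "integral \<kappa> (\<lambda>x. frechet_derivative (u \<kappa>) (at x) e * v \<kappa> x) + integral \<kappa> (\<lambda>x.
        frechet_derivative (v \<kappa>) (at x) e * u \<kappa> x)
      = integral \<kappa> (\<lambda>x. frechet_derivative (u \<kappa>) (at x) e * v \<kappa> x + frechet_derivative (v \<kappa>) (at x)
          e * u \<kappa> x)"
      by (rule Henstock_Kurzweil_Integration.integral_add[symmetric]) (intro grad_integrable u v \<kappa>)+
    also have "\<dots> = integral \<kappa> g"
      using E.integral_eq_interior[of "\<lambda>x. frechet_derivative (u \<kappa>) (at x) e * v \<kappa> x +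
          frechet_derivative (v \<kappa>) (at x) e * u \<kappa> x" g]
      unfolding elem_image[OF \<kappa>] by (simp add: fd)
    finally show ?thesis
      by (simp add: g(3) F_def)
  qed
  then have "grad_form e u v + grad_form e v u = (\<Sum>\<kappa>\<in>elems M. \<Sum>f\<in>{f. f facet_of K}. F (\<kappa>, f))"
    by (simp add: grad_form_def sum.distrib[symmetric])
  also have "\<dots> = (\<Sum>\<Gamma>\<in>faces M. \<Sum>s\<in>set_face \<Gamma>. F s)"
    by (simp add: sum_elems_sides sum_sides)
  also have "\<dots> = (\<Sum>\<Gamma>\<in>faces M. face_integral M \<Gamma> (\<lambda>x. (e \<bullet> face_normal M \<Gamma> x) * jump u \<Gamma> x * average
      v \<Gamma> x))"
  proof (rule sum.cong[OF refl])
    fix \<Gamma> assume \<Gamma>: "\<Gamma> \<in> faces M"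
    have fi: "face_integral M \<Gamma> (\<lambda>x. (e \<bullet> face_normal M \<Gamma> x) * jump u \<Gamma> x * average v \<Gamma> x)
      = side_integral M (lead \<Gamma>) (\<lambda>x. jump u \<Gamma> x * average v \<Gamma> x) e"
      using face_integral_normal[OF \<Gamma>, of e "\<lambda>x. jump u \<Gamma> x * average v \<Gamma> x"] by (simp add:
          mult.assoc)
    note tr = vanishing_traces[OF v(2) \<Gamma>]
    show "(\<Sum>s\<in>set_face \<Gamma>. F s) = face_integral M \<Gamma> (\<lambda>x. (e \<bullet> face_normal M \<Gamma> x) * jump u \<Gamma> x *
        average v \<Gamma> x)"
    proof (cases \<Gamma>)
      case (Boundary s)
      have sM: "s \<in> sides M"
        using face_sides[OF \<Gamma>] Boundary by simp
      have 0: "v (fst s) x = 0" if "x \<in> side_set M s" for x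
        using tr(2)[of x s] that Boundary by (simp add: face_set_def)
      have "F s = 0"
        unfolding F_def by (rule side_integral_0[OF sM]) (simp add: 0)
      moreover have "side_integral M s (\<lambda>x. jump u \<Gamma> x * average v \<Gamma> x) e = 0"
        by (rule side_integral_0[OF sM]) (simp add: 0 Boundary)
      ultimately show ?thesis
        unfolding fi by (simp add: Boundary)
    next
      case (Interior s s')
      note I = interior_face[OF \<Gamma>[unfolded Interior]]
      have fs: "face_set M \<Gamma> = side_set M s"
        by (simp add: Interior face_set_def)
      have av: "v (fst s) x = average v \<Gamma> x" "v (fst s') x = average v \<Gamma> x" if "x \<in> side_set M s"
          for x
      proof -
        have x: "x \<in> face_set M \<Gamma>"
          using that fs by simp
        show "v (fst s) x = average v \<Gamma> x" "v (fst s') x = average v \<Gamma> x"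
          by (rule tr(3)[OF x, symmetric], simp add: Interior)+
      qed
      have cu: "continuous_on (side_set M s) (u (fst s))" "continuous_on (side_set M s) (u (fst
          s'))"
        unfolding fs[symmetric] by (rule branch_continuous_side[OF u \<Gamma>], simp add: Interior)+
      have ca: "continuous_on (side_set M s) (average v \<Gamma>)"
        using jump_cont(2)[OF v(1) \<Gamma>] by (simp add: fs)
      have "F s' = side_integral M s' (\<lambda>x. u (fst s') x * average v \<Gamma> x) e"
        unfolding F_def by (rule side_integral_cong[OF I(2)]) (simp add: av I(4))
      also have "\<dots> = - side_integral M s (\<lambda>x. u (fst s') x * average v \<Gamma> x) e"
        by (intro side_integral_opposite \<Gamma>[unfolded Interior] continuous_intros cu ca)
      finally have 1: "F s' = - side_integral M s (\<lambda>x. u (fst s') x * average v \<Gamma> x) e" .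
      have 2: "F s = side_integral M s (\<lambda>x. u (fst s) x * average v \<Gamma> x) e"
        unfolding F_def by (rule side_integral_cong[OF I(1)]) (simp add: av)
      have "side_integral M s (\<lambda>x. jump u \<Gamma> x * average v \<Gamma> x) e
        = side_integral M s (\<lambda>x. u (fst s) x * average v \<Gamma> x - u (fst s') x * average v \<Gamma> x) e"
        by (rule side_integral_cong[OF I(1)]) (simp only: Interior jump.simps left_diff_distrib)
      also have "\<dots> = F s + F s'"
        unfolding 1 2 by (subst side_integral_diff[OF I(1)]) (auto intro!: continuous_intros cu ca)
      finally have "side_integral M s (\<lambda>x. jump u \<Gamma> x * average v \<Gamma> x) e = F s + F s'" .
      moreover have "s \<noteq> s'"
        using I(3) by blast
      then have "(\<Sum>s\<in>set_face \<Gamma>. F s) = F s + F s'"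
        by (simp add: Interior)
      moreover have "lead \<Gamma> = s"
        by (simp add: Interior)
      ultimately show ?thesis
        unfolding fi by (simp only:)
    qed
  qed
  finally show ?thesis .
qed

end

section \<open>Functions with vanishing jumps\<close>

lemma negligible_support_of_zero_integral:
  fixes f :: "'a::euclidean_space \<Rightarrow> real"
  assumes f: "f absolutely_integrable_on S" and nonneg: "\<And>x. x \<in> S \<Longrightarrow> 0 \<le> f x" and 0: "integral S f =
      0"
  shows "negligible {x \<in> S. f x \<noteq> 0}"
proof -
  have int: "integrable lebesgue (\<lambda>x. indicator S x *\<^sub>R f x)"
    using f by (simp add: set_integrable_def)
  have "(LINT x:S|lebesgue. f x) = 0"
    using set_lebesgue_integral_eq_integral(2)[OF f] 0 by simp
  then have "integral\<^sup>L lebesgue (\<lambda>x. indicator S x *\<^sub>R f x) = 0"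
    by (simp add: set_lebesgue_integral_def)
  moreover have "AE x in lebesgue. 0 \<le> indicator S x *\<^sub>R f x"
    using nonneg by (intro AE_I2) (auto simp: indicator_def)
  ultimately have "AE x in lebesgue. indicator S x *\<^sub>R f x = 0"
    using integral_nonneg_eq_0_iff_AE[OF int] by blast
  then obtain N where N: "\<And>x. x \<in> space lebesgue - N \<Longrightarrow> indicator S x *\<^sub>R f x = 0" "N \<in> null_sets
      lebesgue"
    by (elim AE_E3) metis
  have "{x \<in> S. f x \<noteq> 0} \<subseteq> N"
    using N(1) by force
  then show ?thesis
    using N(2) negligible_subset negligible_iff_null_sets by metis
qed

lemma zero_integral_imp_zero_on_interior:
  fixes f :: "'a::euclidean_space \<Rightarrow> real"
  assumes S: "compact S" and f: "continuous_on S f" and nonneg: "\<And>x. x \<in> S \<Longrightarrow> 0 \<le> f x"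
    and 0: "integral S f = 0" and x: "x \<in> interior S"
  shows "f x = 0"
proof (rule ccontr)
  assume nz: "f x \<noteq> 0"
  have "open (interior S \<inter> f -` (- {0}))"
    by (rule continuous_open_preimage[OF continuous_on_subset[OF f interior_subset]]) auto
  then have "open {x \<in> interior S. f x \<in> - {0}}"
    by (simp add: vimage_def Int_def)
  moreover have "negligible {x \<in> interior S. f x \<in> - {0}}"
    using negligible_support_of_zero_integral[OF absolutely_integrable_continuous_compact[OF S f]
        nonneg 0]
    by (rule negligible_subset) (use interior_subset in auto)
  moreover have "x \<in> {x \<in> interior S. f x \<in> - {0}}"
    using x nz by simp
  ultimately show False
    using open_not_negligible by blast
qed

text \<open>The integrand vanishes in the interior of the cylinder, which contains points above
  every relative interior point of the facet; the rest of the facet follows by density and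
  continuity.\<close>

lemma (in polytope_facet) facet_integral_zero:
  assumes q: "continuous_on f q" and nonneg: "\<And>y. y \<in> f \<Longrightarrow> 0 \<le> q y"
    and 0: "facet_integral f (ref_normal K f) q = 0" and y: "y \<in> f"
  shows "q y = 0"
proof -
  have rel: "q y = 0" if y: "y \<in> rel_interior f" for y
  proof -
    \<comment> \<open>Half the height of the cylinder, hence away from its top and bottom.\<close>
    define z where "z = y + (1 / 2) *\<^sub>R ref_normal K f"
    have yi: "y \<in> facet_interior" and yf: "y \<in> f"
      using y rel_interior_subset_facet_interior rel_interior_subset by blast+
    have gz: "gap K f z = - (1 / 2)"
      using yf by (simp add: z_def gap_add mem_facet)
    have fz: "foot K f z = y"
      by (simp add: foot_def gz) (simp add: z_def)
    let ?V = "(\<Inter>f'\<in>{f'. f' facet_of K} - {f}. {z. 0 < gap K f' (foot K f z)}) \<inter> {z. 0 < - gap K f z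
        \<and> - gap K f z < 1}"
    have cf: "continuous_on UNIV (\<lambda>z. gap K f' (foot K f z))" for f'
      unfolding gap_def by (intro continuous_intros continuous_foot)
    have "open ?V"
      using finite_facets cf
      by (intro open_Int open_INT ballI open_Collect_conj open_Collect_less continuous_intros) auto
    moreover have "?V \<subseteq> cylinder K f"
    proof
      fix u assume u: "u \<in> ?V"
      have "0 \<le> gap K f' (foot K f u)" if "f' facet_of K" for f'
        using u that by (cases "f' = f") (auto intro: less_imp_le)
      then have "foot K f u \<in> f"
        by (simp add: mem_facet mem_iff_gaps)
      then show "u \<in> cylinder K f"
        using u by (simp add: mem_cylinder)
    qed
    moreover have "z \<in> ?V"
      using yi by (auto simp: fz gz facet_interior_def)
    ultimately have "z \<in> interior (cylinder K f)"
      by (meson interior_maximal subsetD)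
    then have "q (foot K f z) = 0"
      using 0 nonneg foot_cylinder unfolding facet_integral_eq
      by (intro zero_integral_imp_zero_on_interior[OF compact_cylinder facet_integrand_continuous[OF
          q]]) auto
    then show ?thesis
      by (simp add: fz)
  qed
  have "closure (rel_interior f) = f"
    using convex_closure_rel_interior[OF facet_convex] facet_compact by (simp add:
        compact_imp_closed)
  then show ?thesis
    using continuous_constant_on_closure[of "rel_interior f" q 0 y] q rel y by simp
qed

text \<open>Squaring the positive part makes the function continuously differentiable with an
  explicit quadratic Taylor error. It depends only on y - z, so moving the centre amounts to moving
  the argument.\<close>

definition bump :: "real \<Rightarrow> 'a::real_inner \<Rightarrow> 'a \<Rightarrow> real" where
  "bump \<delta> z y = (max 0 (\<delta>\<^sup>2 - (y - z) \<bullet> (y - z)))\<^sup>2"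

definition bump_grad :: "real \<Rightarrow> 'a::real_inner \<Rightarrow> 'a \<Rightarrow> 'a" where
  "bump_grad \<delta> z y = (- 4 * max 0 (\<delta>\<^sup>2 - (y - z) \<bullet> (y - z))) *\<^sub>R (y - z)"

lemma bump_nonneg: "0 \<le> bump \<delta> z y"
  by (simp add: bump_def)

lemma bump_shift: "bump \<delta> (z + v) y = bump \<delta> z (y - v)"
  by (simp add: bump_def diff_diff_eq2 diff_diff_add add.commute)

lemma bump_eq_0: "0 < \<delta> \<Longrightarrow> y \<notin> ball z \<delta> \<Longrightarrow> bump \<delta> z y = 0"
proof -
  assume "0 < \<delta>" "y \<notin> ball z \<delta>"
  then have "\<delta>\<^sup>2 \<le> (norm (y - z))\<^sup>2"
    by (intro power_mono) (auto simp: dist_norm norm_minus_commute)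
  then show ?thesis
    by (simp add: bump_def power2_norm_eq_inner)
qed

lemma bump_center: "0 < \<delta> \<Longrightarrow> bump \<delta> z z > 0"
  by (simp add: bump_def)

lemma continuous_bump: "continuous_on S (bump \<delta> z)" "continuous_on S (bump_grad \<delta> z)"
  unfolding bump_def bump_grad_def by (intro continuous_intros)+

text \<open>The squared positive part differs from its linearization by at most the square of the
  increment s. Here s contains a further term of second order in v, which accounts for 2 \<delta>^2,
  and norm v \<le> 1 turns the bound on s into one proportional to norm v.\<close>

lemma bump_taylor:
  assumes r: "norm (y - z) \<le> r" and v: "norm v \<le> 1"
  shows "\<bar>bump \<delta> z (y + v) - bump \<delta> z y - bump_grad \<delta> z y \<bullet> v\<bar> \<le> (2 * \<delta>\<^sup>2 + (2 * r + 1)\<^sup>2) * (norm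
      v)\<^sup>2"
proof -
  define t where "t = \<delta>\<^sup>2 - (y - z) \<bullet> (y - z)"
  define s where "s = - 2 * ((y - z) \<bullet> v) - v \<bullet> v"
  have ts: "\<delta>\<^sup>2 - (y + v - z) \<bullet> (y + v - z) = t + s"
    by (simp add: t_def s_def inner_diff_left inner_diff_right inner_add_left inner_add_right
        inner_commute)
  have quad: "\<bar>(max 0 (t + s))\<^sup>2 - (max 0 t)\<^sup>2 - 2 * max 0 t * s\<bar> \<le> s\<^sup>2"
  proof -
    consider "0 \<le> t" "0 \<le> t + s" | "t \<le> 0" "t + s \<le> 0" | "0 \<le> t" "t + s \<le> 0" | "t \<le> 0" "0 \<le> t + s"
      by linarith
    then show ?thesis
    proof cases
      case 1
      then show ?thesis
        by (simp add: power2_eq_square algebra_simps)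
    next
      case 2
      then show ?thesis
        by simp
    next
      case 3
      then have "(- t - 2 * s) * t \<le> s\<^sup>2" "0 \<le> (- t - 2 * s) * t"
      proof -
        have "s\<^sup>2 - (- t - 2 * s) * t = (s + t)\<^sup>2"
          by (simp add: power2_eq_square algebra_simps)
        then show "(- t - 2 * s) * t \<le> s\<^sup>2"
          using zero_le_power2[of "s + t"] by linarith
        show "0 \<le> (- t - 2 * s) * t"
          using 3 by (intro mult_nonneg_nonneg) auto
      qed
      then show ?thesis
        using 3 by (simp add: power2_eq_square algebra_simps)
    next
      case 4
      then have "(t + s)\<^sup>2 \<le> s\<^sup>2"
        by (intro power_mono) auto
      then show ?thesis
        using 4 by simp
    qed
  qed
  have "\<bar>s\<bar> \<le> 2 * \<bar>(y - z) \<bullet> v\<bar> + v \<bullet> v"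
    using inner_ge_zero[of v] by (simp add: s_def abs_le_iff abs_if)
  also have "\<dots> \<le> 2 * (r * norm v) + norm v * norm v"
    using Cauchy_Schwarz_ineq2[of "y - z" v] mult_right_mono[OF r norm_ge_zero[of v]]
    by (simp add: power2_norm_eq_inner[symmetric] power2_eq_square)
  also have "\<dots> \<le> (2 * r + 1) * norm v"
    using mult_right_mono[OF v norm_ge_zero[of v]] by (simp add: algebra_simps)
  finally have "\<bar>s\<bar> \<le> (2 * r + 1) * norm v" .
  from power_mono[OF this, of 2] have s: "s\<^sup>2 \<le> ((2 * r + 1) * norm v)\<^sup>2"
    by simp
  have t: "max 0 t \<le> \<delta>\<^sup>2" "0 \<le> max 0 t"
    by (auto simp: t_def)
  have "bump \<delta> z (y + v) - bump \<delta> z y - bump_grad \<delta> z y \<bullet> v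
     = ((max 0 (t + s))\<^sup>2 - (max 0 t)\<^sup>2 - 2 * max 0 t * s) - 2 * max 0 t * (norm v)\<^sup>2"
    unfolding bump_def bump_grad_def ts t_def[symmetric]
    by (simp add: s_def power2_norm_eq_inner algebra_simps)
  then have "\<bar>bump \<delta> z (y + v) - bump \<delta> z y - bump_grad \<delta> z y \<bullet> v\<bar>
     \<le> s\<^sup>2 + 2 * max 0 t * (norm v)\<^sup>2"
    using quad t(2) mult_nonneg_nonneg[of "2 * max 0 t" "(norm v)\<^sup>2"] by (smt (verit)
        zero_le_power2)
  also have "\<dots> \<le> ((2 * r + 1) * norm v)\<^sup>2 + 2 * \<delta>\<^sup>2 * (norm v)\<^sup>2"
    using s t(1) by (intro add_mono mult_right_mono) auto
  also have "\<dots> = (2 * \<delta>\<^sup>2 + (2 * r + 1)\<^sup>2) * (norm v)\<^sup>2"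
    unfolding power_mult_distrib by (simp add: distrib_right)
  finally show ?thesis .
qed

lemma quadratic_error_has_derivative:
  fixes b :: "'a::real_inner \<Rightarrow> real"
  assumes C: "0 \<le> C" and "d > 0" and est: "\<And>v. norm v \<le> d \<Longrightarrow> \<bar>b (y + v) - b y - g \<bullet> v\<bar> \<le> C * (norm
      v)\<^sup>2"
  shows "(b has_derivative (\<lambda>v. g \<bullet> v)) (at y)"
  unfolding has_derivative_at_alt
proof (intro conjI allI impI)
  show "bounded_linear (\<lambda>v. g \<bullet> v)"
    by (rule bounded_linear_inner_right)
  fix e :: real assume e: "e > 0"
  define d' where "d' = min d (e / (C + 1))"
  show "\<exists>d>0. \<forall>x. norm (x - y) < d \<longrightarrow> norm (b x - b y - g \<bullet> (x - y)) \<le> e * norm (x - y)"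
  proof (intro exI conjI allI impI)
    show "d' > 0"
      using e C \<open>d > 0\<close> by (simp add: d'_def)
    fix x assume x: "norm (x - y) < d'"
    have "\<bar>b x - b y - g \<bullet> (x - y)\<bar> \<le> C * (norm (x - y))\<^sup>2"
      using est[of "x - y"] x by (simp add: d'_def)
    also have "\<dots> = (C * norm (x - y)) * norm (x - y)"
      by (simp add: power2_eq_square)
    also have "\<dots> \<le> e * norm (x - y)"
    proof (intro mult_right_mono)
      have "norm (x - y) * (C + 1) \<le> e"
        using x C by (simp add: d'_def pos_less_divide_eq less_imp_le)
      then have "C * norm (x - y) + norm (x - y) \<le> e"
        by (simp add: algebra_simps)
      then show "C * norm (x - y) \<le> e"
        using norm_ge_zero[of "x - y"] by linarith
    qed simp
    finally show "norm (b x - b y - g \<bullet> (x - y)) \<le> e * norm (x - y)"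
      by simp
  qed
qed

lemma bump_derivative: "(bump \<delta> z has_derivative (\<lambda>v. bump_grad \<delta> z y \<bullet> v)) (at y)"
  by (rule quadratic_error_has_derivative[OF _ zero_less_one bump_taylor[OF order_refl]]) auto

section \<open>Connectedness of the elements around a point, by means of bump functions\<close>

context mesh
begin

lemma elem_divergence_bump:
  assumes \<kappa>: "\<kappa> \<in> elems M"
  shows "integral \<kappa> (\<lambda>y. bump_grad \<delta> z y \<bullet> e) = (\<Sum>f\<in>{f. f facet_of K}. side_integral M (\<kappa>, f) (bump
      \<delta> z) e)"
proof -
  interpret E: curved_element K "emap M \<kappa>"
    by (rule element[OF \<kappa>])
  obtain R where "\<forall>y\<in>\<kappa>. norm y \<le> R"
    using compact_imp_bounded[OF elem_compact[OF \<kappa>]] unfolding bounded_iff by (elim exE)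
  then have R: "\<kappa> \<subseteq> cball 0 R"
    by auto
  have "bounded (bump_grad \<delta> z ` cball 0 R)"
    by (intro compact_imp_bounded compact_continuous_image continuous_bump compact_cball)
  then obtain L where L: "\<And>y. y \<in> cball 0 R \<Longrightarrow> norm (bump_grad \<delta> z y) \<le> L"
    unfolding bounded_iff by blast
  have lip: "\<bar>bump \<delta> z a - bump \<delta> z b\<bar> \<le> L * norm (a - b)" if "a \<in> emap M \<kappa> ` K" "b \<in> emap M \<kappa> ` K"
      for a b
  proof -
    have ab: "a \<in> cball 0 R" "b \<in> cball 0 R"
      using that R unfolding elem_image[OF \<kappa>] by blast+
    have "norm (bump \<delta> z a - bump \<delta> z b) \<le> L * norm (a - b)"
    proof (rule differentiable_bound[OF convex_cball has_derivative_at_withinI[OF bump_derivative] _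
        ab])
      fix y :: "real^'n" assume y: "y \<in> cball 0 R"
      show "onorm (\<lambda>v. bump_grad \<delta> z y \<bullet> v) \<le> L"
        by (rule onorm_le)
          (use L[OF y] in \<open>auto intro: order_trans[OF Cauchy_Schwarz_ineq2 mult_right_mono]\<close>)
    qed
    then show ?thesis
      by simp
  qed
  have "integral (emap M \<kappa> ` K) (\<lambda>y. bump_grad \<delta> z y \<bullet> e) = (\<Sum>f\<in>{f. f facet_of K}.
    facet_integral f (ref_normal K f) (\<lambda>y. bump \<delta> z (emap M \<kappa> y) * (\<bar>det (E.J y)\<bar> * (E.cnormal f y \<bullet>
        e))))"
    by (rule E.divergence_theorem[OF lip bump_derivative])
      (auto intro!: continuous_intros continuous_bump continuous_on_compose2[OF
          continuous_bump(1)[of UNIV] E.T_cont])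
  then show ?thesis
    using \<kappa> by (simp add: elem_image side_integral_def conormal_eq)
qed

lemma elem_closure: "\<kappa> \<in> elems M \<Longrightarrow> \<kappa> \<subseteq> closure (emap M \<kappa> ` interior K)"
proof -
  assume \<kappa>: "\<kappa> \<in> elems M"
  interpret E: curved_element K "emap M \<kappa>"
    by (rule element[OF \<kappa>])
  have cl: "closure (interior K) = K"
    using convex_closure_interior[OF convex interior] closed by (simp add: closure_closed)
  have "emap M \<kappa> ` closure (interior K) \<subseteq> closure (emap M \<kappa> ` interior K)"
    by (rule image_closure_subset) (simp_all add: cl E.T_cont closure_subset)
  then show "\<kappa> \<subseteq> closure (emap M \<kappa> ` interior K)"
    by (simp add: cl elem_image[OF \<kappa>])
qed

text \<open>If every side through \<open>x\<close> of an element in \<open>C\<close> is shared with another element in \<open>C\<close>, then by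
  the divergence theorem the indicator function of the union of \<open>C\<close> has vanishing weak gradient
  near \<open>x\<close>. Hence it is constant there, and \<open>C\<close> contains all elements at \<open>x\<close>.\<close>
lemma elements_at_point:
  assumes C: "C \<subseteq> elems M" "\<kappa>1 \<in> C" "x \<in> \<kappa>1"
    and bd: "\<And>s. Boundary s \<in> faces M \<Longrightarrow> x \<in> side_set M s \<Longrightarrow> fst s \<notin> C"
    and int: "\<And>s s'. Interior s s' \<in> faces M \<Longrightarrow> x \<in> side_set M s \<Longrightarrow> fst s \<in> C \<longleftrightarrow> fst s' \<in> C"
    and \<kappa>0: "\<kappa>0 \<in> elems M" "x \<in> \<kappa>0"
  shows "\<kappa>0 \<in> C"
proof (rule ccontr)
  assume nC: "\<kappa>0 \<notin> C"
  have finC: "finite C"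
    using C(1) finite_elems finite_subset by blast
  \<comment> \<open>The sides that miss \<open>x\<close> form a closed set because there are
    finitely many; a ball around \<open>x\<close> therefore meets only sides through
    \<open>x\<close>.\<close>
  define Z where "Z = (\<Union>s\<in>{s \<in> sides M. x \<notin> side_set M s}. side_set M s)"
  have "closed Z"
    unfolding Z_def
  proof (rule closed_UN)
    show "finite {s \<in> sides M. x \<notin> side_set M s}"
      using finite_sides by simp
    show "\<forall>s\<in>{s \<in> sides M. x \<notin> side_set M s}. closed (side_set M s)"
      using compact_imp_closed[OF compact_side_set] by simp
  qed
  then have "open (- Z)"
    by (rule open_Compl)
  moreover have "x \<in> - Z"
    by (simp add: Z_def)
  ultimately obtain R where R: "R > 0" "ball x R \<subseteq> - Z"
    using openE by metis
  have near: "\<exists>z\<in>emap M \<kappa> ` interior K. dist z x < R" if "\<kappa> \<in> elems M" "x \<in> \<kappa>" for \<kappa>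
  proof -
    have "x \<in> closure (emap M \<kappa> ` interior K)"
      using elem_closure[OF that(1)] that(2) by (rule subsetD)
    then show ?thesis
      unfolding closure_approachable using R(1) by simp
  qed
  obtain z1 where z1: "z1 \<in> emap M \<kappa>1 ` interior K" "dist z1 x < R"
    using near C by blast
  obtain z0 where z0: "z0 \<in> emap M \<kappa>0 ` interior K" "dist z0 x < R"
    using near \<kappa>0 by blast
  have sub_int: "emap M \<kappa> ` interior K \<subseteq> interior \<kappa>" if "\<kappa> \<in> elems M" for \<kappa>
    using curved_element.image_interior_subset[OF element[OF that]] elem_image[OF that] by simp
  have z1': "z1 \<in> interior \<kappa>1" and z0': "z0 \<in> interior \<kappa>0"
    using sub_int z1 z0 C \<kappa>0 by blast+
  have disj: "interior \<kappa>0 \<inter> \<kappa> = {}" if "\<kappa> \<in> C" for \<kappa>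
  proof -
    have \<kappa>: "\<kappa> \<in> elems M" "\<kappa> \<noteq> \<kappa>0"
      using that C nC by auto
    have "interior \<kappa>0 \<inter> interior \<kappa> = {}"
      using elem_disjoint \<kappa> \<kappa>0(1) by blast
    then have "interior \<kappa>0 \<inter> emap M \<kappa> ` interior K = {}"
      using sub_int[OF \<kappa>(1)] by blast
    then have "interior \<kappa>0 \<inter> closure (emap M \<kappa> ` interior K) = {}"
      by (simp add: open_Int_closure_eq_empty)
    then show ?thesis
      using elem_closure[OF \<kappa>(1)] by blast
  qed
  obtain d where d: "d > 0" "ball z0 d \<subseteq> interior \<kappa>0"
    using z0' open_contains_ball open_interior by meson
  \<comment> \<open>Bumps of this radius around \<open>z0\<close> and \<open>z1\<close> stay inside
    the ball of radius \<open>R\<close> around \<open>x\<close>, and the one around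
    \<open>z0\<close> stays inside \<kappa>0.\<close>
  define \<delta> where "\<delta> = min d (min ((R - dist z0 x) / 2) ((R - dist z1 x) / 2))"
  have \<delta>: "0 < \<delta>" "\<delta> \<le> d" "dist z0 x + \<delta> < R" "dist z1 x + \<delta> < R"
    using d(1) z0(2) z1(2) by (auto simp: \<delta>_def min_def field_simps)
  \<comment> \<open>The bump integrated over the union of \<open>C\<close>, as a function of its
    centre.\<close>
  define m where "m = (\<lambda>z. \<Sum>\<kappa>\<in>C. integral \<kappa> (bump \<delta> z))"
  \<comment> \<open>Sides that miss \<open>x\<close> do not meet the bump. Through \<open>x\<close>,
    a boundary side does not belong to \<open>C\<close>, and an interior face has either both of its
    elements in \<open>C\<close>, with cancelling contributions, or none.\<close>
  have grad0: "(\<Sum>\<kappa>\<in>C. integral \<kappa> (\<lambda>y. bump_grad \<delta> z y \<bullet> e)) = 0" if z: "dist z x + \<delta> < R" for z e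
  proof -
    define F where "F = (\<lambda>s. if fst s \<in> C then side_integral M s (bump \<delta> z) e else 0)"
    have F0: "F s = 0" if "s \<in> sides M" "x \<notin> side_set M s" for s
    proof -
      have "bump \<delta> z u = 0" if "u \<in> side_set M s" for u
      proof (rule bump_eq_0[OF \<delta>(1)])
        show "u \<notin> ball z \<delta>"
        proof
          assume "u \<in> ball z \<delta>"
          then have "u \<in> ball x R"
            using z dist_triangle[of x u z] by (simp add: dist_commute)
          then show False
            using R(2) that \<open>s \<in> sides M\<close> \<open>x \<notin> side_set M s\<close> unfolding Z_def by blast
        qed
      qed
      then show ?thesis
        unfolding F_def using side_integral_0[OF \<open>s \<in> sides M\<close>] by auto
    qed
    have "(\<Sum>\<kappa>\<in>C. integral \<kappa> (\<lambda>y. bump_grad \<delta> z y \<bullet> e)) = (\<Sum>\<kappa>\<in>C. \<Sum>f\<in>{f. f facet_of K}. F (\<kappa>, f))"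
      using C(1) by (intro sum.cong refl) (auto simp: F_def elem_divergence_bump subset_iff)
    also have "\<dots> = (\<Sum>\<kappa>\<in>elems M. \<Sum>f\<in>{f. f facet_of K}. F (\<kappa>, f))"
      using C(1) finite_elems by (intro sum.mono_neutral_left) (auto simp: F_def)
    also have "\<dots> = (\<Sum>\<Gamma>\<in>faces M. \<Sum>s\<in>set_face \<Gamma>. F s)"
      by (simp add: sum_elems_sides sum_sides)
    also have "\<dots> = 0"
    proof (rule sum.neutral, rule ballI)
      fix \<Gamma> assume \<Gamma>: "\<Gamma> \<in> faces M"
      show "(\<Sum>s\<in>set_face \<Gamma>. F s) = 0"
      proof (cases \<Gamma>)
        case (Boundary s)
        have "F s = 0"
          using F0[of s] bd[of s] face_sides[OF \<Gamma>] \<Gamma> by (cases "x \<in> side_set M s") (auto simp: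
              Boundary F_def)
        then show ?thesis
          by (simp add: Boundary)
      next
        case (Interior s s')
        note I = interior_face[OF \<Gamma>[unfolded Interior]]
        have "F s + F s' = 0"
        proof (cases "x \<in> side_set M s")
          case True
          have "side_integral M s' (bump \<delta> z) e = - side_integral M s (bump \<delta> z) e"
            by (intro side_integral_opposite \<Gamma>[unfolded Interior] continuous_bump)
          then show ?thesis
            using int[OF \<Gamma>[unfolded Interior] True] by (simp add: F_def)
        next
          case False
          then show ?thesis
            using F0[OF I(1)] F0[OF I(2)] I(4) by simp
        qed
        moreover have "s \<noteq> s'"
          using I(3) by blast
        ultimately show ?thesis
          by (simp add: Interior)
      qed
    qed
    finally show ?thesis .
  qed
  define X where "X = ball x (R - \<delta>)"
  have "\<exists>c. \<forall>z\<in>X. m z = c"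
  proof (rule has_derivative_zero_constant)
    show "convex X"
      by (simp add: X_def)
    fix z assume "z \<in> X"
    then have z: "dist z x + \<delta> < R"
      by (simp add: X_def dist_commute)
    have "bounded (\<Union>C)"
      using finC C(1) elem_compact by (intro bounded_Union) (auto intro: compact_imp_bounded)
    then obtain r0 where r0: "\<And>y. y \<in> \<Union>C \<Longrightarrow> norm y \<le> r0"
      unfolding bounded_iff by blast
    define r where "r = r0 + norm z"
    have r: "norm (y - z) \<le> r" if "y \<in> \<kappa>" "\<kappa> \<in> C" for y \<kappa>
    proof -
      have "norm y \<le> r0"
        using r0 that by blast
      then show ?thesis
        using norm_triangle_ineq4[of y z] by (simp add: r_def)
    qed
    define q where "q = 2 * \<delta>\<^sup>2 + (2 * r + 1)\<^sup>2"
    define Q where "Q = (\<Sum>\<kappa>\<in>C. q * measure lebesgue \<kappa>)"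
    have q0: "q \<ge> 0"
      by (simp add: q_def)
    \<comment> \<open>Differentiation under the integral is avoided: the Taylor error is quadratic
      uniformly on \<open>C\<close>, and the first-order terms add up to zero by
      \<open>grad0\<close>.\<close>
    have "(m has_derivative (\<lambda>v. 0 \<bullet> v)) (at z)"
    proof (rule quadratic_error_has_derivative[OF _ zero_less_one])
      show "0 \<le> Q"
        unfolding Q_def using q0 by (intro sum_nonneg) simp
      fix v :: "real^'n" assume v: "norm v \<le> 1"
      define E where "E = (\<lambda>y. bump \<delta> z (y + - v) - bump \<delta> z y - bump_grad \<delta> z y \<bullet> (- v))"
      have cE: "continuous_on S E" for S
        unfolding E_def
        by (intro continuous_intros continuous_bump continuous_on_compose2[OF continuous_bump(1)[of
            UNIV]]) auto
      have intble: "g integrable_on \<kappa>" if "\<kappa> \<in> C" "continuous_on \<kappa> g" for g :: "real^'n \<Rightarrow> real" and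
          \<kappa>
        using absolutely_integrable_continuous_compact[OF elem_compact that(2)] that(1) C(1)
        by (auto simp: absolutely_integrable_on_def)
      have "integral \<kappa> (bump \<delta> (z + v)) = integral \<kappa> (bump \<delta> z) + integral \<kappa> (\<lambda>y. bump_grad \<delta> z y \<bullet>
          (- v)) + integral \<kappa> E"
        if \<kappa>: "\<kappa> \<in> C" for \<kappa>
      proof -
        have "bump \<delta> (z + v) = (\<lambda>y. (bump \<delta> z y + bump_grad \<delta> z y \<bullet> (- v)) + E y)"
          by (simp add: E_def bump_shift fun_eq_iff)
        moreover have "bump \<delta> z integrable_on \<kappa>" "(\<lambda>y. bump_grad \<delta> z y \<bullet> (- v)) integrable_on \<kappa>" "E
            integrable_on \<kappa>"
          by (intro intble[OF \<kappa>] continuous_intros continuous_bump cE)+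
        ultimately show ?thesis
          by (simp only: Henstock_Kurzweil_Integration.integral_add integrable_add)
      qed
      then have "m (z + v) = (\<Sum>\<kappa>\<in>C. integral \<kappa> (bump \<delta> z) + integral \<kappa> (\<lambda>y. bump_grad \<delta> z y \<bullet> (- v))
          + integral \<kappa> E)"
        unfolding m_def by (intro sum.cong refl)
      also have "\<dots> = m z + (\<Sum>\<kappa>\<in>C. integral \<kappa> E)"
        unfolding sum.distrib grad0[OF z] by (simp add: m_def)
      finally have "m (z + v) - m z = (\<Sum>\<kappa>\<in>C. integral \<kappa> E)"
        by simp
      also have "\<bar>\<dots>\<bar> \<le> (\<Sum>\<kappa>\<in>C. \<bar>integral \<kappa> E\<bar>)"
        by (rule sum_abs)
      also have "\<dots> \<le> (\<Sum>\<kappa>\<in>C. q * measure lebesgue \<kappa> * (norm v)\<^sup>2)"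
      proof (rule sum_mono)
        fix \<kappa> assume \<kappa>: "\<kappa> \<in> C"
        have lm: "\<kappa> \<in> lmeasurable"
          using \<kappa> C(1) elem_compact lmeasurable_compact by blast
        have "norm (integral \<kappa> E) \<le> integral \<kappa> (\<lambda>y. q * (norm v)\<^sup>2)"
        proof (rule integral_norm_bound_integral)
          show "E integrable_on \<kappa>"
            by (rule intble[OF \<kappa> cE])
          show "(\<lambda>y. q * (norm v)\<^sup>2) integrable_on \<kappa>"
            by (rule integrable_on_const[OF lm])
          fix y assume "y \<in> \<kappa>"
          then show "norm (E y) \<le> q * (norm v)\<^sup>2"
            using bump_taylor[OF r[OF _ \<kappa>], of y "- v" \<delta>] v by (simp add: E_def q_def)
        qed
        also have "\<dots> = (q * (norm v)\<^sup>2) * integral \<kappa> (\<lambda>y. 1)"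
          using integral_mult_right[of \<kappa> "q * (norm v)\<^sup>2" "\<lambda>_. 1"] by simp
        also have "\<dots> = q * measure lebesgue \<kappa> * (norm v)\<^sup>2"
          by (simp add: lmeasure_integral[OF lm])
        finally show "\<bar>integral \<kappa> E\<bar> \<le> q * measure lebesgue \<kappa> * (norm v)\<^sup>2"
          by simp
      qed
      also have "\<dots> = Q * (norm v)\<^sup>2"
        by (simp add: Q_def sum_distrib_right)
      finally show "\<bar>m (z + v) - m z - 0 \<bullet> v\<bar> \<le> Q * (norm v)\<^sup>2"
        by simp
    qed
    then show "(m has_derivative (\<lambda>v. 0)) (at z within X)"
      by (simp add: has_derivative_at_withinI)
  qed
  \<comment> \<open>The contradiction: around \<open>z0\<close> the bump misses \<open>C\<close>,
    while around \<open>z1\<close> it has positive integral over \<kappa>1.\<close>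
  then have "m z0 = m z1"
    using \<delta>(3,4) by (auto simp: X_def dist_commute)
  moreover have "m z0 = 0"
    unfolding m_def
  proof (rule sum.neutral, rule ballI)
    fix \<kappa> assume "\<kappa> \<in> C"
    then have "bump \<delta> z0 y = 0" if "y \<in> \<kappa>" for y
    proof (intro bump_eq_0[OF \<delta>(1)])
      have "y \<notin> ball z0 d"
        using disj[OF \<open>\<kappa> \<in> C\<close>] d(2) that by blast
      then show "y \<notin> ball z0 \<delta>"
        using \<delta>(2) by simp
    qed
    then have "integral \<kappa> (bump \<delta> z0) = integral \<kappa> (\<lambda>_. 0)"
      by (intro integral_cong) auto
    then show "integral \<kappa> (bump \<delta> z0) = 0"
      by simp
  qed
  moreover have "integral \<kappa>1 (bump \<delta> z1) \<noteq> 0"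
  proof
    assume "integral \<kappa>1 (bump \<delta> z1) = 0"
    then have "bump \<delta> z1 z1 = 0"
      using z1' C elem_compact
      by (intro zero_integral_imp_zero_on_interior[OF _ continuous_bump(1) bump_nonneg, of \<kappa>1]) auto
    then show False
      using bump_center[OF \<delta>(1), of z1] by simp
  qed
  moreover have nn: "0 \<le> integral \<kappa> (bump \<delta> z1)" if "\<kappa> \<in> C" for \<kappa>
    using absolutely_integrable_continuous_compact[OF elem_compact continuous_bump(1)] that C(1)
    by (intro integral_nonneg) (auto simp: absolutely_integrable_on_def bump_nonneg)
  then have "integral \<kappa>1 (bump \<delta> z1) \<le> m z1"
    unfolding m_def using finC C(2) by (intro member_le_sum) auto
  ultimately show False
    using nn[OF C(2)] by linarith
qed

end

context dg_mesh
begin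

text \<open>At a point \<open>x\<close>, the elements on which \<open>u\<close> takes a fixed
  nonzero value satisfy the hypotheses of \<open>elements_at_point\<close>, so this value is taken
  on all elements at \<open>x\<close>, including those that touch only in a vertex or an edge. The
  branches then glue to a continuous function, since finitely many closed elements cover the
  domain.\<close>

lemma vanishing_jumps_imp_continuous:
  assumes u: "u \<in> U" and jump: "\<And>\<Gamma> x. \<Gamma> \<in> faces M \<Longrightarrow> x \<in> face_set M \<Gamma> \<Longrightarrow> jump u \<Gamma> x = 0"
  shows "continuous_vanishing M u"
proof -
  have b: "u (fst s) x = 0" if "Boundary s \<in> faces M" "x \<in> side_set M s" for s x
    using jump[OF that(1)] that(2) by (simp add: face_set_def)
  have i: "u (fst s) x = u (fst s') x" if "Interior s s' \<in> faces M" "x \<in> side_set M s" for s s' x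
    using jump[OF that(1)] that(2) by (simp add: face_set_def)
  \<comment> \<open>The value must be nonzero here: this excludes boundary sides, on which
    \<open>u\<close> vanishes.\<close>
  have star: "\<kappa>' \<in> {\<kappa> \<in> elems M. x \<in> \<kappa> \<and> u \<kappa> x = u \<kappa>1 x}"
    if "\<kappa>1 \<in> elems M" "x \<in> \<kappa>1" "u \<kappa>1 x \<noteq> 0" "\<kappa>' \<in> elems M" "x \<in> \<kappa>'" for \<kappa>1 \<kappa>' x
  proof (rule elements_at_point[OF _ _ that(2) _ _ that(4,5)])
    show "fst s \<notin> {\<kappa> \<in> elems M. x \<in> \<kappa> \<and> u \<kappa> x = u \<kappa>1 x}" if "Boundary s \<in> faces M" "x \<in> side_set M
        s" for s
      using b[OF that] \<open>u \<kappa>1 x \<noteq> 0\<close> by simp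
    show "fst s \<in> {\<kappa> \<in> elems M. x \<in> \<kappa> \<and> u \<kappa> x = u \<kappa>1 x} \<longleftrightarrow> fst s' \<in> {\<kappa> \<in> elems M. x \<in> \<kappa> \<and> u \<kappa> x = u
        \<kappa>1 x}"
      if I: "Interior s s' \<in> faces M" "x \<in> side_set M s" for s s'
    proof -
      note f = interior_face[OF I(1)]
      have "x \<in> fst s" "x \<in> fst s'" "fst s \<in> elems M" "fst s' \<in> elems M"
        using side_set_subset[OF f(1)] side_set_subset[OF f(2)] f(4) I(2) f(1,2) by (auto simp:
            sides_iff)
      then show ?thesis
        using i[OF I] by simp
    qed
  qed (use that in auto)
  have agree: "u \<kappa> x = u \<kappa>' x" if "\<kappa> \<in> elems M" "x \<in> \<kappa>" "\<kappa>' \<in> elems M" "x \<in> \<kappa>'" for \<kappa> \<kappa>' x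
    using star[of \<kappa> x \<kappa>'] star[of \<kappa>' x \<kappa>] that by (cases "u \<kappa> x = 0"; cases "u \<kappa>' x = 0") auto
  define w where "w = (\<lambda>x. u (SOME \<kappa>. \<kappa> \<in> elems M \<and> x \<in> \<kappa>) x)"
  have w: "u \<kappa> x = w x" if "\<kappa> \<in> elems M" "x \<in> \<kappa>" for \<kappa> x
  proof -
    have "(SOME \<kappa>. \<kappa> \<in> elems M \<and> x \<in> \<kappa>) \<in> elems M \<and> x \<in> (SOME \<kappa>. \<kappa> \<in> elems M \<and> x \<in> \<kappa>)"
      by (rule someI[of _ \<kappa>]) (use that in simp)
    then show ?thesis
      unfolding w_def using agree that by blast
  qed
  show ?thesis
    unfolding continuous_vanishing_def
  proof (intro exI conjI ballI)
    have "continuous_on (\<Union>\<kappa>\<in>elems M. \<kappa>) w"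
    proof (rule continuous_on_closed_Union)
      fix \<kappa> assume \<kappa>: "\<kappa> \<in> elems M"
      show "closed \<kappa>"
        by (rule compact_imp_closed[OF elem_compact[OF \<kappa>]])
      show "continuous_on \<kappa> w"
        using branch_continuous[OF u \<kappa>] by (rule continuous_on_cong[THEN iffD1, rotated -1])
            (simp_all add: w[OF \<kappa>])
    qed (rule finite_elems)
    then show "continuous_on (closure (dom M)) w"
      by (simp add: valid_mesh_rules(5)[symmetric])
    show "u \<kappa> x = w x" if "\<kappa> \<in> elems M" "x \<in> \<kappa>" for \<kappa> x
      by (rule w[OF that])
    show "w x = 0" if x: "x \<in> frontier (dom M)" for x
    proof -
      obtain s where s: "Boundary s \<in> faces M" "x \<in> side_set M s"
        using x unfolding frontier_dom by blast
      have "s \<in> sides M"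
        using face_sides[OF s(1)] by simp
      then have "fst s \<in> elems M" "x \<in> fst s"
        using side_set_subset[of s] s(2) by (auto simp: sides_iff)
      then show ?thesis
        using w b[OF s] by simp
    qed
  qed
qed

section \<open>Mass matrices\<close>

definition mass_form :: "(real^'n \<Rightarrow> real) \<Rightarrow> (real^'n) dgfun \<Rightarrow> (real^'n) dgfun \<Rightarrow> real" where
  "mass_form \<sigma> u v = (\<Sum>\<kappa>\<in>elems M. integral \<kappa> (\<lambda>x. \<sigma> x * u \<kappa> x * v \<kappa> x))"

lemma negligible_frontier_dom: "negligible (frontier (dom M))"
  unfolding frontier_dom
proof (rule negligible_subset)
  show "negligible (\<Union>s\<in>sides M. side_set M s)"
  proof (intro negligible_Union finite_imageI finite_sides)
    fix X assume "X \<in> side_set M ` sides M"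
    then obtain s where s: "s \<in> sides M" "X = side_set M s"
      by blast
    interpret E: curved_element K "emap M (fst s)"
      using element s sides_iff by blast
    have "snd s \<subseteq> frontier K"
      using s(1) by (auto simp: frontier_eq_Union_facets sides_iff)
    then show "negligible X"
      unfolding s(2) side_set_def
      by (intro negligible_subset[OF E.negligible_image_frontier] image_mono)
  qed
  show "(\<Union>s\<in>{s. Boundary s \<in> faces M}. side_set M s) \<subseteq> (\<Union>s\<in>sides M. side_set M s)"
    using face_sides by fastforce
qed

lemma elem_minus_dom: "\<kappa> \<in> elems M \<Longrightarrow> \<kappa> - dom M \<subseteq> frontier (dom M)"
proof -
  assume "\<kappa> \<in> elems M"
  then have "\<kappa> \<subseteq> closure (dom M)"
    using valid_mesh_rules(5) by blast
  then show ?thesis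
    unfolding frontier_def using interior_subset[of "dom M"] by blast
qed

text \<open>The opacity is controlled on the open domain only. A closed element leaves it just along
  the frontier, a null set made up of sides.\<close>

lemma opacity_integrable:
  fixes \<sigma> :: "real^'n \<Rightarrow> real"
  assumes \<sigma>: "\<sigma> absolutely_integrable_on dom M" and \<kappa>: "\<kappa> \<in> elems M"
  shows "\<sigma> absolutely_integrable_on \<kappa>"
proof -
  have "open (dom M)"
    using valid unfolding valid_mesh_def by (elim conjE)
  then have meas: "\<kappa> \<inter> dom M \<in> sets lebesgue"
    using fmeasurableD[OF lmeasurable_compact[OF elem_compact[OF \<kappa>]]] by (simp add: sets.Int lborelD
        borel_open)
  have 1: "\<sigma> absolutely_integrable_on (\<kappa> \<inter> dom M)"
    by (rule set_integrable_subset[OF \<sigma> meas]) simp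
  have "negligible (\<kappa> - dom M)"
    by (rule negligible_subset[OF negligible_frontier_dom elem_minus_dom[OF \<kappa>]])
  then have 2: "negligible {x \<in> \<kappa> - \<kappa> \<inter> dom M. \<sigma> x \<noteq> 0}"
    by (rule negligible_subset) blast
  have "{x \<in> \<kappa> \<inter> dom M - \<kappa>. \<sigma> x \<noteq> 0} = {}"
    by blast
  then have 3: "negligible {x \<in> \<kappa> \<inter> dom M - \<kappa>. \<sigma> x \<noteq> 0}"
    by (simp only: negligible_empty)
  show ?thesis
    by (rule absolutely_integrable_spike_set[OF 1 3 2])
qed

lemma mass_integrand:
  assumes \<sigma>: "\<sigma> absolutely_integrable_on dom M" and \<kappa>: "\<kappa> \<in> elems M" and u: "u \<in> U" "v \<in> U"
  shows "(\<lambda>x. \<sigma> x * u \<kappa> x * v \<kappa> x) absolutely_integrable_on \<kappa>"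
proof -
  have cont: "continuous_on \<kappa> (\<lambda>x. u \<kappa> x * v \<kappa> x)"
    by (intro continuous_intros branch_continuous u \<kappa>)
  have "(\<lambda>x. (u \<kappa> x * v \<kappa> x) * \<sigma> x) absolutely_integrable_on \<kappa>"
  proof (rule absolutely_integrable_bounded_measurable_product[OF bilinear_times])
    show leb: "\<kappa> \<in> sets lebesgue"
      by (rule fmeasurableD[OF lmeasurable_compact[OF elem_compact[OF \<kappa>]]])
    show "(\<lambda>x. u \<kappa> x * v \<kappa> x) \<in> borel_measurable (lebesgue_on \<kappa>)"
      by (rule continuous_imp_measurable_on_sets_lebesgue[OF cont leb])
    show "bounded ((\<lambda>x. u \<kappa> x * v \<kappa> x) ` \<kappa>)"
      by (rule compact_imp_bounded[OF compact_continuous_image[OF cont elem_compact[OF \<kappa>]]])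
  qed (rule opacity_integrable[OF \<sigma> \<kappa>])
  then show ?thesis
    by (simp add: mult_ac)
qed

lemma mass_form_bilinear:
  assumes \<sigma>: "\<sigma> absolutely_integrable_on dom M"
  shows "bilinear_on U (mass_form \<sigma>)"
  unfolding mass_form_def
proof (rule bilinear_on_sum)
  fix \<kappa> assume \<kappa>: "\<kappa> \<in> elems M"
  have int: "(\<lambda>x. \<sigma> x * u \<kappa> x * v \<kappa> x) integrable_on \<kappa>" if "u \<in> U" "v \<in> U" for u v
    using mass_integrand[OF \<sigma> \<kappa> that] by (simp add: absolutely_integrable_on_def)
  show "bilinear_on U (\<lambda>u v. integral \<kappa> (\<lambda>x. \<sigma> x * u \<kappa> x * v \<kappa> x))"
    unfolding bilinear_on_def
  proof (intro allI ballI conjI)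
    fix a u u' v assume u: "u \<in> U" "u' \<in> U" "v \<in> U"
    have "(\<lambda>x. \<sigma> x * lincomb a u u' \<kappa> x * v \<kappa> x) = (\<lambda>x. a * (\<sigma> x * u \<kappa> x * v \<kappa> x) + \<sigma> x * u' \<kappa> x * v
        \<kappa> x)"
      by (simp add: lincomb_def algebra_simps)
    then show "integral \<kappa> (\<lambda>x. \<sigma> x * lincomb a u u' \<kappa> x * v \<kappa> x)
       = a * integral \<kappa> (\<lambda>x. \<sigma> x * u \<kappa> x * v \<kappa> x) + integral \<kappa> (\<lambda>x. \<sigma> x * u' \<kappa> x * v \<kappa> x)"
      using int[OF u(1,3)] int[OF u(2,3)]
      by (simp add: Henstock_Kurzweil_Integration.integral_add integrable_on_mult_right)
    have "(\<lambda>x. \<sigma> x * v \<kappa> x * lincomb a u u' \<kappa> x) = (\<lambda>x. a * (\<sigma> x * v \<kappa> x * u \<kappa> x) + \<sigma> x * v \<kappa> x * u'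
        \<kappa> x)"
      by (simp add: lincomb_def algebra_simps)
    then show "integral \<kappa> (\<lambda>x. \<sigma> x * v \<kappa> x * lincomb a u u' \<kappa> x)
       = a * integral \<kappa> (\<lambda>x. \<sigma> x * v \<kappa> x * u \<kappa> x) + integral \<kappa> (\<lambda>x. \<sigma> x * v \<kappa> x * u' \<kappa> x)"
      using int[OF u(3,1)] int[OF u(3,2)]
      by (simp add: Henstock_Kurzweil_Integration.integral_add integrable_on_mult_right)
  qed
qed

text \<open>The opacity is merely integrable and positive, so the integrand vanishes only almost
  everywhere. Continuity of each branch and the density of the image of the open reference element
  turn this into vanishing everywhere.\<close>

lemma mass_form_definite:
  assumes \<sigma>: "\<sigma> absolutely_integrable_on dom M" "\<And>x. x \<in> dom M \<Longrightarrow> \<sigma> x > 0"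
    and u: "u \<in> U" and 0: "mass_form \<sigma> u u = 0"
  shows "u = (\<lambda>\<kappa> x. 0)"
proof -
  \<comment> \<open>Set to zero outside the domain, where the sign of \<sigma> is unknown; this
    changes the integrand only on a null set and makes it nonnegative.\<close>
  define q where "q = (\<lambda>\<kappa> x. if x \<in> dom M then \<sigma> x * u \<kappa> x * u \<kappa> x else 0)"
  have q: "integral \<kappa> (q \<kappa>) = integral \<kappa> (\<lambda>x. \<sigma> x * u \<kappa> x * u \<kappa> x)" "q \<kappa> absolutely_integrable_on \<kappa>"
    if \<kappa>: "\<kappa> \<in> elems M" for \<kappa>
  proof -
    show "integral \<kappa> (q \<kappa>) = integral \<kappa> (\<lambda>x. \<sigma> x * u \<kappa> x * u \<kappa> x)"
      by (rule integral_spike[OF negligible_frontier_dom]) (use elem_minus_dom[OF \<kappa>] in \<open>auto simp: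
          q_def\<close>)
    show "q \<kappa> absolutely_integrable_on \<kappa>"
      by (rule absolutely_integrable_spike[OF mass_integrand[OF \<sigma>(1) \<kappa> u u]
          negligible_frontier_dom])
        (use elem_minus_dom[OF \<kappa>] in \<open>auto simp: q_def\<close>)
  qed
  have q0: "0 \<le> q \<kappa> x" for \<kappa> x
    using \<sigma>(2)[of x] by (auto simp: q_def mult.assoc less_imp_le)
  have "0 \<le> integral \<kappa> (q \<kappa>)" if "\<kappa> \<in> elems M" for \<kappa>
    using q(2)[OF that] q0 by (intro integral_nonneg) (auto simp: absolutely_integrable_on_def)
  moreover have "(\<Sum>\<kappa>\<in>elems M. integral \<kappa> (q \<kappa>)) = 0"
    using 0 q(1) by (simp add: mass_form_def)
  ultimately have int0: "integral \<kappa> (q \<kappa>) = 0" if "\<kappa> \<in> elems M" for \<kappa>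
    using that finite_elems by (simp add: sum_nonneg_eq_0_iff)
  have "u \<kappa> x = 0" if \<kappa>: "\<kappa> \<in> elems M" and x: "x \<in> \<kappa>" for \<kappa> x
  proof -
    interpret E: curved_element K "emap M \<kappa>"
      by (rule element[OF \<kappa>])
    define Y where "Y = emap M \<kappa> ` interior K"
    have Yk: "Y \<subseteq> \<kappa>"
      using interior_subset[of K] elem_image[OF \<kappa>] unfolding Y_def by blast
    have "closure Y = \<kappa>"
      using elem_closure[OF \<kappa>] closure_minimal[OF Yk compact_imp_closed[OF elem_compact[OF \<kappa>]]]
      unfolding Y_def by blast
    moreover have "u \<kappa> y = 0" if y: "y \<in> Y" for y
    proof (rule ccontr)
      assume nz: "u \<kappa> y \<noteq> 0"
      have "open (Y \<inter> u \<kappa> -` (- {0}))"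
        unfolding Y_def
        by (rule continuous_open_preimage[OF continuous_on_subset[OF branch_continuous[OF u \<kappa>]
            Yk[unfolded Y_def]]
              E.open_image_interior]) auto
      moreover have "Y \<inter> u \<kappa> -` (- {0}) \<subseteq> {x \<in> \<kappa>. q \<kappa> x \<noteq> 0} \<union> frontier (dom M)"
      proof
        fix t assume t: "t \<in> Y \<inter> u \<kappa> -` (- {0})"
        show "t \<in> {x \<in> \<kappa>. q \<kappa> x \<noteq> 0} \<union> frontier (dom M)"
        proof (cases "t \<in> dom M")
          case True
          then have "q \<kappa> t \<noteq> 0"
            using \<sigma>(2)[OF True] t by (simp add: q_def)
          then show ?thesis
            using t Yk by blast
        next
          case False
          then show ?thesis
            using t Yk elem_minus_dom[OF \<kappa>] by blast
        qed
      qed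
      then have "negligible (Y \<inter> u \<kappa> -` (- {0}))"
        using negligible_support_of_zero_integral[OF q(2)[OF \<kappa>] q0 int0[OF \<kappa>]]
            negligible_frontier_dom
        by (meson negligible_Un negligible_subset)
      ultimately show False
        using open_not_negligible[of "Y \<inter> u \<kappa> -` (- {0})"] y nz by auto
    qed
    ultimately show ?thesis
      using continuous_constant_on_closure[of Y "u \<kappa>" 0 x] branch_continuous[OF u \<kappa>] x by simp
  qed
  moreover have "u \<kappa> x = 0" if "\<kappa> \<notin> elems M \<or> x \<notin> \<kappa>" for \<kappa> x
    using u that unfolding dg_space_def by blast
  ultimately show ?thesis
    by blast
qed

lemma mass_matrix_form: "mass_matrix M \<phi> \<sigma> = form_matrix \<phi> (mass_form \<sigma>)"
  unfolding mass_matrix_def mass_form_def ..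

lemma mass_matrix_invertible:
  assumes \<sigma>: "\<sigma> absolutely_integrable_on dom M" "\<And>x. x \<in> dom M \<Longrightarrow> \<sigma> x > 0"
  shows "invertible (mass_matrix M \<phi> \<sigma>)"
proof -
  have "c = 0" if "mass_matrix M \<phi> \<sigma> *v c = 0" for c
  proof -
    have "mass_form \<sigma> (fc c) (fc c) = c \<bullet> (mass_matrix M \<phi> \<sigma> *v c)"
      unfolding mass_matrix_form by (rule form_matrix_inner[OF mass_form_bilinear[OF \<sigma>(1)],
          symmetric])
    then have "fc c = (\<lambda>\<kappa> x. 0)"
      using that by (intro mass_form_definite[OF \<sigma> fc_U]) simp_all
    then show ?thesis
      by (simp add: fc_eq_0)
  qed
  then show ?thesis
    by (meson invertible_left_inverse matrix_left_invertible_ker)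
qed

end

section \<open>Flux matrices\<close>

context dg_mesh
begin

definition mean_flux :: "real^'n \<Rightarrow> (real^'n) dgfun \<Rightarrow> (real^'n) dgfun \<Rightarrow> real" where
  "mean_flux e u v = (\<Sum>\<Gamma>\<in>faces M. face_integral M \<Gamma> (\<lambda>x. (e \<bullet> face_normal M \<Gamma> x) * jump u \<Gamma> x *
      average v \<Gamma> x))"

definition mean_flux' :: "real^'n \<Rightarrow> (real^'n) dgfun \<Rightarrow> (real^'n) dgfun \<Rightarrow> real" where
  "mean_flux' e u v = (\<Sum>\<Gamma>\<in>faces M. face_integral M \<Gamma> (\<lambda>x. (e \<bullet> face_normal M \<Gamma> x) * average u \<Gamma> x *
      jump v \<Gamma> x))"

definition penalty :: "real^'n \<Rightarrow> (real^'n) dgfun \<Rightarrow> (real^'n) dgfun \<Rightarrow> real" where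
  "penalty e u v = (\<Sum>\<Gamma>\<in>faces M. face_integral M \<Gamma> (\<lambda>x. \<bar>e \<bullet> face_normal M \<Gamma> x\<bar> * jump u \<Gamma> x * jump v
      \<Gamma> x))"

lemma face_forms_bilinear:
  "bilinear_on U (mean_flux e)" "bilinear_on U (mean_flux' e)" "bilinear_on U (penalty e)"
  unfolding mean_flux_def mean_flux'_def penalty_def
  by (rule face_form_bilinear[OF face_cont_normal trace_jump trace_average]
      face_form_bilinear[OF face_cont_normal trace_average trace_jump]
      face_form_bilinear[OF face_cont_abs[OF face_cont_normal] trace_jump trace_jump]; assumption)+

lemma flux_matrix_form:
  "flux_matrix M \<phi> e = form_matrix \<phi> (\<lambda>u v. (- 1) * mean_flux e u v + 1 / 2 * penalty e u v)"
  "flux_matrix' M \<phi> e = form_matrix \<phi> (\<lambda>u v. 1 * mean_flux' e u v + 1 / 2 * penalty e u v)"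
  unfolding flux_matrix_def flux_matrix'_def mean_flux_def mean_flux'_def penalty_def by simp_all

lemma flux_matrix_inner:
  "d \<bullet> (flux_matrix M \<phi> e *v c) = - mean_flux e (fc c) (fc d) + 1 / 2 * penalty e (fc c) (fc d)"
  "d \<bullet> (flux_matrix' M \<phi> e *v c) = mean_flux' e (fc c) (fc d) + 1 / 2 * penalty e (fc c) (fc d)"
  unfolding flux_matrix_form
  using form_matrix_inner[OF bilinear_on_combine[OF face_forms_bilinear(1,3)], of d "-1" e "1/2" e
      c]
    form_matrix_inner[OF bilinear_on_combine[OF face_forms_bilinear(2,3)], of d 1 e "1/2" e c]
  by simp_all

lemma grad_matrix_inner: "d \<bullet> (grad_matrix M \<phi> j *v c) = grad_form (axis j 1) (fc c) (fc d)"
proof -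
  have "grad_matrix M \<phi> j = form_matrix \<phi> (grad_form (axis j 1))"
    unfolding grad_matrix_def grad_form_def ..
  then show ?thesis
    by (simp add: form_matrix_inner[OF grad_form_bilinear])
qed

lemma jump_face_cont: "\<Gamma> \<in> faces M \<Longrightarrow> face_cont \<Gamma> (jump (fc c) \<Gamma>)" "\<Gamma> \<in> faces M \<Longrightarrow> face_cont \<Gamma>
    (average (fc c) \<Gamma>)"
  using jump_cont[OF fc_U] face_contI by blast+

text \<open>Linearity in the direction is what separates this flux from the penalty, which depends
  on the direction through an absolute value. It cancels the flux in the angular mean and allows the
  direction to be split into coordinates.\<close>

lemma mean_flux_linear:
  "(\<Sum>i\<in>I. a i * mean_flux (e i) (fc c) (fc d)) = mean_flux (\<Sum>i\<in>I. a i *\<^sub>R e i) (fc c) (fc d)"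
proof (cases "finite I")
  case True
  have "(\<Sum>i\<in>I. a i * face_integral M \<Gamma> (\<lambda>x. (e i \<bullet> face_normal M \<Gamma> x) * jump (fc c) \<Gamma> x * average
      (fc d) \<Gamma> x))
    = face_integral M \<Gamma> (\<lambda>x. ((\<Sum>i\<in>I. a i *\<^sub>R e i) \<bullet> face_normal M \<Gamma> x) * jump (fc c) \<Gamma> x * average
        (fc d) \<Gamma> x)"
    if \<Gamma>: "\<Gamma> \<in> faces M" for \<Gamma>
  proof -
    have "(\<lambda>x. ((\<Sum>i\<in>I. a i *\<^sub>R e i) \<bullet> face_normal M \<Gamma> x) * jump (fc c) \<Gamma> x * average (fc d) \<Gamma> x)
      = (\<lambda>x. \<Sum>i\<in>I. a i * ((e i \<bullet> face_normal M \<Gamma> x) * jump (fc c) \<Gamma> x * average (fc d) \<Gamma> x))"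
      by (simp add: inner_sum_left sum_distrib_right mult.assoc)
    then show ?thesis
      by (simp add: face_integral_sum[OF \<Gamma> True] face_integral_cmult[OF \<Gamma>] face_cont_mult
          face_cont_const
          face_cont_normal[OF \<Gamma>] jump_face_cont[OF \<Gamma>])
  qed
  then show ?thesis
    unfolding mean_flux_def sum_distrib_left by (subst sum.swap) simp
next
  case False
  then show ?thesis
    by (simp add: mean_flux_def face_integral_zero)
qed

lemma vanishing_face_forms:
  assumes "continuous_vanishing M v"
  shows "penalty e u v = 0" "mean_flux' e u v = 0" "penalty e v u = 0" "mean_flux e v u = 0"
  unfolding penalty_def mean_flux'_def mean_flux_def
  by (rule sum.neutral, rule ballI, rule face_integral_zero, assumption, simp add:
      vanishing_traces(1)[OF assms])+

text \<open>With the continuous function as test function the penalty drops out, and the mean flux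
  is precisely the face term left by integration by parts.\<close>

lemma transport_vanishing:
  assumes c: "continuous_vanishing M (fc c)"
  shows "c \<bullet> (((\<Sum>j\<in>UNIV. e $ j *\<^sub>R grad_matrix M \<phi> j) + flux_matrix M \<phi> e) *v d)
    = - (\<Sum>j\<in>UNIV. e $ j * (d \<bullet> (grad_matrix M \<phi> j *v c)))"
proof -
  have e: "(\<Sum>j\<in>UNIV. e $ j *\<^sub>R axis j (1::real)) = e"
    using basis_expansion[of e] by (simp add: scalar_mult_eq_scaleR)
  have "c \<bullet> (((\<Sum>j\<in>UNIV. e $ j *\<^sub>R grad_matrix M \<phi> j) + flux_matrix M \<phi> e) *v d)
    = (\<Sum>j\<in>UNIV. e $ j * grad_form (axis j 1) (fc d) (fc c)) - mean_flux e (fc d) (fc c)"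
    by (simp add: matrix_vector_mult_add_rdistrib inner_add_right matrix_vector_mult_sum_left
        inner_sum_right
        scaleR_matrix_vector_assoc[symmetric] grad_matrix_inner flux_matrix_inner
            vanishing_face_forms[OF c])
  also have "mean_flux e (fc d) (fc c) = (\<Sum>j\<in>UNIV. e $ j * mean_flux (axis j 1) (fc d) (fc c))"
    by (simp add: mean_flux_linear e)
  also have "\<dots> = (\<Sum>j\<in>UNIV. e $ j * grad_form (axis j 1) (fc d) (fc c)) + (\<Sum>j\<in>UNIV. e $ j * grad_form
      (axis j 1) (fc c) (fc d))"
    unfolding mean_flux_def integration_by_parts[OF fc_U fc_U c, symmetric]
    by (simp add: distrib_left sum.distrib)
  finally show ?thesis
    by (simp add: grad_matrix_inner)
qed

text \<open>The mean fluxes add up to the flux in the mean direction, which is zero. The penalties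
  average to the weight \<open>alpha\<close>.\<close>

lemma F0_matrix_inner:
  fixes \<omega> :: "'d::finite \<Rightarrow> real^'n"
  assumes mean: "(\<Sum>d\<in>UNIV. w d *\<^sub>R \<omega> d) = 0"
  shows "b \<bullet> (F0_matrix M \<phi> \<omega> w *v c) = 1 / 2 * (\<Sum>\<Gamma>\<in>faces M. face_integral M \<Gamma>
    (\<lambda>x. alpha M \<omega> w \<Gamma> x * jump (fc c) \<Gamma> x * jump (fc b) \<Gamma> x))"
proof -
  have "(\<Sum>d\<in>UNIV. w d * mean_flux (\<omega> d) (fc c) (fc b)) = 0"
    unfolding mean_flux_linear mean by (simp add: mean_flux_def face_integral_zero)
  moreover have "1 / (4 * pi) * (\<Sum>d\<in>UNIV. w d * penalty (\<omega> d) (fc c) (fc b))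
    = (\<Sum>\<Gamma>\<in>faces M. face_integral M \<Gamma> (\<lambda>x. alpha M \<omega> w \<Gamma> x * jump (fc c) \<Gamma> x * jump (fc b) \<Gamma> x))"
  proof -
    have "1 / (4 * pi) * (\<Sum>d\<in>UNIV. w d * face_integral M \<Gamma> (\<lambda>x. \<bar>\<omega> d \<bullet> face_normal M \<Gamma> x\<bar> * jump (fc
        c) \<Gamma> x * jump (fc b) \<Gamma> x))
      = face_integral M \<Gamma> (\<lambda>x. alpha M \<omega> w \<Gamma> x * jump (fc c) \<Gamma> x * jump (fc b) \<Gamma> x)" if \<Gamma>: "\<Gamma> \<in>
          faces M" for \<Gamma>
    proof -
      have "(\<lambda>x. alpha M \<omega> w \<Gamma> x * jump (fc c) \<Gamma> x * jump (fc b) \<Gamma> x)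
        = (\<lambda>x. 1 / (4 * pi) * (\<Sum>d\<in>UNIV. w d * (\<bar>\<omega> d \<bullet> face_normal M \<Gamma> x\<bar> * jump (fc c) \<Gamma> x * jump
            (fc b) \<Gamma> x)))"
        by (simp add: alpha_def sum_distrib_right mult.assoc)
      then show ?thesis
        by (simp only: face_integral_cmult[OF \<Gamma>] face_integral_sum[OF \<Gamma> finite_class.finite_UNIV]
            face_cont_mult face_cont_const face_cont_abs face_cont_normal[OF \<Gamma>] jump_face_cont[OF
                \<Gamma>])
    qed
    then show ?thesis
      unfolding penalty_def sum_distrib_left by (subst sum.swap) simp
  qed
  moreover have "b \<bullet> (F0_matrix M \<phi> \<omega> w *v c) = 1 / (4 * pi) *
      (\<Sum>d\<in>UNIV. w d * (- mean_flux (\<omega> d) (fc c) (fc b) + 1 / 2 * penalty (\<omega> d) (fc c) (fc b)))"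
    by (simp add: F0_matrix_def scaleR_matrix_vector_assoc[symmetric] matrix_vector_mult_sum_left
        inner_sum_right
        flux_matrix_inner)
  moreover have "(\<Sum>d\<in>UNIV. w d * (- mean_flux (\<omega> d) (fc c) (fc b) + 1 / 2 * penalty (\<omega> d) (fc c) (fc
      b)))
    = - (\<Sum>d\<in>UNIV. w d * mean_flux (\<omega> d) (fc c) (fc b)) + 1 / 2 * (\<Sum>d\<in>UNIV. w d * penalty (\<omega> d) (fc
        c) (fc b))"
    unfolding sum_negf[symmetric] sum_distrib_left sum.distrib[symmetric]
    by (intro sum.cong refl) (simp add: algebra_simps)
  ultimately show ?thesis
    by simp
qed

lemma F0_matrix_symmetric:
  fixes \<omega> :: "'d::finite \<Rightarrow> real^'n"
  assumes mean: "(\<Sum>d\<in>UNIV. w d *\<^sub>R \<omega> d) = 0"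
  shows "transpose (F0_matrix M \<phi> \<omega> w) = F0_matrix M \<phi> \<omega> w"
proof -
  have "x \<bullet> (transpose (F0_matrix M \<phi> \<omega> w) *v y) = x \<bullet> (F0_matrix M \<phi> \<omega> w *v y)" for x y
  proof -
    have "x \<bullet> (transpose (F0_matrix M \<phi> \<omega> w) *v y) = y \<bullet> (F0_matrix M \<phi> \<omega> w *v x)"
      by (simp add: inner_commute[of x] dot_lmul_matrix)
    then show ?thesis
      by (simp add: F0_matrix_inner[OF mean] mult_ac)
  qed
  then show ?thesis
    by (metis matrix_eq vector_eq_ldot)
qed

text \<open>Tested with \<open>c\<close> itself, the form is a sum of nonnegative face integrals, so
  every integrand vanishes throughout its face. The weight \<open>alpha\<close>, the Jacobian
  determinant and the conormal are nonzero there, hence the jump is zero.\<close>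

lemma F0_matrix_kernel:
  fixes \<omega> :: "'d::finite \<Rightarrow> real^'n"
  assumes mean: "(\<Sum>d\<in>UNIV. w d *\<^sub>R \<omega> d) = 0"
    and alpha: "\<And>\<Gamma>. \<Gamma> \<in> faces M \<Longrightarrow> \<exists>c>0. \<forall>x\<in>face_set M \<Gamma>. alpha M \<omega> w \<Gamma> x \<ge> c"
  shows "F0_matrix M \<phi> \<omega> w *v c = 0 \<longleftrightarrow> continuous_vanishing M (fc c)"
proof
  assume "continuous_vanishing M (fc c)"
  then have "b \<bullet> (F0_matrix M \<phi> \<omega> w *v c) = 0" for b
    unfolding F0_matrix_inner[OF mean]
    by (subst sum.neutral) (auto intro!: face_integral_zero simp: vanishing_traces(1))
  then show "F0_matrix M \<phi> \<omega> w *v c = 0"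
    by (metis inner_eq_zero_iff)
next
  assume 0: "F0_matrix M \<phi> \<omega> w *v c = 0"
  define q where "q = (\<lambda>\<Gamma> x. alpha M \<omega> w \<Gamma> x * jump (fc c) \<Gamma> x * jump (fc c) \<Gamma> x)"
  define s where "s = (\<lambda>\<Gamma> y. q \<Gamma> (emap M (fst (lead \<Gamma>)) y) *
    (\<bar>det (jacobian (emap M (fst (lead \<Gamma>))) (at y))\<bar> * norm (conormal M (lead \<Gamma>) y)))"
  have mem: "emap M (fst (lead \<Gamma>)) y \<in> face_set M \<Gamma>" if "y \<in> snd (lead \<Gamma>)" for \<Gamma> y
    using that by (simp add: face_set_def side_set_def)
  have q0: "0 \<le> q \<Gamma> x" if \<Gamma>: "\<Gamma> \<in> faces M" and x: "x \<in> face_set M \<Gamma>" for \<Gamma> x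
  proof -
    have "0 \<le> alpha M \<omega> w \<Gamma> x"
      using alpha[OF \<Gamma>] x by (meson less_imp_le order_trans)
    then show ?thesis
      by (simp add: q_def mult.assoc)
  qed
  have s0: "0 \<le> s \<Gamma> y" if "\<Gamma> \<in> faces M" "y \<in> snd (lead \<Gamma>)" for \<Gamma> y
    unfolding s_def using q0[OF that(1) mem[OF that(2)]] by simp
  have fi: "face_integral M \<Gamma> (q \<Gamma>) = facet_integral (snd (lead \<Gamma>)) (ref_normal K (snd (lead \<Gamma>))) (s
      \<Gamma>)" for \<Gamma>
    by (simp add: face_integral_def Let_def s_def)
  have cont: "continuous_on (snd (lead \<Gamma>)) (s \<Gamma>)" if \<Gamma>: "\<Gamma> \<in> faces M" for \<Gamma>
    unfolding s_def
  proof (rule face_integrand_continuous[OF \<Gamma>])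
    show "face_cont \<Gamma> (q \<Gamma>)"
      unfolding q_def alpha_def
      by (intro face_cont_mult face_cont_const face_cont_sum face_cont_abs face_cont_normal
          jump_face_cont \<Gamma>)
  qed
  have nonneg: "0 \<le> face_integral M \<Gamma> (q \<Gamma>)" if \<Gamma>: "\<Gamma> \<in> faces M" for \<Gamma>
  proof -
    interpret F: polytope_facet K "snd (lead \<Gamma>)"
      by (rule facet_of_face[OF \<Gamma>])
    show ?thesis
      unfolding fi F.facet_integral_eq
      using F.facet_integrable[OF cont[OF \<Gamma>]] s0[OF \<Gamma>] F.mem_cylinder
      by (intro integral_nonneg) (auto simp: absolutely_integrable_on_def)
  qed
  have "(\<Sum>\<Gamma>\<in>faces M. face_integral M \<Gamma> (q \<Gamma>)) = 0"
    using F0_matrix_inner[OF mean, of c c] 0 by (simp add: q_def)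
  then have int0: "face_integral M \<Gamma> (q \<Gamma>) = 0" if "\<Gamma> \<in> faces M" for \<Gamma>
    using that nonneg finite_faces by (simp add: sum_nonneg_eq_0_iff)
  show "continuous_vanishing M (fc c)"
  proof (rule vanishing_jumps_imp_continuous[OF fc_U])
    fix \<Gamma> x assume \<Gamma>: "\<Gamma> \<in> faces M" and x: "x \<in> face_set M \<Gamma>"
    interpret F: polytope_facet K "snd (lead \<Gamma>)"
      by (rule facet_of_face[OF \<Gamma>])
    interpret E: curved_element K "emap M (fst (lead \<Gamma>))"
      using element lead_side[OF \<Gamma>] sides_iff by blast
    obtain y where y: "y \<in> snd (lead \<Gamma>)" "x = emap M (fst (lead \<Gamma>)) y"
      using x by (auto simp: face_set_def side_set_def)
    have "s \<Gamma> y = 0"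
      using F.facet_integral_zero[OF cont[OF \<Gamma>] s0[OF \<Gamma>] _ y(1)] int0[OF \<Gamma>] by (simp add: fi)
    moreover have "det (E.J y) \<noteq> 0"
      using E.J_invertible[of y] y(1) F.facet_subset by (auto simp: invertible_det_nz)
    moreover have "conormal M (lead \<Gamma>) y \<noteq> 0"
      by (rule conormal_nonzero[OF lead_side[OF \<Gamma>] y(1)])
    ultimately have "q \<Gamma> x = 0"
      by (simp add: s_def y(2))
    moreover have "alpha M \<omega> w \<Gamma> x \<noteq> 0"
      using alpha[OF \<Gamma>] x by fastforce
    ultimately show "jump (fc c) \<Gamma> x = 0"
      by (simp add: q_def)
  qed
qed

text \<open>The left factor \<open>B d\<close> turns into minus the transposed gradients. In the
  right factor the gradients meet the second moment, which gives the factor 1/3, and the fluxes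
  average to \<open>F1_matrix\<close>. These are the terms of \<open>D0_matrix\<close> that survive
  testing with a continuous function.\<close>

lemma second_order_remainder:
  fixes \<omega> :: "'d::finite \<Rightarrow> real^'n" and \<sigma>t \<sigma>a :: "real^'n \<Rightarrow> real"
  assumes second: "\<And>i j. (\<Sum>d\<in>UNIV. w d * (\<omega> d $ i * \<omega> d $ j)) = (if i = j then 4 * pi / 3 else 0)"
    and c: "continuous_vanishing M (fc c)"
  defines "B \<equiv> \<lambda>d. (\<Sum>j\<in>UNIV. \<omega> d $ j *\<^sub>R grad_matrix M \<phi> j) + flux_matrix M \<phi> (\<omega> d)"
    and "I \<equiv> matrix_inv (mass_matrix M \<phi> \<sigma>t)"
  shows "c \<bullet> (mass_matrix M \<phi> \<sigma>a *v x - (1 / (4 * pi)) *\<^sub>R (\<Sum>d\<in>UNIV. w d *\<^sub>R (B d *v (I *v (B d *v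
      x))))
     - D0_matrix M \<phi> \<sigma>t \<sigma>a \<omega> w *v x) = 0"
proof -
  let ?G = "grad_matrix M \<phi>"
  define g where "g = (\<lambda>j. ?G j *v c)"
  define X where "X = (\<lambda>j. I *v (?G j *v x))"
  define Y where "Y = (\<lambda>d. I *v (flux_matrix M \<phi> (\<omega> d) *v x))"
  have IB: "I *v (B d *v x) = (\<Sum>i\<in>UNIV. \<omega> d $ i *\<^sub>R X i) + Y d" for d
    by (simp add: B_def X_def Y_def matrix_vector_mult_add_rdistrib matrix_vector_right_distrib
        matrix_vector_mult_sum_left matrix_vector_mult_sum_right
            scaleR_matrix_vector_assoc[symmetric]
        matrix_vector_mult_scaleR)
  have cB: "c \<bullet> (B d *v q) = - (\<Sum>j\<in>UNIV. \<omega> d $ j * (q \<bullet> g j))" for d q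
    unfolding B_def g_def by (rule transport_vanishing[OF c])
  have "c \<bullet> (\<Sum>d\<in>UNIV. w d *\<^sub>R (B d *v (I *v (B d *v x))))
    = - (\<Sum>d\<in>UNIV. \<Sum>j\<in>UNIV. w d * \<omega> d $ j * (((\<Sum>i\<in>UNIV. \<omega> d $ i *\<^sub>R X i) + Y d) \<bullet> g j))"
    by (simp add: inner_sum_right cB IB sum_distrib_left sum_negf mult.assoc)
  also have "(\<Sum>d\<in>UNIV. \<Sum>j\<in>UNIV. w d * \<omega> d $ j * (((\<Sum>i\<in>UNIV. \<omega> d $ i *\<^sub>R X i) + Y d) \<bullet> g j))
    = (\<Sum>j\<in>UNIV. \<Sum>d\<in>UNIV. w d * \<omega> d $ j * (((\<Sum>i\<in>UNIV. \<omega> d $ i *\<^sub>R X i) + Y d) \<bullet> g j))"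
    by (rule sum.swap)
  also have "\<dots> = (\<Sum>j\<in>UNIV. 4 * pi / 3 * (X j \<bullet> g j) + 4 * pi * ((I *v (F1_matrix M \<phi> \<omega> w j *v x)) \<bullet>
      g j))"
  proof (rule sum.cong[OF refl])
    fix j :: 'n
    have "(\<Sum>d\<in>UNIV. w d * \<omega> d $ j * (((\<Sum>i\<in>UNIV. \<omega> d $ i *\<^sub>R X i) + Y d) \<bullet> g j))
      = (\<Sum>d\<in>UNIV. \<Sum>i\<in>UNIV. (w d * (\<omega> d $ i * \<omega> d $ j)) * (X i \<bullet> g j)) + (\<Sum>d\<in>UNIV. w d * \<omega> d $ j * (Y
          d \<bullet> g j))"
      by (simp add: inner_add_left inner_sum_left distrib_left sum.distrib sum_distrib_left mult_ac)
    also have "(\<Sum>d\<in>UNIV. \<Sum>i\<in>UNIV. (w d * (\<omega> d $ i * \<omega> d $ j)) * (X i \<bullet> g j))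
      = (\<Sum>i\<in>UNIV. (\<Sum>d\<in>UNIV. w d * (\<omega> d $ i * \<omega> d $ j)) * (X i \<bullet> g j))"
      by (subst sum.swap) (simp add: sum_distrib_right)
    also have "\<dots> = (\<Sum>i\<in>UNIV. if i = j then 4 * pi / 3 * (X i \<bullet> g j) else 0)"
      unfolding second by (intro sum.cong) auto
    also have "\<dots> = 4 * pi / 3 * (X j \<bullet> g j)"
      by simp
    also have "(\<Sum>d\<in>UNIV. w d * \<omega> d $ j * (Y d \<bullet> g j)) = 4 * pi * ((I *v (F1_matrix M \<phi> \<omega> w j *v x))
        \<bullet> g j)"
      by (simp add: F1_matrix_def Y_def scaleR_matrix_vector_assoc[symmetric]
          matrix_vector_mult_scaleR
          matrix_vector_mult_sum_left matrix_vector_mult_sum_right inner_sum_left)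
    finally show "(\<Sum>d\<in>UNIV. w d * \<omega> d $ j * (((\<Sum>i\<in>UNIV. \<omega> d $ i *\<^sub>R X i) + Y d) \<bullet> g j))
      = 4 * pi / 3 * (X j \<bullet> g j) + 4 * pi * ((I *v (F1_matrix M \<phi> \<omega> w j *v x)) \<bullet> g j)" .
  qed
  finally have eq: "c \<bullet> (\<Sum>d\<in>UNIV. w d *\<^sub>R (B d *v (I *v (B d *v x)))) =
      - (\<Sum>j\<in>UNIV. 4 * pi / 3 * (X j \<bullet> g j) + 4 * pi * ((I *v (F1_matrix M \<phi> \<omega> w j *v x)) \<bullet> g j))" .
  have Q: "(1 / (4 * pi)) * (c \<bullet> (\<Sum>d\<in>UNIV. w d *\<^sub>R (B d *v (I *v (B d *v x)))))
    = - (1 / 3 * (\<Sum>j\<in>UNIV. X j \<bullet> g j)) - (\<Sum>j\<in>UNIV. (I *v (F1_matrix M \<phi> \<omega> w j *v x)) \<bullet> g j)"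
    unfolding eq sum.distrib sum_distrib_left[symmetric] by (simp add: field_simps)
  have tr: "c \<bullet> (transpose (?G j) *v z) = z \<bullet> g j" for j z
    by (simp add: g_def inner_commute[of c] dot_lmul_matrix)
  \<comment> \<open>Here the jumps fall on the test function, which has none.\<close>
  have F1': "c \<bullet> (F1_matrix' M \<phi> \<omega> w j *v z) = 0" for j z
    by (simp add: F1_matrix'_def scaleR_matrix_vector_assoc[symmetric] matrix_vector_mult_sum_left
        inner_sum_right
        flux_matrix_inner vanishing_face_forms[OF c])
  have D0: "c \<bullet> (D0_matrix M \<phi> \<sigma>t \<sigma>a \<omega> w *v x) = 1 / 3 * (\<Sum>j\<in>UNIV. X j \<bullet> g j)
     + (\<Sum>j\<in>UNIV. (I *v (F1_matrix M \<phi> \<omega> w j *v x)) \<bullet> g j) + c \<bullet> (mass_matrix M \<phi> \<sigma>a *v x)"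
    unfolding D0_matrix_def Let_def I_def[symmetric]
    by (simp add: matrix_vector_mult_add_rdistrib matrix_vector_mult_diff_rdistrib
        matrix_vector_mult_sum_left
        scaleR_matrix_vector_assoc[symmetric] matrix_vector_mul_assoc[symmetric] inner_add_right
            inner_diff_right
        inner_sum_right tr F1' X_def del: transpose_matrix_vector)
  show ?thesis
    using Q D0 by (simp add: inner_diff_right)
qed

end

theorem theorem3p1:
  fixes M :: "(real^'n) mesh"
    and \<iota> :: "'n \<Rightarrow> 3"
    and r :: nat
    and A :: "('n \<Rightarrow> nat) set"
    and \<phi> :: "'N::finite \<Rightarrow> (real^'n) dgfun"
    and \<sigma>t \<sigma>a :: "real^'n \<Rightarrow> real"
    and \<Omega> :: "'d::finite \<Rightarrow> real^3"
    and w :: "'d \<Rightarrow> real"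
    and \<omega> :: "'d \<Rightarrow> real^'n"
    and P :: "real^'N^'N"
  assumes mesh: "valid_mesh M"
    and dimension: "inj \<iota>"
    and degree: "A = total_degree_exponents r \<or> A = tensor_degree_exponents r"
    and basis: "is_basis \<phi> (dg_space A M)"
    and sigma_t: "\<sigma>t absolutely_integrable_on dom M" "\<And>x. x \<in> dom M \<Longrightarrow> \<sigma>t x > 0"
    and sigma_a: "\<sigma>a absolutely_integrable_on dom M"
    and quadrature: "valid_quadrature M \<iota> \<Omega> w"
    and omega: "\<And>d. \<omega> d = spatial \<iota> (\<Omega> d)"
    and alpha_pos: "\<And>\<Gamma>. \<Gamma> \<in> faces M \<Longrightarrow> \<exists>c>0. \<forall>x\<in>face_set M \<Gamma>. alpha M \<omega> w \<Gamma> x \<ge> c"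
    and projection: "P ** P = P"
      "range (\<lambda>c. P *v c) = {c. continuous_vanishing M (from_coeffs \<phi> c)}"
    and invertible_PDP:
      "bij_betw (\<lambda>c. (transpose P ** D0_matrix M \<phi> \<sigma>t \<sigma>a \<omega> w ** P) *v c)
         (range (\<lambda>c. P *v c)) (range (\<lambda>c. transpose P *v c))"
  shows "\<exists>C. \<forall>\<^sub>F \<epsilon> in at_right 0.
           (\<forall>d. \<epsilon> * mat_norm (transport_matrix M \<phi> \<sigma>t (\<omega> d)) < 1) \<and>
           \<epsilon>\<^sup>2 * mat_norm (absorption_matrix M \<phi> \<sigma>t \<sigma>a) < 1 \<longrightarrow>
           invertible (\<epsilon>\<^sup>2 *\<^sub>R SIP_matrix M \<phi> \<sigma>t \<sigma>a \<omega> w \<epsilon>) \<and>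
           mat_norm
             (matrix_inv (\<epsilon>\<^sup>2 *\<^sub>R SIP_matrix M \<phi> \<sigma>t \<sigma>a \<omega> w \<epsilon>) **
                mass_matrix M \<phi> \<sigma>t ** (mat 1 - sweep_matrix M \<phi> \<sigma>t \<sigma>a \<omega> w \<epsilon>)
              - mat 1) \<le> C * \<epsilon>"
proof -
  interpret dg_mesh M A \<phi>
    by unfold_locales (fact mesh, fact basis)
  have w4: "(\<Sum>d\<in>UNIV. w d) = 4 * pi"
    and second3: "(\<Sum>d\<in>UNIV. w d *\<^sub>R (\<chi> i j. \<Omega> d $ i * \<Omega> d $ j)) = (4 * pi / 3) *\<^sub>R (mat 1 :: real^3^3)"
    and mean3: "(\<Sum>d\<in>UNIV. w d *\<^sub>R \<Omega> d) = 0"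
    using quadrature unfolding valid_quadrature_def by - (elim conjE, assumption)+
  have \<omega>: "\<omega> d $ j = \<Omega> d $ \<iota> j" for d j
    by (simp add: omega spatial_def)
  have mean_j: "(\<Sum>d\<in>UNIV. w d * \<omega> d $ j) = 0" for j
    using arg_cong[OF mean3, of "\<lambda>v. v $ \<iota> j"] by (simp add: \<omega>)
  then have mean: "(\<Sum>d\<in>UNIV. w d *\<^sub>R \<omega> d) = 0"
    by (simp add: vec_eq_iff)
  \<comment> \<open>Injectivity of \<iota> keeps different spatial coordinates different on the
    sphere, so the isotropy of the second moment is inherited.\<close>
  have second: "(\<Sum>d\<in>UNIV. w d * (\<omega> d $ i * \<omega> d $ j)) = (if i = j then 4 * pi / 3 else 0)" for i j
    using arg_cong[OF second3, of "\<lambda>A. A $ \<iota> i $ \<iota> j"] inj_eq[OF dimension, of i j]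
    by (cases "i = j") (simp_all add: \<omega> mat_def)
  define B where "B = (\<lambda>d. (\<Sum>j\<in>UNIV. \<omega> d $ j *\<^sub>R grad_matrix M \<phi> j) + flux_matrix M \<phi> (\<omega> d))"
  define Mt where "Mt = mass_matrix M \<phi> \<sigma>t"
  define Ma where "Ma = mass_matrix M \<phi> \<sigma>a"
  \<comment> \<open>The zero first moment removes the gradients, so averaging the full transport
    operators gives the same matrix as averaging the fluxes alone.\<close>
  have F0: "F0_matrix M \<phi> \<omega> w = (1 / (4 * pi)) *\<^sub>R (\<Sum>d\<in>UNIV. w d *\<^sub>R B d)"
  proof -
    have "(\<Sum>d\<in>UNIV. w d *\<^sub>R (\<Sum>j\<in>UNIV. \<omega> d $ j *\<^sub>R grad_matrix M \<phi> j))
      = (\<Sum>j\<in>UNIV. (\<Sum>d\<in>UNIV. w d * \<omega> d $ j) *\<^sub>R grad_matrix M \<phi> j)"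
      by (simp add: scaleR_sum_right scaleR_sum_left) (rule sum.swap)
    then show ?thesis
      by (simp add: F0_matrix_def B_def scaleR_right_distrib sum.distrib mean_j)
  qed
  have "transpose P *v (Ma *v x - (1 / (4 * pi)) *\<^sub>R
      (\<Sum>d\<in>UNIV. w d *\<^sub>R (B d *v (matrix_inv Mt *v (B d *v x)))) - D0_matrix M \<phi> \<sigma>t \<sigma>a \<omega> w *v x) = 0" for x
  proof -
    define z where "z = Ma *v x - (1 / (4 * pi)) *\<^sub>R
      (\<Sum>d\<in>UNIV. w d *\<^sub>R (B d *v (matrix_inv Mt *v (B d *v x)))) - D0_matrix M \<phi> \<sigma>t \<sigma>a \<omega> w *v x"
    \<comment> \<open>Moving \<open>transpose P\<close> to the other side leaves P y, the
      coefficient vector of a continuous function that vanishes on the boundary.\<close>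
    have "y \<bullet> (transpose P *v z) = 0" for y
    proof -
      have "continuous_vanishing M (from_coeffs \<phi> (P *v y))"
        using projection(2) by blast
      from second_order_remainder[OF second this]
      have "(P *v y) \<bullet> z = 0"
        unfolding z_def B_def Mt_def Ma_def .
      then show ?thesis
        by (simp add: inner_commute[of y] dot_lmul_matrix) (simp add: inner_commute)
    qed
    then show ?thesis
      unfolding z_def[symmetric] by (metis inner_eq_zero_iff)
  qed
  note rem = this
  have ker: "F0_matrix M \<phi> \<omega> w *v x = 0 \<longleftrightarrow> x \<in> range (\<lambda>c. P *v c)" for x
    using F0_matrix_kernel[OF mean alpha_pos] projection(2) by simp
  obtain C where "\<forall>\<^sub>F \<epsilon> in at_right 0.
      invertible (\<epsilon>\<^sup>2 *\<^sub>R ((1 / \<epsilon>) *\<^sub>R F0_matrix M \<phi> \<omega> w + D0_matrix M \<phi> \<sigma>t \<sigma>a \<omega> w)) \<and>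
      mat_norm (matrix_inv (\<epsilon>\<^sup>2 *\<^sub>R ((1 / \<epsilon>) *\<^sub>R F0_matrix M \<phi> \<omega> w + D0_matrix M \<phi> \<sigma>t \<sigma>a \<omega> w)) ** Mt **
        (mat 1 - (\<Sum>d\<in>UNIV. w d *\<^sub>R (matrix_inv (mat 1 + \<epsilon> *\<^sub>R (matrix_inv Mt ** B d)) **
         ((1 / (4 * pi)) *\<^sub>R (mat 1 - \<epsilon>\<^sup>2 *\<^sub>R (matrix_inv Mt ** Ma)))))) - mat 1) \<le> C * \<epsilon>"
    using preconditioned_sweep_asymptotics[OF _ w4 F0 F0_matrix_symmetric[OF mean] ker projection(1)
        bij_betw_imp_inj_on[OF invertible_PDP] rem] mass_matrix_invertible[OF sigma_t]
    unfolding Mt_def by blast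
  then show ?thesis
    unfolding SIP_matrix_def sweep_matrix_def transport_matrix_def absorption_matrix_def B_def Mt_def Ma_def
    by (intro exI[of _ C]) (auto elim: eventually_mono)
qed

end
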